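(* Let $c\in(0,1)$ and $l\in\{1,2\}$. The Hilbert space $\ell^2(\mathcal V)$ decomposes into an orthogonal sum of cyclic subspaces of $\mathcal L_c^{(l)}$ as follows: $$\ell^2(\mathcal V)=\mathfrak C_{c,l}^{(O)}\oplus\mathcal L,\qquad\mathcal L=\bigoplus_{Z\in\mathcal V}\widehat{\mathfrak C}_c^{(Z)}.$$
   Context: Intervals. $\Delta_i=[\alpha_i,\beta_i]$, $i=1,2$, are compact intervals with $\beta_1<\alpha_2$. For $c\in(0,1)$ let $(\omega_{c,1},\omega_{c,2})$ be the solution of the Angelesco vector equilibrium problem: the unique minimizer of $I(\nu_1,\nu_1)+I(\nu_2,\nu_2)+I(\nu_1,\nu_2)$, $I(\mu,\nu)=\iint\log\frac1{|x-y|}d\mu(x)d\nu(y)$, among positive Borel measures $\nu_i$ on $\Delta_i$ with total masses $c$ and $1-c$, respectively. The support of $\omega_{c,i}$ is an interval $\Delta_{c,i}=[\alpha_{c,i},\beta_{c,i}]\subseteq\Delta_i$. Riemann surface. $\mathfrak R_c$ is the 3-sheeted genus 0 Riemann surface obtained by gluing crosswise along the cuts a copy $\mathfrak R_c^{(0)}$ of $\overline{\mathbb C}$ cut along $\Delta_{c,1}\cup\Delta_{c,2}$, a copy $\mathfrak R_c^{(1)}$ cut along $\Delta_{c,1}$, and a copy $\mathfrak R_c^{(2)}$ cut along $\Delta_{c,2}$ (sheet $i$ is glued to sheet $0$ along $\Delta_{c,i}$). $z^{(i)}$ is the point of $\mathfrak R_c^{(i)}$ over $z$. $\chi_c$ is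 the conformal map of $\mathfrak R_c$ onto $\overline{\mathbb C}$ with $\chi_c(z^{(0)})=z+O(z^{-1})$ as $z\to\infty$; constants are defined by $\chi_c(z^{(i)})=B_{c,i}+A_{c,i}z^{-1}+O(z^{-2})$, $z\to\infty$, $i\in\{1,2\}$; $A_{c,1},A_{c,2}>0$. $M_c^{(l)}(\boldsymbol z)=1/(B_{c,l}-\chi_c(\boldsymbol z))$; $x_+^{(0)}=\lim_{y\to0^+}(x+iy)^{(0)}$. Tree and operators. $\mathcal V$ is the vertex set of the infinite rooted binary tree with root $O$. Each vertex has two children, one joined to it by an edge labelled type 1 and the other by an edge labelled type 2; the type $\ell_Y\in\{1,2\}$ of a vertex $Y\ne O$ is the type of the edge joining it to its parent. For $Y\neq O$, $$(\mathcal L_c^{(l)}\psi)_Y=\sum_{Y'\sim Y}\sqrt{A_{c,j(Y,Y')}}\,\psi_{Y'}+B_{c,\ell_Y}\psi_Y,\qquad(\mathcal L_c^{(l)}\psi)_O=\sum_{Y'\sim O}\sqrt{A_{c,j(O,Y')}}\,\psi_{Y'}+B_{c,l}\psi_O,$$ where $\sim$ denotes adjacency and $j(Y,Y')$ is the type of the edge. These are bounded self-adjoint operators on $\ell^2(\mathcal V)$. Cyclic subspaces. $\mathfrak C_{c,l}^{(O)}=\overline{\mathrm{span}\{(\mathcal L_c^{(l)})^n\delta^{(O)}:n\in\mathbb Z_+\}}$, with $\delta^{(O)}$ the Kronecker delta at $O$. For $x\in\Delta_{c,1}\cup\Delta_{c,2}$ and $i\in\{1,2\}$, $$\Psi_X^{(c,i)}(x)=\frac{1}{\Im\big(M_c^{(i)}(x_+^{(0)})\big)}\,\Im\Big(M_c^{(i)}(x_+^{(0)})\prod_{Y\in\mathrm{path}^*(X,O)}\big(-A_{c,\ell_Y}^{1/2}\big)M_c^{(\ell_Y)}(x_+^{(0)})\Big),$$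 where $\mathrm{path}^*(X,O)$ is the path from $O$ to $X$ including $X$ but excluding $O$. For $X\in\mathcal V$ with children $X_1,X_2$ of types 1, 2, let $\mathcal V_{[X_i]}$ be the set consisting of $X_i$ and its descendants, and let $\Psi^{(c)}(X_i;x)$ be $\Psi^{(c,i)}(x)$ transported from $\mathcal V$ to $\mathcal V_{[X_i]}$ by the natural type-preserving identification of the subtree rooted at $X_i$ with the whole tree. Put $\widehat\Psi_Y^{(c)}(X;x)=(-1)^iA_{c,i}^{-1/2}\Psi_Y^{(c)}(X_i;x)$ for $Y\in\mathcal V_{[X_i]}$, $i\in\{1,2\}$, and $\widehat\Psi^{(c)}_Y(X;x)=0$ otherwise. With $d\omega^{(c)}(x)=\sqrt{|(x-\alpha_{c,1})(x-\beta_{c,1})(x-\alpha_{c,2})(x-\beta_{c,2})|}\,dx$ on $\Delta_{c,1}\cup\Delta_{c,2}$, $$\widehat{\mathfrak C}_c^{(X)}=\Big\{\int\alpha(x)\widehat\Psi^{(c)}(X;x)\,d\omega^{(c)}(x):\alpha\in L^2(\omega^{(c)})\Big\}.$$ The infinite orthogonal sum is the Hilbert space (closed) direct sum. *)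

theory Defs
  imports "HOL-Analysis.Analysis" "HOL-Library.Landau_Symbols" "HOL-Library.Sublist"
begin

datatype idx = I1 | I2

(* The kernel is +infinity on the diagonal; note that ln 0 = 0 in HOL. *)
definition log_kernel :: "real \<Rightarrow> real \<Rightarrow> ereal" where
  "log_kernel x y = (if x = y then \<infinity> else ereal (ln (1 / \<bar>x - y\<bar>)))"

(* Integral of the positive part minus integral of the negative part (e2ennreal truncates
   negative values to 0).  The Bochner integral would assign 0 to measures of infinite energy.
   For finite measures on a compact set the negative part is finite, so the difference is the
   energy in (-infinity, +infinity]. *)
definition log_energy :: "real measure \<Rightarrow> real measure \<Rightarrow> ereal" where
  "log_energy \<mu> \<nu> =
     enn2ereal (\<integral>\<^sup>+x. (\<integral>\<^sup>+y. e2ennreal (log_kernel x y) \<partial>\<nu>) \<partial>\<mu>)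
     - enn2ereal (\<integral>\<^sup>+x. (\<integral>\<^sup>+y. e2ennreal (- log_kernel x y) \<partial>\<nu>) \<partial>\<mu>)"

definition angelesco_energy :: "(idx \<Rightarrow> real measure) \<Rightarrow> ereal" where
  "angelesco_energy \<nu> =
     log_energy (\<nu> I1) (\<nu> I1) + log_energy (\<nu> I2) (\<nu> I2) + log_energy (\<nu> I1) (\<nu> I2)"

fun angelesco_mass :: "real \<Rightarrow> idx \<Rightarrow> real" where
  "angelesco_mass c I1 = c"
| "angelesco_mass c I2 = 1 - c"

definition angelesco_admissible ::
  "(idx \<Rightarrow> real) \<Rightarrow> (idx \<Rightarrow> real) \<Rightarrow> real \<Rightarrow> (idx \<Rightarrow> real measure) \<Rightarrow> bool" where
  "angelesco_admissible \<alpha> \<beta> c \<nu> \<longleftrightarrow>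
     (\<forall>i. sets (\<nu> i) = sets borel \<and> emeasure (\<nu> i) (- {\<alpha> i..\<beta> i}) = 0 \<and>
          emeasure (\<nu> i) UNIV = ennreal (angelesco_mass c i))"

definition angelesco_equilibrium ::
  "(idx \<Rightarrow> real) \<Rightarrow> (idx \<Rightarrow> real) \<Rightarrow> real \<Rightarrow> (idx \<Rightarrow> real measure) \<Rightarrow> bool" where
  "angelesco_equilibrium \<alpha> \<beta> c \<omega> \<longleftrightarrow>
     angelesco_admissible \<alpha> \<beta> c \<omega> \<and>
     (\<forall>\<nu>. angelesco_admissible \<alpha> \<beta> c \<nu> \<longrightarrow> angelesco_energy \<omega> \<le> angelesco_energy \<nu>)"

definition measure_support :: "real measure \<Rightarrow> real set" where
  "measure_support \<mu> = {x. \<forall>U. open U \<and> x \<in> U \<longrightarrow> emeasure \<mu> U > 0}"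

type_synonym 'p chart = "'p set \<times> ('p \<Rightarrow> complex)"

definition holomorphic_map :: "'p chart set \<Rightarrow> 'q chart set \<Rightarrow> ('p \<Rightarrow> 'q) \<Rightarrow> bool" where
  "holomorphic_map \<A> \<B> f \<longleftrightarrow>
     (\<forall>(U, \<phi>) \<in> \<A>. \<forall>(V, \<psi>) \<in> \<B>.
        open (\<phi> ` (U \<inter> f -` V)) \<and>
        (\<lambda>w. \<psi> (f (inv_into U \<phi> w))) holomorphic_on \<phi> ` (U \<inter> f -` V))"

definition conformal_map ::
  "'p set \<Rightarrow> 'p chart set \<Rightarrow> 'q set \<Rightarrow> 'q chart set \<Rightarrow> ('p \<Rightarrow> 'q) \<Rightarrow> bool" where
  "conformal_map S \<A> T \<B> f \<longleftrightarrow>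
     bij_betw f S T \<and> holomorphic_map \<A> \<B> f \<and> holomorphic_map \<B> \<A> (inv_into S f)"

(* The Riemann sphere; None is the point at infinity. *)
type_synonym sphere = "complex option"

fun sphere_recip :: "sphere \<Rightarrow> complex" where
  "sphere_recip None = 0"
| "sphere_recip (Some z) = 1 / z"

definition sphere_atlas :: "sphere chart set" where
  "sphere_atlas = {(range Some, the), (UNIV - {Some 0}, sphere_recip)}"

datatype sheet = S0 | S idx

(* Three sheets with cuts [a i, b i], i = 1, 2; sheet 0 has both cuts and sheet i has the i-th.
   (k, Some z) is the point of sheet k over z if z is off the cuts of sheet k.  For x in the
   interior of a cut of sheet k, (k, Some x) is the point on the upper bank of that cut, i.e. the
   limit of (k, Some (x + iy)) as y tends to 0 from above.  The lower bank of the i-th cut on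
   sheet 0 is the upper bank on sheet i and vice versa.  A branch point is represented on
   sheet 0 only. *)
type_synonym spoint = "sheet \<times> sphere"

definition branch_points :: "(idx \<Rightarrow> real) \<Rightarrow> (idx \<Rightarrow> real) \<Rightarrow> complex set" where
  "branch_points a b = of_real ` (range a \<union> range b)"

definition surface :: "(idx \<Rightarrow> real) \<Rightarrow> (idx \<Rightarrow> real) \<Rightarrow> spoint set" where
  "surface a b =
     UNIV - {(S i, Some (of_real e)) |i e. e = a i \<or> e = b i}"

fun sheet_cut :: "(idx \<Rightarrow> real) \<Rightarrow> (idx \<Rightarrow> real) \<Rightarrow> sheet \<Rightarrow> complex set" where
  "sheet_cut a b S0 = of_real ` (\<Union>i. {a i..b i})"
| "sheet_cut a b (S i) = of_real ` {a i..b i}"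

definition sheet_charts :: "(idx \<Rightarrow> real) \<Rightarrow> (idx \<Rightarrow> real) \<Rightarrow> spoint chart set" where
  "sheet_charts a b =
     (\<Union>k. {({k} \<times> Some ` (- sheet_cut a b k), \<lambda>p. the (snd p)),
           ({k} \<times> (- Some ` (insert 0 (sheet_cut a b k))), \<lambda>p. sphere_recip (snd p))})"

(* Crosswise gluing: the coordinate z crosses the open i-th cut downwards from sheet k to
   sheet k'. *)
definition crossing_chart ::
  "(idx \<Rightarrow> real) \<Rightarrow> (idx \<Rightarrow> real) \<Rightarrow> idx \<Rightarrow> sheet \<Rightarrow> sheet \<Rightarrow> spoint chart" where
  "crossing_chart a b i k k' =
     ({k} \<times> Some ` ({z. Im z > 0} \<union> of_real ` {a i<..<b i}) \<union> {k'} \<times> Some ` {z. Im z < 0},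
      \<lambda>p. the (snd p))"

(* The square root on the plane cut along the nonnegative half-line, with upper boundary values
   on the cut.  (csqrt is cut along the nonpositive half-line and also has upper boundary values
   there.) *)
definition csqrt_pos_cut :: "complex \<Rightarrow> complex" where
  "csqrt_pos_cut z = (if Im z \<ge> 0 then csqrt z else - csqrt z)"

(* Coordinate sqrt(z - e) near the branch point e joining sheets 0 and i; the root r must have
   the cut of the sheets locally as its cut. *)
definition branch_charts ::
  "(idx \<Rightarrow> real) \<Rightarrow> (idx \<Rightarrow> real) \<Rightarrow> idx \<Rightarrow> real \<Rightarrow> (complex \<Rightarrow> complex) \<Rightarrow> spoint chart set" where
  "branch_charts a b i e r =
     {({S0} \<times> Some ` ball (of_real e) \<epsilon> \<union> {S i} \<times> Some ` (ball (of_real e) \<epsilon> - {of_real e}),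
       \<lambda>(k, p). (if k = S0 then 1 else -1) * r (the p - of_real e)) |\<epsilon>.
      \<epsilon> > 0 \<and> ball (of_real e) \<epsilon> \<inter> branch_points a b = {of_real e}}"

definition surface_atlas :: "(idx \<Rightarrow> real) \<Rightarrow> (idx \<Rightarrow> real) \<Rightarrow> spoint chart set" where
  "surface_atlas a b =
     sheet_charts a b
     \<union> (\<Union>i. {crossing_chart a b i S0 (S i), crossing_chart a b i (S i) S0})
     \<union> (\<Union>i. branch_charts a b i (a i) csqrt_pos_cut \<union> branch_charts a b i (b i) csqrt)"

definition normalized_conformal_map ::
  "(idx \<Rightarrow> real) \<Rightarrow> (idx \<Rightarrow> real) \<Rightarrow> (spoint \<Rightarrow> sphere) \<Rightarrow> bool" where
  "normalized_conformal_map a b chi \<longleftrightarrow>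
     conformal_map (surface a b) (surface_atlas a b) UNIV sphere_atlas chi \<and>
     (\<lambda>z. the (chi (S0, Some z)) - z) \<in> O[at_infinity](\<lambda>z. 1 / z)"

definition expansion_constants ::
  "(spoint \<Rightarrow> sphere) \<Rightarrow> (idx \<Rightarrow> real) \<Rightarrow> (idx \<Rightarrow> real) \<Rightarrow> bool" where
  "expansion_constants chi A B \<longleftrightarrow>
     (\<forall>i. (\<lambda>z. the (chi (S i, Some z)) - (of_real (B i) + of_real (A i) / z))
            \<in> O[at_infinity](\<lambda>z. 1 / z\<^sup>2))"

(* Complex-valued; the value at the pole, where chi = B l, is irrelevant because M is only
   used on the cuts, where chi is finite and non-real. *)
definition M_fun :: "(spoint \<Rightarrow> sphere) \<Rightarrow> (idx \<Rightarrow> real) \<Rightarrow> idx \<Rightarrow> spoint \<Rightarrow> complex" where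
  "M_fun chi B l p = (case chi p of None \<Rightarrow> 0 | Some w \<Rightarrow> 1 / (of_real (B l) - w))"

(* A vertex is the list of types of the edges on the path to the root, the most recent edge
   first: the root is [], the child of type i of X is i # X, the type of Y is hd Y, and the
   subtree at X consists of the lists W @ X. *)
type_synonym vertex = "idx list"

definition tree_adj :: "vertex \<Rightarrow> vertex \<Rightarrow> bool" where
  "tree_adj Y Y' \<longleftrightarrow> (\<exists>i. Y' = i # Y \<or> Y = i # Y')"

definition edge_type :: "vertex \<Rightarrow> vertex \<Rightarrow> idx" where
  "edge_type Y Y' = (if length Y < length Y' then hd Y' else hd Y)"

definition jacobi_op ::
  "(idx \<Rightarrow> real) \<Rightarrow> (idx \<Rightarrow> real) \<Rightarrow> idx \<Rightarrow> (vertex \<Rightarrow> complex) \<Rightarrow> vertex \<Rightarrow> complex" where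
  "jacobi_op A B l \<psi> Y =
     (\<Sum>Y' | tree_adj Y Y'. of_real (sqrt (A (edge_type Y Y'))) * \<psi> Y')
     + of_real (B (if Y = [] then l else hd Y)) * \<psi> Y"

definition l2 :: "('v \<Rightarrow> complex) set" where
  "l2 = {\<psi>. (\<lambda>Y. (cmod (\<psi> Y))\<^sup>2) summable_on UNIV}"

definition l2_inner :: "('v \<Rightarrow> complex) \<Rightarrow> ('v \<Rightarrow> complex) \<Rightarrow> complex" where
  "l2_inner \<phi> \<psi> = (\<Sum>\<^sub>\<infinity>Y. \<phi> Y * cnj (\<psi> Y))"

definition l2_norm :: "('v \<Rightarrow> complex) \<Rightarrow> real" where
  "l2_norm \<psi> = sqrt (\<Sum>\<^sub>\<infinity>Y. (cmod (\<psi> Y))\<^sup>2)"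

definition lin_span :: "('v \<Rightarrow> complex) set \<Rightarrow> ('v \<Rightarrow> complex) set" where
  "lin_span G = {\<lambda>Y. \<Sum>\<phi>\<in>F. k \<phi> * \<phi> Y |F k. finite F \<and> F \<subseteq> G}"

definition l2_closure :: "('v \<Rightarrow> complex) set \<Rightarrow> ('v \<Rightarrow> complex) set" where
  "l2_closure G = {\<psi> \<in> l2. \<forall>\<epsilon>>0. \<exists>\<phi>\<in>G \<inter> l2. l2_norm (\<lambda>Y. \<psi> Y - \<phi> Y) < \<epsilon>}"

definition closed_subspace :: "('v \<Rightarrow> complex) set \<Rightarrow> bool" where
  "closed_subspace E \<longleftrightarrow> lin_span E = E \<and> l2_closure E = E"

definition l2_orthogonal :: "('v \<Rightarrow> complex) set \<Rightarrow> ('v \<Rightarrow> complex) set \<Rightarrow> bool" where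
  "l2_orthogonal E F \<longleftrightarrow> (\<forall>\<phi>\<in>E. \<forall>\<psi>\<in>F. l2_inner \<phi> \<psi> = 0)"

definition orthogonal_sum ::
  "('v \<Rightarrow> complex) set \<Rightarrow> ('v \<Rightarrow> complex) set \<Rightarrow> ('v \<Rightarrow> complex) set \<Rightarrow> bool" where
  "orthogonal_sum H E F \<longleftrightarrow>
     closed_subspace E \<and> closed_subspace F \<and> l2_orthogonal E F \<and>
     H = {\<lambda>Y. \<phi> Y + \<psi> Y |\<phi> \<psi>. \<phi> \<in> E \<and> \<psi> \<in> F}"

definition hilbert_sum ::
  "('v \<Rightarrow> complex) set \<Rightarrow> ('i \<Rightarrow> ('v \<Rightarrow> complex) set) \<Rightarrow> bool" where
  "hilbert_sum H E \<longleftrightarrow>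
     (\<forall>i. closed_subspace (E i)) \<and> (\<forall>i j. i \<noteq> j \<longrightarrow> l2_orthogonal (E i) (E j)) \<and>
     H = l2_closure (lin_span (\<Union>i. E i))"

definition cyclic_subspace ::
  "(('v \<Rightarrow> complex) \<Rightarrow> 'v \<Rightarrow> complex) \<Rightarrow> ('v \<Rightarrow> complex) \<Rightarrow> ('v \<Rightarrow> complex) set" where
  "cyclic_subspace L g = l2_closure (lin_span (range (\<lambda>n. (L ^^ n) g)))"

definition is_cyclic_subspace ::
  "(('v \<Rightarrow> complex) \<Rightarrow> 'v \<Rightarrow> complex) \<Rightarrow> ('v \<Rightarrow> complex) set \<Rightarrow> bool" where
  "is_cyclic_subspace L E \<longleftrightarrow> (\<exists>g\<in>l2. E = cyclic_subspace L g)"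

definition delta :: "'v \<Rightarrow> 'v \<Rightarrow> complex" where
  "delta X Y = (if Y = X then 1 else 0)"

(* The ancestors of X, with X included, are the suffixes of X. *)
definition path_star :: "vertex \<Rightarrow> vertex set" where
  "path_star X = {Y. suffix Y X \<and> Y \<noteq> []}"

(* (S0, Some x) is x_+ on sheet 0. *)
definition Psi ::
  "(spoint \<Rightarrow> sphere) \<Rightarrow> (idx \<Rightarrow> real) \<Rightarrow> (idx \<Rightarrow> real) \<Rightarrow> idx \<Rightarrow> vertex \<Rightarrow> real \<Rightarrow> real" where
  "Psi chi A B i X x =
     1 / Im (M_fun chi B i (S0, Some (of_real x))) *
     Im (M_fun chi B i (S0, Some (of_real x)) *
         (\<Prod>Y\<in>path_star X. - of_real (sqrt (A (hd Y))) * M_fun chi B (hd Y) (S0, Some (of_real x))))"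

(* The identification of the whole tree with the subtree at i # X is W |-> W @ (i # X);
   the function below is used for vertices Y of that subtree only. *)
definition Psi_sub ::
  "(spoint \<Rightarrow> sphere) \<Rightarrow> (idx \<Rightarrow> real) \<Rightarrow> (idx \<Rightarrow> real) \<Rightarrow> idx \<Rightarrow> vertex \<Rightarrow> vertex \<Rightarrow> real \<Rightarrow> real" where
  "Psi_sub chi A B i X Y x = Psi chi A B i (THE W. Y = W @ (i # X)) x"

definition Psi_hat ::
  "(spoint \<Rightarrow> sphere) \<Rightarrow> (idx \<Rightarrow> real) \<Rightarrow> (idx \<Rightarrow> real) \<Rightarrow> vertex \<Rightarrow> vertex \<Rightarrow> real \<Rightarrow> real" where
  "Psi_hat chi A B X Y x =
     (if suffix (I1 # X) Y then - (1 / sqrt (A I1)) * Psi_sub chi A B I1 X Y x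
      else if suffix (I2 # X) Y then 1 / sqrt (A I2) * Psi_sub chi A B I2 X Y x
      else 0)"

definition omega_c :: "(idx \<Rightarrow> real) \<Rightarrow> (idx \<Rightarrow> real) \<Rightarrow> real measure" where
  "omega_c a b =
     density lborel (\<lambda>x. indicator (\<Union>i. {a i..b i}) x *
       ennreal (sqrt \<bar>(x - a I1) * (x - b I1) * (x - a I2) * (x - b I2)\<bar>))"

definition L2_fun :: "real measure \<Rightarrow> (real \<Rightarrow> complex) set" where
  "L2_fun \<mu> = {f. f \<in> borel_measurable \<mu> \<and> integrable \<mu> (\<lambda>x. (cmod (f x))\<^sup>2)}"

definition C_hat ::
  "(idx \<Rightarrow> real) \<Rightarrow> (idx \<Rightarrow> real) \<Rightarrow> (spoint \<Rightarrow> sphere) \<Rightarrow> (idx \<Rightarrow> real) \<Rightarrow> (idx \<Rightarrow> real) \<Rightarrow>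
   vertex \<Rightarrow> (vertex \<Rightarrow> complex) set" where
  "C_hat a b chi A B X =
     {\<lambda>Y. \<integral>x. f x * of_real (Psi_hat chi A B X Y x) \<partial>(omega_c a b) |f. f \<in> L2_fun (omega_c a b)}"

end

theory Submission
  imports Defs "HOL-Complex_Analysis.Complex_Analysis"
begin

text \<open>
  Let \<open>h(w) = w + A\<^sub>1/(w - B\<^sub>1) + A\<^sub>2/(w - B\<^sub>2)\<close>.  By Liouville's theorem \<open>h \<circ> \<chi>\<close> is the projection
  of the surface to the sphere, so \<open>\<chi>\<close> at the points over \<open>z\<close> runs through the roots of a cubic
  whose discriminant is \<open>(B\<^sub>1 - B\<^sub>2)\<^sup>2\<close> times the product of the \<open>z - e\<close> over the four branch
  points \<open>e\<close>.  Hence \<open>\<chi>(x\<^sub>+)\<close> is nonreal exactly inside the cuts, and \<open>\<Im> \<chi>(x\<^sub>+)\<close> is comparable with the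
  density of \<open>\<omega>\<^sup>c\<close>.  Substituting \<open>x = h(w)\<close> and integrating rational functions of \<open>w\<close> by the
  fundamental theorem of calculus shows that \<open>\<Im> M\<^sup>l(x\<^sub>+) dx / \<pi>\<close> is the spectral measure of the
  root and that \<open>f \<mapsto> \<integral> f \<Psi>\<^sub>X d\<omega>\<^sup>c\<close> maps \<open>L\<^sup>2\<close> onto the cyclic subspace of the root, bounded
  above and below.

  In a subtree with top \<open>X\<close> the cyclic subspace of \<open>X\<close> is spanned by \<open>\<delta>\<^sup>X\<close> and the vectors whose
  components in the two child subtrees have densities \<open>\<surd>A\<^sub>i u \<Im> M\<^sup>i\<close> with a common \<open>u\<close>; the space
  attached to \<open>X\<close> is its orthogonal complement in the span of \<open>\<delta>\<^sup>X\<close> and the cyclic subspaces of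
  the children.  Descending the tree, every \<open>\<delta>\<^sup>X\<close> lies in the sum.
\<close>

section \<open>Charts of the glued surface\<close>

text \<open>Three points shape the argument. \<open>A\<close> and \<open>B\<close> are given only by
  expansions at infinity, and it is left open which half-plane contains the boundary values of
  \<open>chi\<close> on a cut. So \<open>B I1 \<noteq> B I2\<close>, the signs of the
  \<open>A i\<close> and the order of the branch values among the \<open>B i\<close> must first be
  extracted from injectivity, the intermediate value theorem and reflection in the real axis; that
  order decides which logarithm contributes pi to a moment. Next, the transform built from
  \<open>Psi\<close> is not unitary on L^2(omega_c), since the spectral measure of the root is
  \<open>kap\<close> times omega_c and depends on the type of the root. Two-sided bounds for
  \<open>kap\<close> replace unitarity; they rest on the third root of the cubic keeping a positive
  distance from the conjugate pair, even at the ends of the cuts. Finally, the factor (-1)^i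
  A_i^(-1/2) in \<open>Psi_hat\<close> is dictated by the edges: what the two child subtrees send to
  their parent under the operator cancels, so the operator acts on the attached space as
  multiplication by x.\<close>

lemma UNIV_idx: "(UNIV :: idx set) = {I1, I2}"
  using idx.exhaust by auto

lemma ex_idx: "(\<exists>i. P i) \<longleftrightarrow> P I1 \<or> P I2"
  by (metis idx.exhaust)

lemma holomorphic_map_chart:
  assumes "holomorphic_map \<A> \<B> f" "(U, \<phi>) \<in> \<A>" "(V, \<psi>) \<in> \<B>"
  shows "open (\<phi> ` (U \<inter> f -` V))"
    and "(\<lambda>w. \<psi> (f (inv_into U \<phi> w))) holomorphic_on \<phi> ` (U \<inter> f -` V)"
  using assms unfolding holomorphic_map_def by blast+

text \<open>Openness of the chart image is part of \<open>holomorphic_map\<close>, so near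
  \<open>p\<close> the map \<open>f\<close> stays inside \<open>V\<close> and is represented by one
  holomorphic \<open>H\<close>. Later local arguments on the surface work with such an
  \<open>H\<close> on its neighbourhood \<open>W\<close>.\<close>

lemma holomorphic_map_chart_at:
  assumes "holomorphic_map \<A> \<B> f" "(U, \<phi>) \<in> \<A>" "(V, \<psi>) \<in> \<B>"
    and inj: "inj_on \<phi> U" and p: "p \<in> U" "f p \<in> V"
  obtains W H where "open W" "\<phi> p \<in> W" "H holomorphic_on W"
    "\<And>q. q \<in> U \<Longrightarrow> \<phi> q \<in> W \<Longrightarrow> f q \<in> V \<and> \<psi> (f q) = H (\<phi> q)"
proof
  let ?W = "\<phi> ` (U \<inter> f -` V)"
  show "open ?W" "(\<lambda>w. \<psi> (f (inv_into U \<phi> w))) holomorphic_on ?W"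
    using holomorphic_map_chart[OF assms(1-3)] by auto
  show "\<phi> p \<in> ?W" using p by auto
  show "f q \<in> V \<and> \<psi> (f q) = \<psi> (f (inv_into U \<phi> (\<phi> q)))" if "q \<in> U" "\<phi> q \<in> ?W" for q
    using that inj inj_on_eq_iff[OF inj] by (auto simp: inv_into_f_f)
qed

lemma sphere_atlas_charts:
  "(range Some, the) \<in> sphere_atlas" "(UNIV - {Some 0}, sphere_recip) \<in> sphere_atlas"
  by (auto simp: sphere_atlas_def)

lemma sheet_charts_in_atlas:
  "({k} \<times> Some ` (- sheet_cut a b k), \<lambda>p. the (snd p)) \<in> surface_atlas a b"
  "({k} \<times> (- Some ` (insert 0 (sheet_cut a b k))), \<lambda>p. sphere_recip (snd p)) \<in> surface_atlas a b"
  unfolding surface_atlas_def sheet_charts_def by blast+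

lemma crossing_chart_in_atlas:
  "crossing_chart a b i S0 (S i) \<in> surface_atlas a b"
  "crossing_chart a b i (S i) S0 \<in> surface_atlas a b"
  unfolding surface_atlas_def by blast+

lemma csqrt_pos_cut_sq: "(csqrt_pos_cut z)\<^sup>2 = z"
  by (simp add: csqrt_pos_cut_def)

text \<open>The nonzero values lie in the union of the upper half-plane and the positive half-line,
  a set disjoint from its negative. This keeps the coordinates of two sheets apart in a branch
  chart.\<close>

lemma csqrt_pos_cut_half: "csqrt_pos_cut z \<noteq> 0 \<Longrightarrow>
   Im (csqrt_pos_cut z) > 0 \<or> Im (csqrt_pos_cut z) = 0 \<and> Re (csqrt_pos_cut z) > 0"
proof -
  assume nz: "csqrt_pos_cut z \<noteq> 0"
  define u where "u = csqrt z"
  have u: "u\<^sup>2 = z" by (simp add: u_def)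
  have im: "Im z = 2 * Re u * Im u" using u by (auto simp: power2_eq_square)
  have pr: "0 < Re u \<or> Re u = 0 \<and> 0 \<le> Im u" unfolding u_def by (rule csqrt_principal)
  have u0: "u \<noteq> 0" using nz by (auto simp: csqrt_pos_cut_def u_def split: if_splits)
  show ?thesis
  proof (cases "Im z \<ge> 0")
    case True
    then have "csqrt_pos_cut z = u" by (simp add: csqrt_pos_cut_def u_def)
    moreover have "Im u > 0 \<or> Im u = 0 \<and> Re u > 0"
      using pr True im u0 by (auto simp: complex_eq_iff zero_le_mult_iff)
    ultimately show ?thesis by simp
  next
    case False
    then have "csqrt_pos_cut z = - u" by (simp add: csqrt_pos_cut_def u_def)
    moreover have "Im u < 0"
      using pr False im by (auto simp: complex_eq_iff zero_le_mult_iff not_le mult_less_0_iff)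
    ultimately show ?thesis by simp
  qed
qed

text \<open>A root whose values lie in a half-plane, so that \<open>r\<close> on one sheet and \<open>- r\<close> on the other form
  an injective chart.\<close>

definition half_root :: "(complex \<Rightarrow> complex) \<Rightarrow> bool" where
  "half_root r \<longleftrightarrow> (\<forall>z. (r z)\<^sup>2 = z) \<and> (\<forall>z z'. r z = - r z' \<longrightarrow> z = 0)"

lemma half_root_csqrt: "half_root csqrt"
proof -
  have *: "u = 0" if "0 < Re u \<or> Re u = 0 \<and> 0 \<le> Im u" "0 < Re v \<or> Re v = 0 \<and> 0 \<le> Im v" "u = - v" for u v
    using that by (auto simp: complex_eq_iff)
  have "z = 0" if "csqrt z = - csqrt z'" for z z'
    using *[OF csqrt_principal csqrt_principal that] by simp
  then show ?thesis by (auto simp: half_root_def)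
qed

lemma half_root_csqrt_pos_cut: "half_root csqrt_pos_cut"
proof -
  have "z = 0" if *: "csqrt_pos_cut z = - csqrt_pos_cut z'" for z z'
  proof (rule ccontr)
    assume "z \<noteq> 0"
    then have "csqrt_pos_cut z \<noteq> 0" using csqrt_pos_cut_sq[of z] by auto
    moreover from this have "csqrt_pos_cut z' \<noteq> 0" using * by auto
    ultimately show False using csqrt_pos_cut_half[of z] csqrt_pos_cut_half[of z'] * by auto
  qed
  then show ?thesis by (auto simp: half_root_def csqrt_pos_cut_sq)
qed

text \<open>Such a root jumps across its cut, so continuity cannot be used; the identity |r(z)|^2 =
  |z| alone gives the limit at the branch point.\<close>

lemma half_root_tendsto_0:
  assumes "half_root r" shows "((\<lambda>z. r (z - e)) \<longlongrightarrow> 0) (at e)"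
proof -
  have "cmod (r (z - e)) = sqrt (cmod (z - e))" for z
  proof -
    have "(cmod (r (z - e)))\<^sup>2 = cmod (z - e)"
      using assms by (metis half_root_def norm_power)
    then show ?thesis by (metis norm_ge_zero real_sqrt_unique)
  qed
  moreover have "((\<lambda>z. sqrt (cmod (z - e))) \<longlongrightarrow> sqrt (cmod (e - e))) (at e)"
    by (intro tendsto_intros)
  ultimately have "((\<lambda>z. cmod (r (z - e))) \<longlongrightarrow> 0) (at e)" by simp
  then show ?thesis by (rule tendsto_norm_zero_cancel)
qed

lemma one_over_at_infinity: "((\<lambda>z::complex. 1 / z) \<longlongrightarrow> 0) at_infinity"
  using tendsto_inverse_0[where 'a=complex] by (auto simp: inverse_eq_divide[abs_def])

section \<open>The conformal map inverts a rational function\<close>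

text \<open>Here the cuts are arbitrary ordered disjoint intervals; the final theorem links them to
  the equilibrium measures. \<open>B I1 \<noteq> B I2\<close> and \<open>A i > 0\<close> are
  consequences of conformality, proved as \<open>B_neq\<close> and \<open>A_pos\<close>.\<close>

locale surface_map =
  fixes a b :: "idx \<Rightarrow> real" and chi :: "spoint \<Rightarrow> sphere" and A B :: "idx \<Rightarrow> real"
  assumes cuts: "a I1 < b I1" "b I1 < a I2" "a I2 < b I2"
    and nrm: "normalized_conformal_map a b chi"
    and expan: "expansion_constants chi A B"
begin

lemma cut_less: "a i < b i" using cuts by (cases i) auto

lemma a_neq_b: "a i \<noteq> b j" "b j \<noteq> a i" "a i = a j \<longleftrightarrow> i = j" "b i = b j \<longleftrightarrow> i = j"
  using cuts by (cases i; cases j; auto)+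

definition bp :: "real set" where "bp = range a \<union> range b"

lemma bp_eq: "bp = {a I1, b I1, a I2, b I2}"
  unfolding bp_def UNIV_idx by auto

lemma finite_bp: "finite bp" by (simp add: bp_eq)

lemma branch_points_eq: "branch_points a b = of_real ` bp"
  by (simp add: branch_points_def bp_def)

lemma chi_bij: "bij_betw chi (surface a b) UNIV"
  and chi_hol: "holomorphic_map (surface_atlas a b) sphere_atlas chi"
  and inv_hol: "holomorphic_map sphere_atlas (surface_atlas a b) (inv_into (surface a b) chi)"
  using nrm by (auto simp: normalized_conformal_map_def conformal_map_def)

lemma chi_inj: "p \<in> surface a b \<Longrightarrow> q \<in> surface a b \<Longrightarrow> chi p = chi q \<Longrightarrow> p = q"
  using chi_bij by (auto simp: bij_betw_def inj_on_def)

abbreviation G where "G \<equiv> inv_into (surface a b) chi"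

lemma G_surface: "G s \<in> surface a b" and chi_G: "chi (G s) = s"
  using chi_bij by (auto simp: bij_betw_def inv_into_into f_inv_into_f)

lemma G_chi: "p \<in> surface a b \<Longrightarrow> G (chi p) = p"
  using chi_bij by (auto simp: bij_betw_def inv_into_f_f)

lemma in_surface: "(k, None) \<in> surface a b" "(S0, q) \<in> surface a b"
  "z \<notin> of_real ` bp \<Longrightarrow> (k, Some z) \<in> surface a b"
  by (auto simp: surface_def bp_def)

lemma surface_S: "(S i, Some (of_real e)) \<in> surface a b \<Longrightarrow> e \<noteq> a i \<and> e \<noteq> b i"
  unfolding surface_def by blast

lemma bp_in_cut: "x \<in> bp \<Longrightarrow> a i \<le> x \<Longrightarrow> x \<le> b i \<Longrightarrow> x = a i \<or> x = b i"
  using cuts by (cases i) (auto simp: bp_eq)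

lemma bounded_sheet_cut: "bounded (sheet_cut a b k)"
proof (cases k)
  case S0
  have "{x. \<exists>i. a i \<le> x \<and> x \<le> b i} = {a I1..b I1} \<union> {a I2..b I2}"
    by (auto simp: ex_idx)
  then show ?thesis by (auto simp: S0 Bex_def UNIV_idx intro!: bounded_linear_image bounded_linear_of_real)
next
  case (S i)
  then show ?thesis by (auto intro!: bounded_linear_image bounded_linear_of_real)
qed

section \<open>Values of \<open>chi\<close> at the three points at infinity\<close>

lemma eventually_off_cut: "eventually (\<lambda>z. z \<notin> insert 0 (sheet_cut a b k)) at_infinity"
proof -
  obtain R where R: "\<And>z. z \<in> insert 0 (sheet_cut a b k) \<Longrightarrow> cmod z \<le> R"
    using bounded_sheet_cut[of k] unfolding bounded_iff[of "sheet_cut a b k"]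
    by (metis (no_types, opaque_lifting) dual_order.trans insertE linorder_linear norm_zero)
  then show ?thesis unfolding eventually_at_infinity
    by (intro exI[of _ "R + 1"]) force
qed

lemma inj_recip: "inj_on (\<lambda>p. sphere_recip (snd p)) ({k} \<times> (- Some ` insert 0 C))"
proof (rule inj_onI)
  fix p q assume "p \<in> {k} \<times> (- Some ` insert 0 C)" "q \<in> {k} \<times> (- Some ` insert 0 C)"
    "sphere_recip (snd p) = sphere_recip (snd q)"
  then show "p = q" by (cases p; cases q; cases "snd p"; cases "snd q") auto
qed

text \<open>The expansions control \<open>chi\<close> only at large finite points. Continuity in the
  chart \<open>1 / z\<close> transfers their limits to the point at infinity itself.\<close>

lemma chi_at_None:
  assumes "chi (k, None) = Some w0"
  shows "((\<lambda>z. the (chi (k, Some z))) \<longlongrightarrow> w0) at_infinity"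
proof -
  obtain W H where W: "open W" "sphere_recip (snd (k, None :: complex option)) \<in> W"
    "H holomorphic_on W"
    and H: "\<And>q. q \<in> {k} \<times> (- Some ` (insert 0 (sheet_cut a b k))) \<Longrightarrow> sphere_recip (snd q) \<in> W \<Longrightarrow>
              chi q \<in> range Some \<and> the (chi q) = H (sphere_recip (snd q))"
    by (rule holomorphic_map_chart_at[OF chi_hol sheet_charts_in_atlas(2)[of k] sphere_atlas_charts(1) inj_recip,
          of "(k, None)"]) (use assms in auto)
  have 0: "0 \<in> W" using W by simp
  have "isCont H 0" using W 0 by (meson continuous_on_eq_continuous_at holomorphic_on_imp_continuous_on)
  moreover have "H 0 = w0" using H[of "(k, None)"] 0 assms by auto
  ultimately have "(H \<longlongrightarrow> w0) (nhds 0)" by (metis isCont_def tendsto_at_iff_tendsto_nhds)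
  then have lim: "((\<lambda>z. H (1 / z)) \<longlongrightarrow> w0) at_infinity"
    by (rule filterlim_compose) (rule one_over_at_infinity)
  have ev: "eventually (\<lambda>z. 1 / z \<in> W) at_infinity"
    by (rule topological_tendstoD[OF one_over_at_infinity W(1) 0])
  show ?thesis
  proof (rule Lim_transform_eventually[OF lim])
    show "eventually (\<lambda>z. H (1 / z) = the (chi (k, Some z))) at_infinity"
      using ev eventually_off_cut[of k]
    proof eventually_elim
      case (elim z)
      then have "Some z \<notin> Some ` insert 0 (sheet_cut a b k)" by blast
      then show ?case using H[of "(k, Some z)"] elim by auto
    qed
  qed
qed

lemma chi_S0_asymp: "((\<lambda>z. the (chi (S0, Some z)) - z) \<longlongrightarrow> 0) at_infinity"
proof -
  have "(\<lambda>z. the (chi (S0, Some z)) - z) \<in> O[at_infinity](\<lambda>z. 1 / z)"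
    using nrm by (simp add: normalized_conformal_map_def)
  moreover have "(\<lambda>z::complex. 1 / z) \<in> o[at_infinity](\<lambda>z. 1)"
    using one_over_at_infinity by (intro smalloI_tendsto) auto
  ultimately have "(\<lambda>z. the (chi (S0, Some z)) - z) \<in> o[at_infinity](\<lambda>z. 1)"
    by (rule landau_o.big_small_trans)
  from smalloD_tendsto[OF this] show ?thesis by simp
qed

lemma chi_S_asymp: "((\<lambda>z. (the (chi (S i, Some z)) - of_real (B i)) * z) \<longlongrightarrow> of_real (A i)) at_infinity"
proof -
  have "(\<lambda>z. the (chi (S i, Some z)) - (of_real (B i) + of_real (A i) / z)) \<in> O[at_infinity](\<lambda>z. 1 / z\<^sup>2)"
    using expan by (simp add: expansion_constants_def)
  then have "(\<lambda>z. z * (the (chi (S i, Some z)) - (of_real (B i) + of_real (A i) / z))) \<in> O[at_infinity](\<lambda>z. z * (1 / z\<^sup>2))"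
    by (intro landau_o.big.mult_left)
  moreover have "(\<lambda>z::complex. z * (1 / z\<^sup>2)) = (\<lambda>z. 1 / z)"
    by (auto simp: fun_eq_iff power2_eq_square)
  then have "(\<lambda>z::complex. z * (1 / z\<^sup>2)) \<in> o[at_infinity](\<lambda>z. 1)"
    using one_over_at_infinity by (intro smalloI_tendsto) auto
  ultimately have "(\<lambda>z. z * (the (chi (S i, Some z)) - (of_real (B i) + of_real (A i) / z))) \<in> o[at_infinity](\<lambda>z. 1)"
    by (rule landau_o.big_small_trans)
  from smalloD_tendsto[OF this]
  have "((\<lambda>z. z * (the (chi (S i, Some z)) - (of_real (B i) + of_real (A i) / z)) + of_real (A i)) \<longlongrightarrow> 0 + of_real (A i)) at_infinity"
    by (intro tendsto_intros) simp
  moreover have "\<forall>\<^sub>F z in at_infinity. z * (the (chi (S i, Some z)) - (of_real (B i) + of_real (A i) / z)) + of_real (A i) =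
      (the (chi (S i, Some z)) - of_real (B i)) * z"
    using eventually_off_cut[of S0] by eventually_elim (auto simp: field_simps)
  ultimately show ?thesis by (auto dest: Lim_transform_eventually)
qed

lemma chi_S_lim: "((\<lambda>z. the (chi (S i, Some z))) \<longlongrightarrow> of_real (B i)) at_infinity"
proof -
  have "((\<lambda>z. (the (chi (S i, Some z)) - of_real (B i)) * z * (1 / z) + of_real (B i)) \<longlongrightarrow>
     of_real (A i) * 0 + of_real (B i)) at_infinity"
    by (intro tendsto_intros chi_S_asymp one_over_at_infinity)
  moreover have "\<forall>\<^sub>F z in at_infinity. (the (chi (S i, Some z)) - of_real (B i)) * z * (1 / z) + of_real (B i) =
      the (chi (S i, Some z))"
    using eventually_off_cut[of S0] by eventually_elim (auto simp: field_simps)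
  ultimately show ?thesis by (auto dest: Lim_transform_eventually)
qed

text \<open>If the value were finite, then subtracting the remainder \<open>chi - z\<close>, which
  tends to 0, would make z itself converge at infinity.\<close>

lemma chi_S0_None: "chi (S0, None) = None"
proof (rule ccontr)
  assume "chi (S0, None) \<noteq> None"
  then obtain w0 where "chi (S0, None) = Some w0" by auto
  from tendsto_diff[OF chi_at_None[OF this] chi_S0_asymp]
  have "((\<lambda>z::complex. z) \<longlongrightarrow> w0) at_infinity" by simp
  moreover have "filterlim (\<lambda>z::complex. z) at_infinity at_infinity" by (rule filterlim_ident)
  ultimately show False
    by (metis not_tendsto_and_filterlim_at_infinity trivial_limit_at_infinity)
qed

lemma chi_S_None: "chi (S i, None) = Some (of_real (B i))"
proof (cases "chi (S i, None)")
  case None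
  then have "(S i, None) = (S0, None :: sphere)"
    by (intro chi_inj) (auto simp: in_surface chi_S0_None)
  then show ?thesis by auto
next
  case (Some w0)
  from tendsto_unique[OF trivial_limit_at_infinity chi_at_None[OF this] chi_S_lim] Some show ?thesis by auto
qed

lemma B_neq: "B I1 \<noteq> B I2"
proof
  assume "B I1 = B I2"
  then have "(S I1, None) = (S I2, None :: sphere)"
    by (intro chi_inj) (auto simp: in_surface chi_S_None)
  then show False by auto
qed

section \<open>The covering projection as a function of the value of \<open>chi\<close>\<close>

definition proj :: "complex \<Rightarrow> complex" where "proj w = the (snd (G (Some w)))"

lemma inj_the: "inj_on the (range Some)" by (auto simp: inj_on_def)

text \<open>\<open>chi\<close> takes the value \<open>B i\<close> at infinity on sheet i. In the
  chart \<open>1 / z\<close> there, \<open>1 / proj\<close> is holomorphic with value 0 at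
  \<open>B i\<close>. At \<open>B i\<close> itself \<open>proj\<close> is \<open>the None\<close>,
  so only the punctured neighbourhood carries information.\<close>

lemma proj_at_B:
  shows "filterlim proj at_infinity (at (of_real (B i)))"
    and "eventually (\<lambda>w. G (Some w) = (S i, Some (proj w))) (at (of_real (B i)))"
proof -
  let ?b = "complex_of_real (B i)"
  have g0: "G (Some ?b) = (S i, None)"
    using G_chi[OF in_surface(1)[of "S i"]] by (simp add: chi_S_None)
  obtain W H where W: "open W" "the (Some ?b) \<in> W" "H holomorphic_on W"
    and H: "\<And>q. q \<in> range Some \<Longrightarrow> the q \<in> W \<Longrightarrow>
        G q \<in> {S i} \<times> (- Some ` (insert 0 (sheet_cut a b (S i)))) \<and> sphere_recip (snd (G q)) = H (the q)"
    by (rule holomorphic_map_chart_at[OF inv_hol sphere_atlas_charts(1) sheet_charts_in_atlas(2)[of "S i"] inj_the,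
          of "Some ?b"]) (use g0 in auto)
  have bW: "?b \<in> W" using W by simp
  have H0: "H ?b = 0" using H[of "Some ?b"] bW g0 by auto
  have key: "G (Some w) = (S i, Some (proj w)) \<and> proj w \<noteq> 0 \<and> H w = 1 / proj w" if "w \<in> W" "w \<noteq> ?b" for w
  proof -
    from H[of "Some w"] that obtain q where q: "G (Some w) = (S i, q)" "q \<notin> Some ` (insert 0 (sheet_cut a b (S i)))"
      "sphere_recip q = H w" by (metis DiffE ComplD option.sel mem_Sigma_iff prod.collapse rangeI singletonD snd_conv)
    have "q \<noteq> None"
    proof
      assume "q = None"
      then have "Some w = Some ?b" using chi_G[of "Some w"] q chi_S_None by metis
      then show False using that by simp
    qed
    then obtain z where "q = Some z" by auto
    with q show ?thesis by (auto simp: proj_def)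
  qed
  have ev: "eventually (\<lambda>w. w \<in> W \<and> w \<noteq> ?b) (at ?b)"
    using W bW by (auto simp: eventually_at_topological)
  show "eventually (\<lambda>w. G (Some w) = (S i, Some (proj w))) (at ?b)"
    using ev by eventually_elim (use key in auto)
  have "isCont H ?b" using W bW by (meson continuous_on_eq_continuous_at holomorphic_on_imp_continuous_on)
  then have "(H \<longlongrightarrow> 0) (at ?b)" using H0 by (simp add: isCont_def)
  then have "((\<lambda>w. inverse (proj w)) \<longlongrightarrow> 0) (at ?b)"
    by (rule Lim_transform_eventually) (use ev in eventually_elim, use key in \<open>auto simp: inverse_eq_divide\<close>)
  then have "filterlim (\<lambda>w. inverse (proj w)) (at 0) (at ?b)"
    unfolding filterlim_at using ev key by (auto simp: o_def elim!: eventually_mono)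
  then show "filterlim proj at_infinity (at ?b)" by (simp add: filterlim_inverse_at_iff)
qed

text \<open>Substituting z = \<open>proj w\<close> in \<open>chi_S_asymp\<close> turns the
  coefficient \<open>A i\<close> of the expansion of \<open>chi\<close> into the residue of its
  inverse.\<close>

lemma proj_residue: "((\<lambda>w. (w - of_real (B i)) * proj w) \<longlongrightarrow> of_real (A i)) (at (of_real (B i)))"
proof (rule Lim_transform_eventually)
  show "((\<lambda>w. (the (chi (S i, Some (proj w))) - of_real (B i)) * proj w) \<longlongrightarrow> of_real (A i)) (at (of_real (B i)))"
    by (rule filterlim_compose[OF chi_S_asymp proj_at_B(1)])
  show "\<forall>\<^sub>F w in at (of_real (B i)). (the (chi (S i, Some (proj w))) - of_real (B i)) * proj w = (w - of_real (B i)) * proj w"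
    using proj_at_B(2)
  proof eventually_elim
    case (elim w)
    then have "chi (S i, Some (proj w)) = Some w" by (metis chi_G)
    then show ?case by simp
  qed
qed

text \<open>Charts \<open>1 / z\<close> on both sides show that \<open>proj w\<close> tends to
  infinity with w; then z = \<open>proj w\<close> may be inserted in the normalization of
  \<open>chi\<close> on sheet 0.\<close>

lemma proj_at_infinity: "((\<lambda>w. proj w - w) \<longlongrightarrow> 0) at_infinity"
proof -
  have g0: "G None = (S0, None)"
    using G_chi[OF in_surface(1)[of "S0"]] by (simp add: chi_S0_None)
  have inj: "inj_on sphere_recip (UNIV - {Some 0})"
    unfolding inj_on_def
  proof (intro ballI impI)
    fix p q assume "p \<in> UNIV - {Some 0}" "q \<in> UNIV - {Some 0}" "sphere_recip p = sphere_recip q"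
    then show "p = q" by (cases p; cases q) auto
  qed
  obtain W H where W: "open W" "sphere_recip None \<in> W" "H holomorphic_on W"
    and H: "\<And>q. q \<in> UNIV - {Some 0} \<Longrightarrow> sphere_recip q \<in> W \<Longrightarrow>
        G q \<in> {S0} \<times> (- Some ` (insert 0 (sheet_cut a b S0))) \<and> sphere_recip (snd (G q)) = H (sphere_recip q)"
    by (rule holomorphic_map_chart_at[OF inv_hol sphere_atlas_charts(2) sheet_charts_in_atlas(2)[of "S0"] inj,
          of None]) (use g0 in auto)
  have W0: "0 \<in> W" using W by simp
  have H0: "H 0 = 0" using H[of None] W0 g0 by auto
  have key: "G (Some w) = (S0, Some (proj w)) \<and> proj w \<noteq> 0 \<and> H (1 / w) = 1 / proj w" if "1 / w \<in> W" "w \<noteq> 0" for w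
  proof -
    from H[of "Some w"] that obtain q where q: "G (Some w) = (S0, q)" "q \<notin> Some ` (insert 0 (sheet_cut a b S0))"
      "sphere_recip q = H (1 / w)" by (cases "G (Some w)") auto
    have "q \<noteq> None"
    proof
      assume "q = None"
      then have "Some w = None" using chi_G[of "Some w"] q chi_S0_None by metis
      then show False by simp
    qed
    then obtain z where "q = Some z" by auto
    with q show ?thesis by (auto simp: proj_def)
  qed
  have ev: "eventually (\<lambda>w. 1 / w \<in> W \<and> w \<noteq> 0) at_infinity"
    using eventually_conj[OF topological_tendstoD[OF one_over_at_infinity W(1) W0] eventually_not_equal_at_infinity[of 0]] .
  have "isCont H 0" using W W0 by (meson continuous_on_eq_continuous_at holomorphic_on_imp_continuous_on)
  then have "((\<lambda>w. H (1 / w)) \<longlongrightarrow> H 0) at_infinity"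
    by (rule isCont_tendsto_compose[OF _ one_over_at_infinity])
  then have "((\<lambda>w. inverse (proj w)) \<longlongrightarrow> 0) at_infinity" unfolding H0
    by (rule Lim_transform_eventually) (use ev in eventually_elim, use key in \<open>auto simp: inverse_eq_divide\<close>)
  then have "filterlim (\<lambda>w. inverse (proj w)) (at 0) at_infinity"
    unfolding filterlim_at using ev key by (auto simp: o_def elim!: eventually_mono)
  then have inf: "filterlim proj at_infinity at_infinity" by (simp add: filterlim_inverse_at_iff)
  have "((\<lambda>w. - (the (chi (S0, Some (proj w))) - proj w)) \<longlongrightarrow> - 0) at_infinity"
    by (intro tendsto_minus filterlim_compose[OF chi_S0_asymp inf])
  moreover have "\<forall>\<^sub>F w in at_infinity. - (the (chi (S0, Some (proj w))) - proj w) = proj w - w"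
    using ev
  proof eventually_elim
    case (elim w)
    then have "chi (S0, Some (proj w)) = Some w" using key by (metis chi_G)
    then show ?case by simp
  qed
  ultimately have "((\<lambda>w. proj w - w) \<longlongrightarrow> - 0) at_infinity" by (rule Lim_transform_eventually)
  then show ?thesis by simp
qed

lemma branch_chart_ex:
  assumes "e \<in> bp"
  obtains i r \<epsilon> where "e = a i \<or> e = b i" "half_root r" "\<epsilon> > 0"
    "({S0} \<times> Some ` ball (of_real e) \<epsilon> \<union> {S i} \<times> Some ` (ball (of_real e) \<epsilon> - {of_real e}),
       \<lambda>(k, p). (if k = S0 then 1 else -1) * r (the p - of_real e)) \<in> surface_atlas a b"
proof -
  have "finite (complex_of_real ` bp)" using finite_bp by simp
  from finite_ball_avoid[OF open_UNIV this UNIV_I] obtain \<epsilon> where \<epsilon>: "\<epsilon> > 0"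
    "\<forall>w\<in>ball (complex_of_real e) \<epsilon>. w \<noteq> of_real e \<longrightarrow> w \<notin> complex_of_real ` bp" by blast
  have av: "ball (complex_of_real e) \<epsilon> \<inter> branch_points a b = {complex_of_real e}"
    using \<epsilon> assms unfolding branch_points_eq by auto
  from assms obtain i where "e = a i \<or> e = b i" by (auto simp: bp_def)
  then show ?thesis
  proof
    assume e: "e = a i"
    show ?thesis
      by (rule that[of i csqrt_pos_cut \<epsilon>])
        (use e \<epsilon> av half_root_csqrt_pos_cut in \<open>auto simp: surface_atlas_def branch_charts_def\<close>)
  next
    assume e: "e = b i"
    show ?thesis
      by (rule that[of i csqrt \<epsilon>])
        (use e \<epsilon> av half_root_csqrt in \<open>auto simp: surface_atlas_def branch_charts_def\<close>)
  qed
qed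

text \<open>In every chart the projection is an entire function F of the coordinate: the identity on
  a sheet and across a cut, and e + w^2 at a branch point e, where the coordinate is a root. The
  last case arises with \<open>k = S0\<close> only, because a branch point is represented on sheet
  0.\<close>

lemma proj_holomorphic_at:
  assumes g: "G (Some w0) = (k, Some z)"
  shows "proj field_differentiable at w0"
proof -
  have *: ?thesis if UA: "(U, \<phi>) \<in> surface_atlas a b" and kU: "(k, Some z) \<in> U"
      and fp: "F holomorphic_on UNIV" "\<And>q. q \<in> U \<Longrightarrow> the (snd q) = F (\<phi> q)" for U \<phi> F
  proof -
    obtain W H where W: "open W" "the (Some w0) \<in> W" "H holomorphic_on W"
      and H: "\<And>q. q \<in> range Some \<Longrightarrow> the q \<in> W \<Longrightarrow> G q \<in> U \<and> \<phi> (G q) = H (the q)"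
      by (rule holomorphic_map_chart_at[OF inv_hol sphere_atlas_charts(1) UA inj_the,
          of "Some w0"]) (use g kU in auto)
    have "F \<circ> H holomorphic_on W"
      by (intro holomorphic_on_compose W holomorphic_on_subset[OF fp(1)]) auto
    then have "proj holomorphic_on W"
      by (rule holomorphic_transform) (use H fp(2) in \<open>auto simp: proj_def\<close>)
    then show ?thesis using W by (auto simp: holomorphic_on_def at_within_open_NO_MATCH)
  qed
  show ?thesis
  proof (cases "z \<in> sheet_cut a b k")
    case False
    then show ?thesis by (intro *[OF sheet_charts_in_atlas(1)[of k], of "\<lambda>w. w"]) auto
  next
    case True
    then obtain i x where ix: "z = of_real x" "a i \<le> x" "x \<le> b i" "k = S0 \<or> k = S i"
      by (cases k) auto
    show ?thesis
    proof (cases "x \<in> bp")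
      case False
      then have "x \<in> {a i<..<b i}" using ix by (auto simp: bp_def less_le)
      then have "(k, Some z) \<in> fst (crossing_chart a b i k (if k = S0 then S i else S0))"
        using ix by (auto simp: crossing_chart_def)
      moreover have "(fst (crossing_chart a b i k (if k = S0 then S i else S0)), \<lambda>p. the (snd p)) \<in> surface_atlas a b"
        using ix crossing_chart_in_atlas[of a b i] by (auto simp: crossing_chart_def)
      ultimately show ?thesis by (intro *[of _ _ "\<lambda>w. w"]) auto
    next
      case True
      then have "x = a i \<or> x = b i" using ix by (intro bp_in_cut)
      then have k: "k = S0" using surface_S[of i x] G_surface[of "Some w0"] g ix by auto
      obtain i r \<epsilon> where c: "x = a i \<or> x = b i" "half_root r" "\<epsilon> > 0"
        "({S0} \<times> Some ` ball (of_real x) \<epsilon> \<union> {S i} \<times> Some ` (ball (of_real x) \<epsilon> - {of_real x}),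
       \<lambda>(k, p). (if k = S0 then 1 else -1) * r (the p - complex_of_real x)) \<in> surface_atlas a b"
        by (rule branch_chart_ex[OF True])
      have r: "r (z - of_real x) * r (z - of_real x) = z - of_real x" for z
        using c(2) by (simp add: half_root_def power2_eq_square)
      show ?thesis
        by (rule *[OF c(4), of "\<lambda>w. of_real x + w * w"]) (use k ix c r in \<open>auto intro!: holomorphic_intros\<close>)
    qed
  qed
qed

text \<open>Subtracting w and the two principal parts leaves a function F with removable
  singularities that vanishes at infinity. Removability is checked through (w - b) F(w) tending to
  0, which is the residue computation of \<open>proj_residue\<close>.\<close>

lemma proj_eq:
  assumes "w \<noteq> of_real (B I1)" "w \<noteq> of_real (B I2)"
  shows "proj w = w + of_real (A I1) / (w - of_real (B I1)) + of_real (A I2) / (w - of_real (B I2))"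
proof -
  define b1 b2 a1 a2 where "b1 = complex_of_real (B I1)" "b2 = complex_of_real (B I2)"
    "a1 = complex_of_real (A I1)" "a2 = complex_of_real (A I2)"
  note d = this
  have b12: "b1 \<noteq> b2" using B_neq by (simp add: d)
  define F where "F w = proj w - w - a1 / (w - b1) - a2 / (w - b2)" for w
  have dproj: "proj field_differentiable at w" if w: "w \<noteq> b1" "w \<noteq> b2" for w
  proof (cases "G (Some w)")
    case (Pair k p)
    have "p \<noteq> None"
    proof
      assume "p = None"
      then have "chi (k, None) = Some w" using Pair chi_G[of "Some w"] by simp
      moreover obtain i where "k = S i" using calculation chi_S0_None by (cases k) auto
      ultimately show False using w chi_S_None[of i] d by (cases i) auto
    qed
    then show ?thesis using Pair proj_holomorphic_at by auto
  qed
  have holF: "F holomorphic_on UNIV - {b1, b2}"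
  proof -
    have "proj holomorphic_on UNIV - {b1, b2}"
      unfolding holomorphic_on_def by (intro ballI, rule field_differentiable_at_within, rule dproj) simp_all
    then show ?thesis unfolding F_def by (intro holomorphic_intros) simp_all
  qed
  have pr: "((\<lambda>w. (w - b1) * proj w) \<longlongrightarrow> a1) (at b1)" "((\<lambda>w. (w - b2) * proj w) \<longlongrightarrow> a2) (at b2)"
    unfolding d by (rule proj_residue)+
  have z0: "((\<lambda>w. (w - u) * q w) \<longlongrightarrow> 0) (at u)" if "isCont q u" for q and u :: complex
  proof -
    have "isCont (\<lambda>w. (w - u) * q w) u" using that by (intro continuous_intros)
    then show ?thesis by (simp add: isCont_def)
  qed
  have zlim: "((\<lambda>w. (w - b1) * w) \<longlongrightarrow> 0) (at b1)" "((\<lambda>w. (w - b1) * (a2 / (w - b2))) \<longlongrightarrow> 0) (at b1)"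
    "((\<lambda>w. (w - b2) * w) \<longlongrightarrow> 0) (at b2)" "((\<lambda>w. (w - b2) * (a1 / (w - b1))) \<longlongrightarrow> 0) (at b2)"
    using b12 by (intro z0 continuous_intros; simp)+
  have lim1: "((\<lambda>w. (w - b1) * F w) \<longlongrightarrow> 0) (at b1)"
  proof (rule Lim_transform_eventually)
    show "((\<lambda>w. (w - b1) * proj w - (w - b1) * w - a1 - (w - b1) * (a2 / (w - b2))) \<longlongrightarrow> 0) (at b1)"
      using tendsto_diff[OF tendsto_diff[OF tendsto_diff[OF pr(1) zlim(1)] tendsto_const[of a1]] zlim(2)] by simp
    show "\<forall>\<^sub>F w in at b1. (w - b1) * proj w - (w - b1) * w - a1 - (w - b1) * (a2 / (w - b2)) = (w - b1) * F w"
      unfolding eventually_at_filter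
    proof (intro always_eventually allI impI)
      fix w assume "w \<noteq> b1"
      then have "(w - b1) * (a1 / (w - b1)) = a1" by simp
      then show "(w - b1) * proj w - (w - b1) * w - a1 - (w - b1) * (a2 / (w - b2)) = (w - b1) * F w" by (simp only: F_def right_diff_distrib)
    qed
  qed
  have lim2: "((\<lambda>w. (w - b2) * F w) \<longlongrightarrow> 0) (at b2)"
  proof (rule Lim_transform_eventually)
    show "((\<lambda>w. (w - b2) * proj w - (w - b2) * w - (w - b2) * (a1 / (w - b1)) - a2) \<longlongrightarrow> 0) (at b2)"
      using tendsto_diff[OF tendsto_diff[OF tendsto_diff[OF pr(2) zlim(3)] zlim(4)] tendsto_const[of a2]] by simp
    show "\<forall>\<^sub>F w in at b2. (w - b2) * proj w - (w - b2) * w - (w - b2) * (a1 / (w - b1)) - a2 = (w - b2) * F w"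
      unfolding eventually_at_filter
    proof (intro always_eventually allI impI)
      fix w assume "w \<noteq> b2"
      then have "(w - b2) * (a2 / (w - b2)) = a2" by simp
      then show "(w - b2) * proj w - (w - b2) * w - (w - b2) * (a1 / (w - b1)) - a2 = (w - b2) * F w" by (simp only: F_def right_diff_distrib)
    qed
  qed
  \<comment> \<open>The singularities are removed one at a time: \<open>g1\<close> extends F over
    \<open>b1\<close>, and \<open>g\<close> extends \<open>g1\<close> over
    \<open>b2\<close>.\<close>
  have "(\<exists>g. g holomorphic_on - {b2} \<and> (\<forall>z\<in>- {b2} - {b1}. g z = F z))"
  proof (subst holomorphic_on_extend_lim)
    have "- {b2} - {b1} = UNIV - {b1, b2}" by auto
    then show "F holomorphic_on - {b2} - {b1}" using holF by simp
    have "open (- {b2})" by (intro open_Compl closed_singleton)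
    then show "b1 \<in> interior (- {b2})" using b12 by (simp add: interior_open)
  qed (rule lim1)
  then obtain g1 where g1: "g1 holomorphic_on - {b2}" "\<And>z. z \<noteq> b2 \<Longrightarrow> z \<noteq> b1 \<Longrightarrow> g1 z = F z" by auto
  have "((\<lambda>w. (w - b2) * g1 w) \<longlongrightarrow> 0) (at b2)"
  proof (rule Lim_transform_eventually[OF lim2])
    have "\<forall>\<^sub>F w in at b2. w \<noteq> b1" using b12 by (simp add: eventually_neq_at_within)
    then have "\<forall>\<^sub>F w in at b2. w \<noteq> b1 \<and> w \<noteq> b2" using eventually_neq_at_within[of b2 b2 UNIV]
      by (rule eventually_conj)
    then show "\<forall>\<^sub>F w in at b2. (w - b2) * F w = (w - b2) * g1 w"
      by eventually_elim (use g1 in auto)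
  qed
  then have "(\<exists>g. g holomorphic_on UNIV \<and> (\<forall>z\<in>UNIV - {b2}. g z = g1 z))"
    by (subst holomorphic_on_extend_lim) (use g1(1) in \<open>simp_all add: Compl_eq_Diff_UNIV\<close>)
  then obtain g where g: "g holomorphic_on UNIV" "\<And>z. z \<noteq> b2 \<Longrightarrow> g z = g1 z" by auto
  have ainf: "((\<lambda>w. c / (w - d)) \<longlongrightarrow> 0) at_infinity" for c d :: complex
    by (rule tendsto_divide_0[OF tendsto_const])
      (use tendsto_add_filterlim_at_infinity'[OF filterlim_ident tendsto_const[of "- d"]] in simp)
  have "((\<lambda>w. proj w - w - a1 / (w - b1) - a2 / (w - b2)) \<longlongrightarrow> 0 - 0 - 0) at_infinity"
    by (intro tendsto_diff proj_at_infinity ainf)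
  then have "(F \<longlongrightarrow> 0) at_infinity" by (simp add: F_def[abs_def])
  moreover have "\<forall>\<^sub>F w in at_infinity. F w = g w"
    using eventually_conj[OF eventually_not_equal_at_infinity[of b1] eventually_not_equal_at_infinity[of b2]]
    by eventually_elim (use g g1 in auto)
  ultimately have "(g \<longlongrightarrow> 0) at_infinity" by (rule Lim_transform_eventually)
  then have "g w = 0" using Liouville_weak_0 g by blast
  then have "F w = 0" using g g1 assms by (auto simp: d)
  then show ?thesis by (simp add: F_def d algebra_simps)
qed

end

section \<open>The discriminant and the real structure\<close>

text \<open>Vieta's formulas with the third root written as -p - x - y. Subtracting the two
  equations and cancelling x - y gives q, and then s.\<close>

lemma cubic_two_roots:
  fixes x y p q s :: "'a::field"
  assumes "x \<noteq> y" "x^3 + p * x^2 + q * x + s = 0" "y^3 + p * y^2 + q * y + s = 0"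
  shows "q = x * y + x * (-p - x - y) + y * (-p - x - y)" "s = - (x * y * (-p - x - y))"
proof -
  have "(x - y) * (x^2 + x * y + y^2 + p * (x + y) + q) = 0"
    using assms(2,3) by algebra
  then have "x^2 + x * y + y^2 + p * (x + y) + q = 0" using assms(1) by simp
  then show "q = x * y + x * (-p - x - y) + y * (-p - x - y)" by algebra
  then show "s = - (x * y * (-p - x - y))" using assms(2) by algebra
qed

text \<open>The difference of the two sides, \<open>P\<close>, has degree at most 3 because the
  leading terms cancel, and four distinct zeros.\<close>

lemma quartic_four_roots:
  fixes c :: "'a::field_char_0"
  assumes root: "\<And>z. z \<in> {e1, e2, e3, e4} \<Longrightarrow> c0 + c1 * z + c2 * z^2 + c3 * z^3 + c * z^4 = 0"
    and "distinct [e1, e2, e3, e4]"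
  shows "c0 + c1 * z + c2 * z^2 + c3 * z^3 + c * z^4 = c * ((z - e1) * (z - e2) * (z - e3) * (z - e4))"
proof -
  define P where "P = [:c0 - c * (e1 * e2 * e3 * e4), c1 + c * (e1*e2*e3 + e1*e2*e4 + e1*e3*e4 + e2*e3*e4),
     c2 - c * (e1*e2 + e1*e3 + e1*e4 + e2*e3 + e2*e4 + e3*e4), c3 + c * (e1 + e2 + e3 + e4):]"
  have P: "poly P z = c0 + c1 * z + c2 * z^2 + c3 * z^3 + c * z^4 - c * ((z - e1) * (z - e2) * (z - e3) * (z - e4))" for z
    unfolding P_def by (simp add: algebra_simps power2_eq_square power3_eq_cube power4_eq_xxxx)
  have "P = 0"
  proof (rule ccontr)
    assume nz: "P \<noteq> 0"
    have "card {e1, e2, e3, e4} \<le> card {z. poly P z = 0}"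
      by (rule card_mono) (use poly_roots_finite[OF nz] root in \<open>auto simp: P\<close>)
    also have "\<dots> \<le> degree P" by (rule card_poly_roots_bound[OF nz])
    also have "\<dots> \<le> 3" by (simp add: P_def)
    finally show False using assms(2) by auto
  qed
  then show ?thesis using P[of z] by simp
qed

definition cubic_disc :: "'a::comm_ring_1 \<Rightarrow> 'a \<Rightarrow> 'a \<Rightarrow> 'a" where
  "cubic_disc p q s = p^2 * q^2 - 4 * q^3 - 4 * p^3 * s + 18 * p * q * s - 27 * s^2"

lemma cubic_disc_roots:
  fixes x y p q s :: "'a::field"
  assumes "x \<noteq> y" "x^3 + p * x^2 + q * x + s = 0" "y^3 + p * y^2 + q * y + s = 0"
  shows "cubic_disc p q s = ((x - y) * (x - (-p - x - y)) * (y - (-p - x - y)))^2"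
proof -
  define t where "t = - p - x - y"
  have p: "p = - (x + y + t)" by (simp add: t_def)
  have "q = x * y + x * t + y * t" "s = - (x * y * t)"
    using cubic_two_roots[OF assms] unfolding t_def[symmetric] by auto
  then show ?thesis unfolding t_def[symmetric] unfolding p cubic_disc_def
    by (simp add: algebra_simps power2_eq_square power3_eq_cube)
qed

text \<open>The discriminant is a quartic in z. Its zeros will be known, so the coefficient that
  counts is the leading one, \<open>q1^2 + 4 * s1\<close>: for q1 = B1 + B2 and s1 = - B1 B2 it
  equals (B1 - B2)^2.\<close>

lemma cubic_disc_linear_coeffs:
  fixes p0 q0 q1 s0 s1 z :: "'a::comm_ring_1"
  shows "cubic_disc (p0 - z) (q0 + q1 * z) (s0 + s1 * z) =
     (p0\<^sup>2 * q0\<^sup>2 - 4 * q0^3 - 4 * p0^3 * s0 + 18 * p0 * q0 * s0 - 27 * s0\<^sup>2)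
     + (2*p0\<^sup>2*q0*q1 - 2*p0*q0\<^sup>2 - 12*q0\<^sup>2*q1 - 4*(p0^3* s1 - 3*p0\<^sup>2* s0) + 18*(p0*q0* s1 + (p0*q1 - q0)* s0) - 54* s0* s1) * z
     + (p0\<^sup>2*q1\<^sup>2 - 4*p0*q0*q1 + q0\<^sup>2 - 12*q0*q1\<^sup>2 - 4*(3*p0* s0 - 3*p0\<^sup>2* s1) + 18*((p0*q1 - q0)* s1 - q1* s0) - 27* s1\<^sup>2) * z^2
     + (2*q0*q1 - 2*p0*q1\<^sup>2 - 4*q1^3 - 4*(3*p0* s1 - s0) - 18*q1* s1) * z^3
     + (q1\<^sup>2 + 4* s1) * z^4"
  unfolding cubic_disc_def by (simp add: algebra_simps power2_eq_square power3_eq_cube power4_eq_xxxx)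

text \<open>The intermediate value theorem as an invariance principle: the side of v on which g lies
  at one point propagates along T.\<close>

lemma connected_avoid_less:
  fixes g :: "real \<Rightarrow> real"
  assumes "connected T" "continuous_on T g" "\<And>x. x \<in> T \<Longrightarrow> g x \<noteq> v" "x \<in> T" "y \<in> T"
  shows "g x < v \<longleftrightarrow> g y < v"
proof -
  have c: "connected (g ` T)" using assms by (intro connected_continuous_image)
  have "v \<notin> g ` T" using assms by auto
  then show ?thesis
    using connectedD_interval[OF c, of "g x" "g y" v] connectedD_interval[OF c, of "g y" "g x" v] assms(4,5)
    by (meson assms(3) imageI less_le_not_le linorder_le_cases linorder_not_less order_less_imp_le)
qed

section \<open>The cubic whose roots are the values of \<open>chi\<close> over a point\<close>

context surface_map
begin

abbreviation (input) bB where "bB i \<equiv> complex_of_real (B i)"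
abbreviation (input) bA where "bA i \<equiv> complex_of_real (A i)"

definition X where "X k z = the (chi (k, Some z))"
text \<open>With \<open>cq\<close> and \<open>cs\<close>, the coefficients of the monic cubic (w -
  B1)(w - B2)(h(w) - z) in w, where h is the rational function of the overview. Each is affine in z;
  the form in \<open>cub_alt\<close> shows the origin.\<close>

definition cp :: "complex \<Rightarrow> complex" where "cp z = - (bB I1 + bB I2) - z"
definition cq :: "complex \<Rightarrow> complex" where "cq z = (bB I1 * bB I2 + bA I1 + bA I2) + (bB I1 + bB I2) * z"
definition cs :: "complex \<Rightarrow> complex" where "cs z = - (bA I1 * bB I2 + bA I2 * bB I1) + (- (bB I1 * bB I2)) * z"
definition cub where "cub z w = w^3 + cp z * w^2 + cq z * w + cs z"

lemma cub_alt: "cub z w = (w - z) * (w - bB I1) * (w - bB I2) + bA I1 * (w - bB I2) + bA I2 * (w - bB I1)"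
  unfolding cub_def cp_def cq_def cs_def by (simp add: algebra_simps power2_eq_square power3_eq_cube)

lemma chi_finite:
  assumes "(k, Some z) \<in> surface a b"
  shows "chi (k, Some z) = Some (X k z)" "X k z \<noteq> of_real (B i)" "cub z (X k z) = 0"
proof -
  have "chi (k, Some z) \<noteq> None"
    using chi_inj[OF assms in_surface(1)[of S0]] chi_S0_None by auto
  then show 1: "chi (k, Some z) = Some (X k z)" by (auto simp: X_def)
  show 2: "X k z \<noteq> of_real (B i)" for i
    using chi_inj[OF assms in_surface(1)[of "S i"]] 1 chi_S_None[of i] by auto
  have "proj (X k z) = z" unfolding proj_def using G_chi[OF assms] 1 by simp
  then have "z = X k z + bA I1 / (X k z - bB I1) + bA I2 / (X k z - bB I2)"
    using proj_eq[OF 2 2] by simp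
  moreover have "(w - \<zeta>) * d1 * d2 + a1 * d2 + a2 * d1 = 0" if "\<zeta> = w + a1 / d1 + a2 / d2" "d1 \<noteq> 0" "d2 \<noteq> 0"
    for w a1 a2 d1 d2 \<zeta> :: complex
    using that by (simp add: field_simps)
  ultimately show "cub z (X k z) = 0" unfolding cub_alt using 2[of I1] 2[of I2] right_minus_eq by metis
qed

lemma X_eq_iff:
  assumes "(k, Some z) \<in> surface a b" "(k', Some z') \<in> surface a b"
  shows "X k z = X k' z' \<longleftrightarrow> k = k' \<and> z = z'"
  using chi_finite(1)[OF assms(1)] chi_finite(1)[OF assms(2)] chi_inj[OF assms] by auto

lemmas X_off = chi_finite[OF in_surface(3)]

lemma X_distinct:
  assumes "z \<notin> of_real ` bp"
  shows "X S0 z \<noteq> X (S i) z" "X (S I1) z \<noteq> X (S I2) z"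
  using X_eq_iff[OF in_surface(3)[OF assms] in_surface(3)[OF assms]] by auto

lemma cub_factor:
  assumes "cub z x = 0" "cub z y = 0" "x \<noteq> y"
  shows "cub z w = (w - x) * (w - y) * (w - (- cp z - x - y))"
proof -
  have qs: "cq z = x * y + x * (-cp z - x - y) + y * (-cp z - x - y)" "cs z = - (x * y * (-cp z - x - y))"
    using cubic_two_roots[OF assms(3)] assms(1,2) unfolding cub_def by auto
  show ?thesis unfolding cub_def qs by (simp add: algebra_simps power2_eq_square power3_eq_cube)
qed

text \<open>Off the branch points three different points of the surface lie over z, so by
  injectivity of \<open>chi\<close> the three sheets give distinct roots and exhaust the
  cubic.\<close>

lemma cub_roots:
  assumes "z \<notin> of_real ` bp"
  shows "cub z w = (w - X S0 z) * (w - X (S I1) z) * (w - X (S I2) z)"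
    and "X (S I2) z = - cp z - X S0 z - X (S I1) z"
proof -
  let ?t = "- cp z - X S0 z - X (S I1) z"
  note f = cub_factor[OF X_off(3)[OF assms, of S0] X_off(3)[OF assms, of "S I1"] X_distinct(1)[OF assms]]
  have "cub z (X (S I2) z) = 0" by (rule X_off(3)[OF assms])
  then have "(X (S I2) z - X S0 z) * (X (S I2) z - X (S I1) z) * (X (S I2) z - ?t) = 0" by (simp only: f)
  moreover have "X (S I2) z - X S0 z \<noteq> 0" "X (S I2) z - X (S I1) z \<noteq> 0"
    using X_distinct(1)[OF assms, of I2] X_distinct(2)[OF assms] by simp_all
  ultimately show "X (S I2) z = ?t" by simp
  then show "cub z w = (w - X S0 z) * (w - X (S I1) z) * (w - X (S I2) z)" using f by simp
qed

definition disc where "disc z = cubic_disc (cp z) (cq z) (cs z)"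

lemma disc_two_roots:
  assumes "cub z x = 0" "cub z y = 0" "x \<noteq> y"
  shows "disc z = ((x - y) * (x - (- cp z - x - y)) * (y - (- cp z - x - y)))^2"
  using cubic_disc_roots[OF assms(3)] assms(1,2) unfolding cub_def disc_def by auto

lemma closed_sheet_cut: "closed (sheet_cut a b k)"
proof -
  have "\<exists>T. sheet_cut a b k = of_real ` T \<and> compact T"
  proof (cases k)
    case S0
    have "(\<Union>i. {a i..b i}) = {a I1..b I1} \<union> {a I2..b I2}" by (simp add: UNIV_idx)
    then show ?thesis using S0 by (intro exI[of _ "{a I1..b I1} \<union> {a I2..b I2}"]) auto
  qed auto
  then obtain T where T: "sheet_cut a b k = of_real ` T" "compact T" by blast
  show ?thesis unfolding T(1)
    by (intro compact_imp_closed compact_continuous_image T(2) continuous_intros)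
qed

lemma X_holomorphic: "X k holomorphic_on - sheet_cut a b k"
proof -
  have "X k field_differentiable at z" if z: "z \<in> - sheet_cut a b k" for z
  proof -
    have "(k, Some z) \<in> surface a b" using z by (cases k) (auto simp: surface_def less_imp_le[OF cut_less])
    then have zs: "chi (k, Some z) \<in> range Some" using chi_finite(1) by auto
    obtain W H where W: "open W" "z \<in> W" "H holomorphic_on W"
      and H: "\<And>q. q \<in> {k} \<times> Some ` (- sheet_cut a b k) \<Longrightarrow> the (snd q) \<in> W \<Longrightarrow> chi q \<in> range Some \<and> the (chi q) = H (the (snd q))"
      by (rule holomorphic_map_chart_at[OF chi_hol sheet_charts_in_atlas(1)[of k] sphere_atlas_charts(1), of "(k, Some z)"])
        (use z zs in \<open>auto simp: inj_on_def\<close>)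
    have op: "open (W - sheet_cut a b k)"
      using W closed_sheet_cut by (intro open_Diff)
    have "H holomorphic_on W - sheet_cut a b k" using W by (auto intro: holomorphic_on_subset)
    then have "X k holomorphic_on W - sheet_cut a b k"
      by (rule holomorphic_transform) (use H[of "(k, Some _)"] in \<open>auto simp: X_def\<close>)
    then show ?thesis using op z W by (auto simp: holomorphic_on_def at_within_open_NO_MATCH)
  qed
  then show ?thesis unfolding holomorphic_on_def by (auto intro: field_differentiable_at_within)
qed

text \<open>In the branch chart sheet 0 is H(r(z - e)) and sheet i is H(-r(z - e)) with the same
  holomorphic H, and both arguments tend to 0. Thus \<open>X S0\<close> is continuous at e in a full
  neighbourhood although e is an end of the cut.\<close>

lemma branch_lim:
  assumes e: "e = a i \<or> e = b i"
  shows "isCont (X S0) (of_real e)" "(X (S i) \<longlongrightarrow> X S0 (of_real e)) (at (of_real e))"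
proof -
  let ?e = "complex_of_real e"
  have ebp: "e \<in> bp" using e by (auto simp: bp_def)
  obtain i' r \<epsilon> where c: "e = a i' \<or> e = b i'" and r: "half_root r" "\<epsilon> > 0" and
    ch: "({S0} \<times> Some ` ball ?e \<epsilon> \<union> {S i'} \<times> Some ` (ball ?e \<epsilon> - {?e}),
       \<lambda>(k, p). (if k = S0 then 1 else -1) * r (the p - ?e)) \<in> surface_atlas a b" (is "(?U, ?\<phi>) \<in> _")
    by (rule branch_chart_ex[OF ebp])
  have i': "i' = i" using c e a_neq_b by metis
  have rsq: "r z * r z = z" for z using r by (simp add: half_root_def power2_eq_square)
  have rinj: "z = z'" if "r z = r z'" for z z' using rsq that by metis
  have r0: "r 0 = 0" using rsq[of 0] by simp
  have rneg: "z = 0 \<and> z' = 0" if "r z = - r z'" for z z'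
    using r that unfolding half_root_def by (metis add.inverse_inverse)
  have inj: "inj_on ?\<phi> ?U"
    unfolding inj_on_def by (auto split: if_splits dest!: rinj rneg)
      (metis add.inverse_inverse rneg right_minus_eq)+
  have fin: "chi (S0, Some ?e) \<in> range Some" using chi_finite(1)[OF in_surface(2)] by auto
  obtain W H where W: "open W" "?\<phi> (S0, Some ?e) \<in> W" "H holomorphic_on W"
    and H: "\<And>q. q \<in> ?U \<Longrightarrow> ?\<phi> q \<in> W \<Longrightarrow> chi q \<in> range Some \<and> the (chi q) = H (?\<phi> q)"
    by (rule holomorphic_map_chart_at[OF chi_hol ch sphere_atlas_charts(1) inj, of "(S0, Some ?e)"])
      (use fin r in auto)
  have W0: "0 \<in> W" using W(2) r0 by simp
  have X0: "X S0 ?e = H 0" using H[of "(S0, Some ?e)"] r W0 r0 by (simp add: X_def)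
  have "isCont H 0" using W W0 by (meson continuous_on_eq_continuous_at holomorphic_on_imp_continuous_on)
  then have l1: "((\<lambda>z. H (r (z - ?e))) \<longlongrightarrow> H 0) (at ?e)"
    by (rule isCont_tendsto_compose[OF _ half_root_tendsto_0[OF r(1)]])
  have lneg: "((\<lambda>z. - r (z - ?e)) \<longlongrightarrow> 0) (at ?e)"
    using tendsto_minus[OF half_root_tendsto_0[OF r(1)]] by simp
  from \<open>isCont H 0\<close> have l2: "((\<lambda>z. H (- r (z - ?e))) \<longlongrightarrow> H 0) (at ?e)"
    by (rule isCont_tendsto_compose[OF _ lneg])
  have ball: "\<forall>\<^sub>F z in at ?e. z \<in> ball ?e \<epsilon> - {?e}"
    unfolding eventually_at using r(2) by (intro exI[of _ \<epsilon>]) (auto simp: dist_commute)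
  have "(X S0 \<longlongrightarrow> H 0) (at ?e)"
  proof (rule Lim_transform_eventually[OF l1])
    show "\<forall>\<^sub>F z in at ?e. H (r (z - ?e)) = X S0 z"
      using ball topological_tendstoD[OF half_root_tendsto_0[OF r(1), of ?e] W(1) W0]
    proof eventually_elim
      case (elim z)
      then show ?case using H[of "(S0, Some z)"] by (auto simp: X_def)
    qed
  qed
  then show "isCont (X S0) ?e" by (simp add: isCont_def X0)
  show "(X (S i) \<longlongrightarrow> X S0 ?e) (at ?e)" unfolding X0
  proof (rule Lim_transform_eventually[OF l2])
    show "\<forall>\<^sub>F z in at ?e. H (- r (z - ?e)) = X (S i) z"
      using ball topological_tendstoD[OF lneg W(1) W0]
    proof eventually_elim
      case (elim z)
      then show ?case using H[of "(S i, Some z)"] i' by (auto simp: X_def)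
    qed
  qed
qed

end

fun other :: "idx \<Rightarrow> idx" where "other I1 = I2" | "other I2 = I1"

lemma of_real_at_infinity:
  "filterlim complex_of_real at_infinity at_top" "filterlim complex_of_real at_infinity at_bot"
proof -
  show "filterlim complex_of_real at_infinity at_top" by (rule filterlim_of_real_at_infinity)
  show "filterlim complex_of_real at_infinity at_bot"
    unfolding filterlim_at_infinity_conv_norm_at_top filterlim_at_top eventually_at_bot_linorder
  proof
    fix Z :: real
    show "\<exists>N::real. \<forall>n\<le>N. Z \<le> cmod (complex_of_real n)" by (rule exI[of _ "- \<bar>Z\<bar>"]) auto
  qed
qed

lemma cubic_disc_linear_ex:
  fixes p0 q0 q1 s0 s1 :: "'a::comm_ring_1"
  shows "\<exists>c0 c1 c2 c3. \<forall>z. cubic_disc (p0 - z) (q0 + q1 * z) (s0 + s1 * z) =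
    c0 + c1 * z + c2 * z^2 + c3 * z^3 + (q1\<^sup>2 + 4 * s1) * z^4"
  by (intro exI allI) (rule cubic_disc_linear_coeffs)

section \<open>Discriminant and reality of the roots\<close>

context surface_map
begin

definition prd :: "real \<Rightarrow> real" where "prd x = (x - a I1) * (x - b I1) * (x - a I2) * (x - b I2)"

text \<open>Near e the discriminant is a square with the factor \<open>X S0 z - X (S i) z\<close>,
  and the two sheets meet at e. Since \<open>disc\<close> is a polynomial in z, its limit is its
  value.\<close>

lemma disc_bp:
  assumes "e \<in> bp" shows "disc (of_real e) = 0"
proof -
  let ?e = "complex_of_real e"
  obtain i where i: "e = a i \<or> e = b i" using assms by (auto simp: bp_def)
  let ?f = "\<lambda>z. ((X S0 z - X (S i) z) * (X S0 z - (- cp z - X S0 z - X (S i) z)) * (X (S i) z - (- cp z - X S0 z - X (S i) z)))^2"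
  have l: "(X S0 \<longlongrightarrow> X S0 ?e) (at ?e)" using branch_lim(1)[OF i] by (simp add: isCont_def)
  have cpl: "(cp \<longlongrightarrow> cp ?e) (at ?e)" unfolding cp_def[abs_def] by (intro tendsto_intros)
  have "(?f \<longlongrightarrow> ((X S0 ?e - X S0 ?e) * (X S0 ?e - (- cp ?e - X S0 ?e - X S0 ?e)) * (X S0 ?e - (- cp ?e - X S0 ?e - X S0 ?e)))^2) (at ?e)"
    by (intro tendsto_intros l branch_lim(2)[OF i] cpl)
  then have f0: "(?f \<longlongrightarrow> 0) (at ?e)" by simp
  have "\<not> ?e islimpt (complex_of_real ` bp)" using finite_bp by (intro islimpt_finite) simp
  then have "\<forall>\<^sub>F z in at ?e. z \<notin> complex_of_real ` bp" by (simp add: islimpt_iff_eventually)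
  then have ev: "\<forall>\<^sub>F z in at ?e. ?f z = disc z"
  proof eventually_elim
    case (elim z)
    show ?case
      by (rule disc_two_roots[symmetric]) (use X_off(3)[OF elim] X_distinct(1)[OF elim, of i] in auto)
  qed
  have "(disc \<longlongrightarrow> 0) (at ?e)" by (rule Lim_transform_eventually[OF f0 ev])
  moreover have "(disc \<longlongrightarrow> disc ?e) (at ?e)"
    unfolding disc_def[abs_def] cubic_disc_def cp_def cq_def cs_def by (intro tendsto_intros)
  ultimately show ?thesis by (metis LIM_unique)
qed

text \<open>Quartic in z with four known zeros; the leading coefficient (B1 + B2)^2 - 4 B1 B2
  supplies the factor (B1 - B2)^2.\<close>

lemma disc_eq: "disc (of_real x) = of_real ((B I1 - B I2)\<^sup>2 * prd x)"
proof -
  define c where "c = (bB I1 + bB I2)\<^sup>2 + 4 * (- (bB I1 * bB I2))"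
  have "\<exists>c0 c1 c2 c3. \<forall>z. disc z = c0 + c1 * z + c2 * z^2 + c3 * z^3 + c * z^4"
    using cubic_disc_linear_ex[of "- (bB I1 + bB I2)" "bB I1 * bB I2 + bA I1 + bA I2" "bB I1 + bB I2"
      "- (bA I1 * bB I2 + bA I2 * bB I1)" "- (bB I1 * bB I2)"]
    unfolding disc_def cp_def cq_def cs_def c_def .
  then obtain c0 c1 c2 c3 where dq: "\<And>z. disc z = c0 + c1 * z + c2 * z^2 + c3 * z^3 + c * z^4" by blast
  have "c0 + c1 * z + c2 * z^2 + c3 * z^3 + c * z^4 = c * ((z - of_real (a I1)) * (z - of_real (b I1)) * (z - of_real (a I2)) * (z - of_real (b I2)))" for z
  proof (rule quartic_four_roots)
    show "c0 + c1 * z + c2 * z^2 + c3 * z^3 + c * z^4 = 0"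
      if "z \<in> {complex_of_real (a I1), of_real (b I1), of_real (a I2), of_real (b I2)}" for z
      using that disc_bp unfolding dq[symmetric] bp_eq by auto
    show "distinct [complex_of_real (a I1), of_real (b I1), of_real (a I2), of_real (b I2)]"
      using cuts by auto
  qed
  then have "disc (of_real x) = c * of_real (prd x)" unfolding dq prd_def by simp
  also have "c = of_real ((B I1 - B I2)\<^sup>2)"
    unfolding c_def by (simp add: power2_eq_square algebra_simps)
  finally show ?thesis by simp
qed

lemma cub_cnj: "cub (of_real x) (cnj w) = cnj (cub (of_real x) w)"
  unfolding cub_alt by simp

text \<open>For real x the roots are u, its conjugate and a real t. The discriminant then splits
  into (u - cnj u)^2 = -4 (Im u)^2 and the square of (u - t)(cnj u - t) = |u - t|^2. The identity
  decides reality by the sign of \<open>prd\<close>, and later measures the size of Im u.\<close>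

lemma nonreal_root:
  assumes "cub (of_real x) u = 0" "Im u \<noteq> 0"
  shows "(B I1 - B I2)\<^sup>2 * prd x = - 4 * (Im u)\<^sup>2 * ((cmod (u - of_real (x + B I1 + B I2 - 2 * Re u)))\<^sup>2)\<^sup>2"
proof -
  define t where "t = x + B I1 + B I2 - 2 * Re u"
  have ne: "u \<noteq> cnj u" using assms(2) by (auto simp: complex_eq_iff)
  have r2: "cub (of_real x) (cnj u) = 0" using assms(1) by (simp add: cub_cnj)
  have t: "- cp (of_real x) - u - cnj u = of_real t"
    by (simp add: cp_def t_def complex_eq_iff)
  have "complex_of_real ((B I1 - B I2)\<^sup>2 * prd x) = ((u - cnj u) * ((u - of_real t) * (cnj u - of_real t)))\<^sup>2"
    unfolding disc_eq[symmetric] disc_two_roots[OF assms(1) r2 ne] t by (simp add: mult.assoc)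
  also have "u - cnj u = 2 * \<i> * of_real (Im u)" by (simp add: complex_eq_iff)
  also have "(u - of_real t) * (cnj u - of_real t) = of_real ((cmod (u - of_real t))\<^sup>2)"
    using complex_norm_square[of "u - of_real t"] by simp
  also have "(2 * \<i> * complex_of_real (Im u) * of_real ((cmod (u - of_real t))\<^sup>2))\<^sup>2 =
     of_real (- 4 * (Im u)\<^sup>2 * ((cmod (u - of_real t))\<^sup>2)\<^sup>2)"
    by (simp add: power_mult_distrib)
  finally show ?thesis unfolding t_def of_real_eq_iff .
qed

lemma prd_0_iff: "prd x = 0 \<longleftrightarrow> x \<in> bp"
  by (auto simp: prd_def bp_eq)

lemma prd_pos: "x < a I1 \<or> b I2 < x \<or> b I1 < x \<and> x < a I2 \<Longrightarrow> prd x > 0"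
proof -
  assume x: "x < a I1 \<or> b I2 < x \<or> b I1 < x \<and> x < a I2"
  have "(x - a I1) * (x - b I1) > 0" using x cuts by (cases "x < a I1") (auto intro: mult_neg_neg mult_pos_pos)
  moreover have "(x - a I2) * (x - b I2) > 0" using x cuts by (cases "x < a I2") (auto intro: mult_neg_neg mult_pos_pos)
  ultimately show ?thesis unfolding prd_def using mult_pos_pos by (fastforce simp: mult.assoc)
qed

lemma prd_neg:
  assumes "a i < x" "x < b i" shows "prd x < 0"
proof (cases i)
  case I1
  have "(x - a I1) * (x - b I1) < 0" "(x - a I2) * (x - b I2) > 0"
    using assms I1 cuts by (auto intro: mult_neg_neg mult_pos_neg)
  then show ?thesis unfolding prd_def using mult_neg_pos by (fastforce simp: mult.assoc)
next
  case I2
  have "(x - a I1) * (x - b I1) > 0" "(x - a I2) * (x - b I2) < 0"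
    using assms I2 cuts by (auto intro: mult_pos_pos mult_pos_neg)
  then show ?thesis unfolding prd_def using mult_pos_neg by (fastforce simp: mult.assoc)
qed

lemma root_real:
  assumes "cub (of_real x) u = 0" "prd x > 0" shows "Im u = 0"
proof (rule ccontr)
  assume "Im u \<noteq> 0"
  from nonreal_root[OF assms(1) this] have "(B I1 - B I2)\<^sup>2 * prd x \<le> 0" by simp
  then show False using assms(2) B_neq by (simp add: mult_le_0_iff)
qed

lemma X_real_pos: "prd x > 0 \<Longrightarrow> Im (X k (of_real x)) = 0"
  using prd_0_iff[of x] by (intro root_real[of x] X_off) auto

lemma X0_bp_real: assumes "e \<in> bp" shows "Im (X S0 (of_real e)) = 0"
proof (rule ccontr)
  let ?u = "X S0 (of_real e)"
  assume im: "Im ?u \<noteq> 0"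
  have "cub (of_real e) ?u = 0" by (rule chi_finite(3)[OF in_surface(2)])
  \<comment> \<open>At a branch point the left side of the identity is 0, so a nonreal u would have
    to coincide with the real third root.\<close>
  from nonreal_root[OF this im] im have "?u = of_real (e + B I1 + B I2 - 2 * Re ?u)"
    using assms by (simp add: prd_0_iff[THEN iffD2])
  then have "Im ?u = 0" by (metis Im_complex_of_real)
  with im show False ..
qed

text \<open>Reflection principle: f(z) minus the conjugate of f(conjugate of z) is holomorphic on
  the symmetric domain and vanishes on an interval, hence everywhere.\<close>

lemma analytic_real:
  assumes hol: "f holomorphic_on U" and U: "open U" "connected U" "cnj ` U = U"
    and l: "l < r" "\<And>x. l < x \<Longrightarrow> x < r \<Longrightarrow> of_real x \<in> U \<and> Im (f (of_real x)) = 0"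
    and y: "of_real y \<in> U"
  shows "Im (f (of_real y)) = 0"
proof -
  have h: "cnj \<circ> f \<circ> cnj holomorphic_on U" using hol U by (intro holomorphic_on_compose_cnj_cnj) auto
  let ?g = "\<lambda>z. f z - cnj (f (cnj z))"
  have g: "?g holomorphic_on U" using holomorphic_on_diff[OF hol h] by (simp add: o_def)
  define m where "m = (l + r) / 2"
  have m: "l < m" "m < r" using l(1) by (auto simp: m_def)
  have lim: "complex_of_real m islimpt of_real ` {l<..<r}"
    unfolding islimpt_approachable
  proof (intro allI impI)
    fix e :: real assume "0 < e"
    define d where "d = min (e / 2) ((r - m) / 2)"
    have d: "0 < d" "d < e" "m + d < r" using \<open>0 < e\<close> m by (auto simp: d_def min_def field_simps)
    show "\<exists>x'\<in>complex_of_real ` {l<..<r}. x' \<noteq> of_real m \<and> dist x' (of_real m) < e"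
      by (rule bexI[of _ "of_real (m + d)"]) (use d m in \<open>auto simp: dist_norm simp flip: of_real_diff of_real_add\<close>)
  qed
  have "?g (of_real y) = 0"
  proof (rule analytic_continuation[OF g U(1,2) _ _ lim _ y])
    show "complex_of_real ` {l<..<r} \<subseteq> U" using l by auto
    show "complex_of_real m \<in> U" using l m by auto
    show "?g z = 0" if "z \<in> complex_of_real ` {l<..<r}" for z
      using that l(2) by (auto simp: complex_eq_iff)
  qed
  then show ?thesis by (simp add: complex_eq_iff)
qed

text \<open>Sheet 2 has no cut over the first interval, so \<open>X (S I2)\<close> is holomorphic on
  the half-plane left of \<open>a I2\<close>. It is real left of \<open>a I1\<close> by the sign of
  the discriminant, and reflection carries this across the first cut. Sheet 1 is symmetric.\<close>

lemma X_real_far: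
  "x < a I2 \<Longrightarrow> Im (X (S I2) (of_real x)) = 0"
  "b I1 < x \<Longrightarrow> Im (X (S I1) (of_real x)) = 0"
proof -
  have open_re: "open {z. Re z < c}" "open {z. Re z > c}" for c
    by (auto simp: open_halfspace_Re_lt open_halfspace_Re_gt)
  have conn: "connected {z. Re z < c}" "connected {z. Re z > c}" for c
    by (auto intro!: convex_connected simp: convex_halfspace_Re_lt convex_halfspace_Re_gt)
  have cn: "cnj ` {z. Re z < c} = {z. Re z < c}" "cnj ` {z. Re z > c} = {z. Re z > c}" for c
    by (auto intro!: image_eqI[of _ cnj "cnj _"])
  show "Im (X (S I2) (of_real x)) = 0" if "x < a I2"
  proof (rule analytic_real[OF _ open_re(1)[of "a I2"] conn(1) cn(1), of _ "a I1 - 1" "a I1"])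
    show "X (S I2) holomorphic_on {z. Re z < a I2}"
      by (rule holomorphic_on_subset[OF X_holomorphic]) auto
    show "of_real x \<in> {z. Re z < a I2} \<and> Im (X (S I2) (of_real x)) = 0" if "a I1 - 1 < x" "x < a I1" for x
      using that cuts X_real_pos[OF prd_pos] by auto
  qed (use that in auto)
  show "Im (X (S I1) (of_real x)) = 0" if "b I1 < x"
  proof (rule analytic_real[OF _ open_re(2)[of "b I1"] conn(2) cn(2), of _ "b I2" "b I2 + 1"])
    show "X (S I1) holomorphic_on {z. Re z > b I1}"
      by (rule holomorphic_on_subset[OF X_holomorphic]) auto
    show "of_real x \<in> {z. Re z > b I1} \<and> Im (X (S I1) (of_real x)) = 0" if "b I2 < x" "x < b I2 + 1" for x
      using that cuts X_real_pos[OF prd_pos] by auto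
  qed (use that in auto)
qed

lemma X_other_real: "a i \<le> x \<Longrightarrow> x \<le> b i \<Longrightarrow> Im (X (S (other i)) (of_real x)) = 0"
  using X_real_far cuts by (cases i) auto

lemma off_bp: "a i < x \<Longrightarrow> x < b i \<Longrightarrow> complex_of_real x \<notin> of_real ` bp"
  using prd_neg[of i x] prd_0_iff[of x] by auto

text \<open>On cut i the uninvolved sheet is real. If sheet 0 were real too, Vieta would make all
  three roots real and the discriminant a square, contrary to its negative sign inside the
  cut.\<close>

lemma X0_nonreal:
  assumes "a i < x" "x < b i" shows "Im (X S0 (of_real x)) \<noteq> 0"
proof
  let ?z = "complex_of_real x"
  let ?u = "X S0 ?z" and ?v = "X (S (other i)) ?z"
  assume im: "Im ?u = 0"
  have imv: "Im ?v = 0" using assms X_other_real by simp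
  note off = off_bp[OF assms]
  have d: "disc ?z = ((?u - ?v) * (?u - (- cp ?z - ?u - ?v)) * (?v - (- cp ?z - ?u - ?v)))^2"
    by (rule disc_two_roots) (use X_off(3)[OF off] X_distinct(1)[OF off] in auto)
  obtain u v where uv: "?u = of_real u" "?v = of_real v"
    using im imv by (metis complex_is_Real_iff Reals_cases)
  have "complex_of_real ((B I1 - B I2)\<^sup>2 * prd x) =
      of_real (((u - v) * (u - (B I1 + B I2 + x - u - v)) * (v - (B I1 + B I2 + x - u - v)))^2)"
    using d unfolding disc_eq uv cp_def by (simp add: algebra_simps)
  then have "(B I1 - B I2)\<^sup>2 * prd x = ((u - v) * (u - (B I1 + B I2 + x - u - v)) * (v - (B I1 + B I2 + x - u - v)))^2"
    by (simp only: of_real_eq_iff)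
  then have "(B I1 - B I2)\<^sup>2 * prd x \<ge> 0" by simp
  then show False using prd_neg[OF assms] B_neq by (simp add: zero_le_mult_iff)
qed

section \<open>Order of the branch values and signs of the residues\<close>

lemma isCont_X: "z \<notin> sheet_cut a b k \<Longrightarrow> isCont (X k) z"
  using X_holomorphic[of k] closed_sheet_cut[of k]
  by (metis ComplI closed_Compl continuous_on_eq_continuous_at holomorphic_on_imp_continuous_on open_Compl)

lemma continuous_on_ReX:
  assumes "\<And>x. x \<in> T \<Longrightarrow> of_real x \<notin> sheet_cut a b k \<or> k = S0 \<and> x \<in> bp"
  shows "continuous_on T (\<lambda>x. Re (X k (of_real x)))"
proof -
  have "isCont (X k) (of_real x)" if "x \<in> T" for x
    using assms[OF that] isCont_X branch_lim(1) by (auto simp: bp_def)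
  then have "isCont (\<lambda>x. X k (of_real x)) x" if "x \<in> T" for x
    using that isCont_o2[OF continuous_of_real[OF continuous_ident]] by metis
  then have "continuous_on T (\<lambda>x. X k (of_real x))" by (simp add: continuous_at_imp_continuous_on)
  then show ?thesis by (rule continuous_on_Re)
qed

lemma ReX_neq_B:
  assumes "(k, Some (of_real x)) \<in> surface a b" "Im (X k (of_real x)) = 0"
  shows "Re (X k (of_real x)) \<noteq> B i"
  using chi_finite(2)[OF assms(1), of i] assms(2) by (auto simp: complex_eq_iff)

text \<open>At minus infinity \<open>X S0\<close> behaves like x and is below \<open>B i\<close>.
  Going right it stays real up to the first branch point and cannot reach \<open>B i\<close>, the
  value \<open>chi\<close> already takes at infinity on sheet i.\<close>

lemma X0_end_left: "Re (X S0 (of_real (a I1))) < B i"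
proof -
  let ?g = "\<lambda>x. Re (X S0 (of_real x))"
  have im: "Im (X S0 (of_real x)) = 0" if "x \<le> a I1" for x
    using that X_real_pos[OF prd_pos, of x] X0_bp_real[of "a I1"] by (cases "x = a I1") (auto simp: bp_eq)
  have "((\<lambda>x. X S0 (of_real x) - of_real x) \<longlongrightarrow> 0) at_bot"
    using filterlim_compose[OF chi_S0_asymp of_real_at_infinity(2)] by (simp add: X_def)
  from tendsto_Re[OF this] have "((\<lambda>x. ?g x - x) \<longlongrightarrow> 0) at_bot" by simp
  then have "\<forall>\<^sub>F x in at_bot. ?g x - x < 1" by (rule order_tendstoD) simp
  moreover have "\<forall>\<^sub>F x in at_bot. x < min (a I1) (B i - 1)" by (rule eventually_gt_at_bot)
  ultimately have "\<forall>\<^sub>F x in at_bot. ?g x < B i \<and> x \<le> a I1" by eventually_elim auto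
  then obtain x where x: "?g x < B i" "x \<le> a I1"
    using eventually_happens'[OF trivial_limit_at_bot_linorder] by blast
  have "?g x < B i \<longleftrightarrow> ?g (a I1) < B i"
  proof (rule connected_avoid_less[of "{..a I1}" ?g])
    show "connected {..a I1}" by simp
    show "continuous_on {..a I1} ?g"
      by (rule continuous_on_ReX) (use cuts in \<open>auto simp: bp_eq UNIV_idx less_le\<close>)
    show "?g y \<noteq> B i" if "y \<in> {..a I1}" for y
      using that im by (intro ReX_neq_B in_surface(2)) auto
  qed (use x in auto)
  then show ?thesis using x by simp
qed

lemma X0_end_right: "B i < Re (X S0 (of_real (b I2)))"
proof -
  let ?g = "\<lambda>x. Re (X S0 (of_real x))"
  have im: "Im (X S0 (of_real x)) = 0" if "x \<ge> b I2" for x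
    using that X_real_pos[OF prd_pos, of x] X0_bp_real[of "b I2"] by (cases "x = b I2") (auto simp: bp_eq)
  have "((\<lambda>x. X S0 (of_real x) - of_real x) \<longlongrightarrow> 0) at_top"
    using filterlim_compose[OF chi_S0_asymp of_real_at_infinity(1)] by (simp add: X_def)
  from tendsto_Re[OF this] have "((\<lambda>x. ?g x - x) \<longlongrightarrow> 0) at_top" by simp
  then have "\<forall>\<^sub>F x in at_top. ?g x - x > -1" by (rule order_tendstoD) simp
  moreover have "\<forall>\<^sub>F x in at_top. x > max (b I2) (B i + 1)" by (rule eventually_gt_at_top)
  ultimately have "\<forall>\<^sub>F x in at_top. ?g x > B i \<and> x \<ge> b I2" by eventually_elim auto
  then obtain x where x: "?g x > B i" "x \<ge> b I2"
    using eventually_happens'[OF trivial_limit_at_top_linorder] by blast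
  have ne: "?g y \<noteq> B i" if "y \<in> {b I2..}" for y
    using that im by (intro ReX_neq_B in_surface(2)) auto
  have "?g x < B i \<longleftrightarrow> ?g (b I2) < B i"
  proof (rule connected_avoid_less[of "{b I2..}" ?g])
    show "connected {b I2..}" by simp
    show "continuous_on {b I2..} ?g"
      by (rule continuous_on_ReX) (use cuts in \<open>auto simp: bp_eq UNIV_idx less_le\<close>)
  qed (use x ne in auto)
  then show ?thesis using x ne[of "b I2"] by auto
qed

text \<open>If \<open>A i\<close> vanished, \<open>B i\<close> would be a root of the cubic for
  every z, yet no finite point of the surface is mapped to \<open>B i\<close>. The point m is any
  convenient real point off the cuts.\<close>

lemma A_nonzero: "A i \<noteq> 0"
proof
  assume 0: "A i = 0"
  define m where "m = a I1 - 1"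
  let ?z = "complex_of_real m"
  have off: "?z \<notin> of_real ` bp" 
  proof -
    have "m < a I1" by (simp add: m_def)
    then show ?thesis using prd_pos[of m] prd_0_iff[of m] by auto
  qed
  have "cub ?z (bB i) = 0" using 0 unfolding cub_alt by (cases i) auto
  then have "bB i = X S0 ?z \<or> bB i = X (S I1) ?z \<or> bB i = X (S I2) ?z"
    unfolding cub_roots(1)[OF off] by auto
  then show False using X_off(2)[OF off] by metis
qed

lemma sheet_real_lim:
  assumes "filterlim complex_of_real at_infinity F"
  shows "((\<lambda>x. (Re (X (S i) (of_real x)) - B i) * x) \<longlongrightarrow> A i) F"
proof -
  have "((\<lambda>x. (X (S i) (of_real x) - of_real (B i)) * of_real x) \<longlongrightarrow> of_real (A i)) F"
    using filterlim_compose[OF chi_S_asymp assms] by (simp add: X_def)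
  from tendsto_Re[OF this] show ?thesis by simp
qed

text \<open>The sign of \<open>A i\<close> decides from which side \<open>X (S i)\<close> leaves its
  limit \<open>B i\<close> at minus infinity. It cannot cross \<open>B i\<close>, so the side
  persists up to the branch point, where sheets i and 0 meet; passing to that limit makes the
  inequality weak.\<close>

lemma sheet_left:
  assumes im: "\<And>x. x < a i \<Longrightarrow> Im (X (S i) (of_real x)) = 0"
  shows "A i > 0 \<Longrightarrow> Re (X S0 (of_real (a i))) \<le> B i" "A i < 0 \<Longrightarrow> Re (X S0 (of_real (a i))) \<ge> B i"
proof -
  let ?g = "\<lambda>x. Re (X (S i) (of_real x))"
  have ne: "?g y \<noteq> B i" if "y \<in> {..<a i}" for y
    using that im cut_less[of i] by (intro ReX_neq_B) (auto simp: surface_def)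
  have co: "?g x < B i \<longleftrightarrow> ?g y < B i" if "x < a i" "y < a i" for x y
  proof (rule connected_avoid_less[of "{..<a i}" ?g])
    show "connected {..<a i}" by simp
    show "continuous_on {..<a i} ?g" by (rule continuous_on_ReX) auto
  qed (use that ne in auto)
  have "((\<lambda>z. X (S i) z) \<longlongrightarrow> X S0 (of_real (a i))) (at (of_real (a i)))" by (rule branch_lim) simp
  then have "((\<lambda>x. X (S i) (of_real x)) \<longlongrightarrow> X S0 (of_real (a i))) (at_left (a i))"
    by (rule filterlim_compose) (auto simp: filterlim_at eventually_at_filter intro!: tendsto_intros)
  from tendsto_Re[OF this] have lim: "(?g \<longlongrightarrow> Re (X S0 (of_real (a i)))) (at_left (a i))" .
  have evl: "\<forall>\<^sub>F x in at_left (a i). x < a i" by (simp add: eventually_at_filter)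
  have neg: "\<forall>\<^sub>F x in at_bot. x < min 0 (a i)" by (rule eventually_gt_at_bot)
  note L = sheet_real_lim[OF of_real_at_infinity(2), of i]
  show "Re (X S0 (of_real (a i))) \<le> B i" if "A i > 0"
  proof -
    have "\<forall>\<^sub>F x in at_bot. (?g x - B i) * x > 0" using L that by (rule order_tendstoD)
    with neg have "\<forall>\<^sub>F x in at_bot. x < a i \<and> ?g x < B i"
      by eventually_elim (auto simp: zero_less_mult_iff)
    then obtain x where "x < a i" "?g x < B i"
      using eventually_happens'[OF trivial_limit_at_bot_linorder] by blast
    then have "?g y \<le> B i" if "y < a i" for y using co[OF that] by (meson less_imp_le not_less)
    then have "\<forall>\<^sub>F y in at_left (a i). ?g y \<le> B i" by (rule eventually_mono[OF evl])
    then show ?thesis by (rule tendsto_upperbound[OF lim]) simp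
  qed
  show "Re (X S0 (of_real (a i))) \<ge> B i" if "A i < 0"
  proof -
    have "\<forall>\<^sub>F x in at_bot. (?g x - B i) * x < 0" using L that by (rule order_tendstoD)
    with neg have "\<forall>\<^sub>F x in at_bot. x < a i \<and> \<not> ?g x < B i"
      by eventually_elim (auto simp: mult_less_0_iff)
    then obtain x where "x < a i" "\<not> ?g x < B i"
      using eventually_happens'[OF trivial_limit_at_bot_linorder] by blast
    then have "?g y \<ge> B i" if "y < a i" for y using co[OF that] by (meson less_imp_le not_less)
    then have "\<forall>\<^sub>F y in at_left (a i). ?g y \<ge> B i" by (rule eventually_mono[OF evl])
    then show ?thesis by (rule tendsto_lowerbound[OF lim]) simp
  qed
qed

lemma sheet_right:
  assumes im: "\<And>x. b i < x \<Longrightarrow> Im (X (S i) (of_real x)) = 0"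
  shows "A i > 0 \<Longrightarrow> Re (X S0 (of_real (b i))) \<ge> B i" "A i < 0 \<Longrightarrow> Re (X S0 (of_real (b i))) \<le> B i"
proof -
  let ?g = "\<lambda>x. Re (X (S i) (of_real x))"
  have ne: "?g y \<noteq> B i" if "y \<in> {b i<..}" for y
    using that im cut_less[of i] by (intro ReX_neq_B) (auto simp: surface_def)
  have co: "?g x < B i \<longleftrightarrow> ?g y < B i" if "b i < x" "b i < y" for x y
  proof (rule connected_avoid_less[of "{b i<..}" ?g])
    show "connected {b i<..}" by simp
    show "continuous_on {b i<..} ?g" by (rule continuous_on_ReX) auto
  qed (use that ne in auto)
  have "((\<lambda>z. X (S i) z) \<longlongrightarrow> X S0 (of_real (b i))) (at (of_real (b i)))" by (rule branch_lim) simp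
  then have "((\<lambda>x. X (S i) (of_real x)) \<longlongrightarrow> X S0 (of_real (b i))) (at_right (b i))"
    by (rule filterlim_compose) (auto simp: filterlim_at eventually_at_filter intro!: tendsto_intros)
  from tendsto_Re[OF this] have lim: "(?g \<longlongrightarrow> Re (X S0 (of_real (b i)))) (at_right (b i))" .
  have evl: "\<forall>\<^sub>F x in at_right (b i). b i < x" by (simp add: eventually_at_filter)
  have pos: "\<forall>\<^sub>F x in at_top. x > max 0 (b i)" by (rule eventually_gt_at_top)
  note L = sheet_real_lim[OF of_real_at_infinity(1), of i]
  show "Re (X S0 (of_real (b i))) \<ge> B i" if "A i > 0"
  proof -
    have "\<forall>\<^sub>F x in at_top. (?g x - B i) * x > 0" using L that by (rule order_tendstoD)
    with pos have "\<forall>\<^sub>F x in at_top. x > b i \<and> \<not> ?g x < B i"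
      by eventually_elim (auto simp: zero_less_mult_iff)
    then obtain x where "x > b i" "\<not> ?g x < B i"
      using eventually_happens'[OF trivial_limit_at_top_linorder] by blast
    then have "?g y \<ge> B i" if "b i < y" for y using co[OF that] by (meson less_imp_le not_less)
    then have "\<forall>\<^sub>F y in at_right (b i). ?g y \<ge> B i" by (rule eventually_mono[OF evl])
    then show ?thesis by (rule tendsto_lowerbound[OF lim]) simp
  qed
  show "Re (X S0 (of_real (b i))) \<le> B i" if "A i < 0"
  proof -
    have "\<forall>\<^sub>F x in at_top. (?g x - B i) * x < 0" using L that by (rule order_tendstoD)
    with pos have "\<forall>\<^sub>F x in at_top. x > b i \<and> ?g x < B i"
      by eventually_elim (auto simp: mult_less_0_iff)
    then obtain x where "x > b i" "?g x < B i"
      using eventually_happens'[OF trivial_limit_at_top_linorder] by blast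
    then have "?g y \<le> B i" if "b i < y" for y using co[OF that] by (meson less_imp_le not_less)
    then have "\<forall>\<^sub>F y in at_right (b i). ?g y \<le> B i" by (rule eventually_mono[OF evl])
    then show ?thesis by (rule tendsto_upperbound[OF lim]) simp
  qed
qed

lemma X_sheet_real:
  "x < a i \<Longrightarrow> Im (X (S i) (of_real x)) = 0" "b i < x \<Longrightarrow> Im (X (S i) (of_real x)) = 0"
  using X_real_far X_real_pos[OF prd_pos, of x] by (cases i; auto)+

text \<open>If \<open>A\<^sub>1 < 0\<close>, then sheet 1 would stay above \<open>B\<^sub>1\<close> on the half-line left of the cuts and sheet 0
  below \<open>B\<^sub>1\<close>, although they meet at the branch point; similarly for \<open>A\<^sub>2\<close> on the right.\<close>

lemma A_pos: "A i > 0"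
proof (cases i)
  case I1
  have "\<not> A I1 < 0" using sheet_left(2)[OF X_sheet_real(1), of I1] X0_end_left[of I1] by force
  then show ?thesis using I1 A_nonzero[of I1] by auto
next
  case I2
  have "\<not> A I2 < 0" using sheet_right(2)[OF X_sheet_real(2), of I2] X0_end_right[of I2] by force
  then show ?thesis using I2 A_nonzero[of I2] by auto
qed

lemma X0_bp_neq: "e \<in> bp \<Longrightarrow> Re (X S0 (of_real e)) \<noteq> B i"
  by (intro ReX_neq_B X0_bp_real in_surface(2))

text \<open>Sheet 1 determines the side of \<open>B I1\<close> at \<open>b I1\<close>, and sheet 2
  the side of \<open>B I2\<close> at \<open>a I2\<close>. Between the cuts sheet 0 is real and
  avoids both values, so each inequality also holds at the other end of the gap.\<close>

lemma X0_inner: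
  shows "B I1 < Re (X S0 (of_real (b I1)))" "Re (X S0 (of_real (a I2))) < B I2"
    and "B I1 < Re (X S0 (of_real (a I2)))" "Re (X S0 (of_real (b I1))) < B I2"
proof -
  let ?g = "\<lambda>x. Re (X S0 (of_real x))"
  show 1: "B I1 < ?g (b I1)" using sheet_right(1)[OF X_sheet_real(2) A_pos, of I1] X0_bp_neq[of "b I1" I1] by (auto simp: bp_eq)
  show 2: "?g (a I2) < B I2" using sheet_left(1)[OF X_sheet_real(1) A_pos, of I2] X0_bp_neq[of "a I2" I2] by (auto simp: bp_eq)
  have ne: "?g y \<noteq> B i" if "y \<in> {b I1..a I2}" for y i
  proof (cases "y \<in> bp")
    case False
    then have "prd y > 0" using that by (intro prd_pos) (auto simp: bp_eq)
    then show ?thesis by (intro ReX_neq_B in_surface(2) X_real_pos)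
  qed (rule X0_bp_neq)
  have eq: "?g (b I1) < B i \<longleftrightarrow> ?g (a I2) < B i" for i
  proof (rule connected_avoid_less[of "{b I1..a I2}" ?g])
    show "connected {b I1..a I2}" by simp
    show "continuous_on {b I1..a I2} ?g"
      by (rule continuous_on_ReX) (use cuts in \<open>auto simp: bp_eq UNIV_idx less_le\<close>)
  qed (use cuts ne in auto)
  show "B I1 < ?g (a I2)" using eq[of I1] 1 ne[of "a I2" I1] cuts by auto
  show "?g (b I1) < B I2" using eq[of I2] 2 by simp
qed

end

section \<open>Boundary values on the cuts and moments\<close>

text \<open>A logarithm that is holomorphic at every nonzero point of the closed upper half-plane.\<close>

definition half_log :: "complex \<Rightarrow> complex" where
  "half_log w = Ln (- \<i> * w)"

lemma half_log_deriv:
  assumes "Im w \<ge> 0" "w \<noteq> 0"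
  shows "(half_log has_field_derivative 1 / w) (at w)"
proof -
  have "- \<i> * w \<notin> \<real>\<^sub>\<le>\<^sub>0"
    using assms by (auto simp: complex_nonpos_Reals_iff complex_eq_iff)
  then show ?thesis unfolding half_log_def[abs_def]
    using assms by (auto intro!: derivative_eq_intros simp: field_simps)
qed

lemma half_log_real:
  fixes r :: real
  assumes "r \<noteq> 0"
  shows "Im (half_log (of_real r)) = (if r > 0 then - (pi / 2) else pi / 2)"
proof (cases "r > 0")
  case True
  then have "half_log (of_real r) = of_real (ln r) + Ln (- \<i>)"
    unfolding half_log_def using Ln_times_of_real[of r "- \<i>"] by (simp add: mult.commute Ln_of_real)
  then show ?thesis using True by simp
next
  case False
  then have r: "0 < - r" using assms by simp
  have "half_log (of_real r) = of_real (ln (- r)) + Ln \<i>"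
    unfolding half_log_def using Ln_times_of_real[OF r, of "\<i>"] Ln_of_real[OF r] by (simp add: mult.commute)
  then show ?thesis using False by simp
qed

section \<open>Boundary values on the upper banks of the cuts\<close>

context surface_map
begin

text \<open>The crossing chart continues \<open>X S0\<close> from the upper half-plane through the
  cut into sheet i, so on the open cut the upper boundary values are restrictions of a holomorphic
  function.\<close>

lemma X0_has_vector_derivative:
  assumes "a i < x" "x < b i"
  shows "\<exists>D. ((\<lambda>x. X S0 (of_real x)) has_vector_derivative D) (at x)"
proof -
  let ?x = "complex_of_real x"
  let ?U = "fst (crossing_chart a b i S0 (S i))"
  have xU: "(S0, Some ?x) \<in> ?U" using assms by (auto simp: crossing_chart_def)
  have ch: "(?U, \<lambda>p. the (snd p)) \<in> surface_atlas a b"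
    using crossing_chart_in_atlas(1)[of a b i] by (simp add: crossing_chart_def)
  have inj: "inj_on (\<lambda>p. the (snd p)) ?U" by (auto simp: inj_on_def crossing_chart_def)
  have fin: "chi (S0, Some ?x) \<in> range Some" using chi_finite(1)[OF in_surface(2)] by auto
  obtain W H where W: "open W" "the (snd (S0, Some ?x)) \<in> W" "H holomorphic_on W"
    and H: "\<And>q. q \<in> ?U \<Longrightarrow> the (snd q) \<in> W \<Longrightarrow> chi q \<in> range Some \<and> the (chi q) = H (the (snd q))"
    by (rule holomorphic_map_chart_at[OF chi_hol ch sphere_atlas_charts(1) inj xU fin]) blast
  have "(H has_field_derivative deriv H ?x) (at ?x)" by (rule holomorphic_derivI[OF W(3,1)]) (use W(2) in simp)
  then have "((\<lambda>x. H (of_real x)) has_vector_derivative deriv H ?x) (at x)"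
    by (rule has_vector_derivative_real_field)
  moreover have "open ({a i<..<b i} \<inter> complex_of_real -` W)"
    by (intro open_Int open_vimage W continuous_intros open_greaterThanLessThan)
  ultimately have "((\<lambda>x. X S0 (of_real x)) has_vector_derivative deriv H ?x) (at x)"
  proof (rule has_vector_derivative_transform_within_open)
    show "x \<in> {a i<..<b i} \<inter> complex_of_real -` W" using assms W by auto
    show "H (of_real y) = X S0 (of_real y)" if "y \<in> {a i<..<b i} \<inter> complex_of_real -` W" for y
      using that H[of "(S0, Some (of_real y))"] by (auto simp: X_def crossing_chart_def)
  qed
  then show ?thesis by blast
qed

lemma isCont_X0_cut:
  assumes "a i \<le> x" "x \<le> b i" shows "isCont (\<lambda>x. X S0 (of_real x)) x"
proof (cases "x = a i \<or> x = b i")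
  case True
  then show ?thesis using isCont_o2[OF continuous_of_real[OF continuous_ident] branch_lim(1)] by blast
next
  case False
  then obtain D where "((\<lambda>x. X S0 (of_real x)) has_vector_derivative D) (at x)"
    using X0_has_vector_derivative[of i x] assms by auto
  then show ?thesis by (rule has_vector_derivative_continuous)
qed

text \<open>\<open>W\<close> may replace \<open>\<chi>(x\<^sub>+)\<close> throughout: the functions \<open>\<Psi>\<close> do not change when \<open>\<chi>(x\<^sub>+)\<close> is
  conjugated.\<close>

definition W :: "real \<Rightarrow> complex" where
  "W x = Complex (Re (X S0 (of_real x))) \<bar>Im (X S0 (of_real x))\<bar>"

lemma W_cases: "W x = X S0 (of_real x) \<or> W x = cnj (X S0 (of_real x))"
  by (auto simp: W_def complex_eq_iff)

lemma W_cub: "cub (of_real x) (W x) = 0"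
  using W_cases[of x] chi_finite(3)[OF in_surface(2), of "of_real x"] by (auto simp: cub_cnj)

lemma W_continuous: "continuous_on {a i..b i} W"
proof -
  have "continuous_on {a i..b i} (\<lambda>x. X S0 (of_real x))"
    by (intro continuous_at_imp_continuous_on ballI isCont_X0_cut[of i]) auto
  then show ?thesis unfolding W_def[abs_def] Complex_eq by (intro continuous_intros)
qed

lemma Im_W_nonneg: "Im (W x) \<ge> 0" by (simp add: W_def)

lemma Im_W_pos: "a i < x \<Longrightarrow> x < b i \<Longrightarrow> Im (W x) > 0"
  using X0_nonreal[of i x] by (simp add: W_def)

lemma W_end: "e \<in> bp \<Longrightarrow> W e = of_real (Re (X S0 (of_real e)))"
  using X0_bp_real[of e] by (simp add: W_def complex_eq_iff)

text \<open>The imaginary part has no zero on the open cut, hence a constant sign, so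
  \<open>W\<close> is there either the boundary value throughout or its conjugate
  throughout.\<close>

lemma W_has_vector_derivative:
  assumes "a i < x" "x < b i" shows "\<exists>D. (W has_vector_derivative D) (at x)"
proof -
  let ?f = "\<lambda>x. X S0 (of_real x)"
  obtain D where D: "(?f has_vector_derivative D) (at x)"
    using X0_has_vector_derivative[OF assms] by blast
  have sg: "Im (?f y) < 0 \<longleftrightarrow> Im (?f x) < 0" if "a i < y" "y < b i" for y
  proof (rule connected_avoid_less[of "{a i<..<b i}" "\<lambda>y. Im (?f y)"])
    show "continuous_on {a i<..<b i} (\<lambda>y. Im (?f y))"
      by (intro continuous_on_Im continuous_at_imp_continuous_on ballI isCont_X0_cut[of i]) auto
  qed (use that assms X0_nonreal in auto)
  show ?thesis
  proof (cases "Im (?f x) < 0")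
    case True
    then have "W y = cnj (?f y)" if "y \<in> {a i<..<b i}" for y
      using that sg[of y] by (auto simp: W_def complex_eq_iff)
    then have "(W has_vector_derivative cnj D) (at x)"
      by (intro has_vector_derivative_transform_within_open[OF has_vector_derivative_cnj[OF D], of "{a i<..<b i}"])
        (use assms in auto)
    then show ?thesis by blast
  next
    case False
    then have "W y = ?f y" if "y \<in> {a i<..<b i}" for y
      using that sg[of y] by (auto simp: W_def complex_eq_iff)
    then have "(W has_vector_derivative D) (at x)"
      by (intro has_vector_derivative_transform_within_open[OF D, of "{a i<..<b i}"])
        (use assms in auto)
    then show ?thesis by blast
  qed
qed

definition dW :: "real \<Rightarrow> complex" where "dW x = vector_derivative W (at x)"

lemma W_deriv: "a i < x \<Longrightarrow> x < b i \<Longrightarrow> (W has_vector_derivative dW x) (at x)"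
  unfolding dW_def using W_has_vector_derivative vector_derivative_works differentiableI_vector by metis

lemma W_neq_B: "W x \<noteq> of_real (B i)"
  using W_cases[of x] chi_finite(2)[OF in_surface(2), of "of_real x" i]
  by (metis complex_cnj_cnj complex_cnj_complex_of_real)

definition MW :: "idx \<Rightarrow> real \<Rightarrow> complex" where "MW j x = 1 / (of_real (B j) - W x)"

lemma MW_nz: "MW j x \<noteq> 0" using W_neq_B[of x j] by (auto simp: MW_def)

lemma x_eq: "of_real x = W x - of_real (A I1) * MW I1 x - of_real (A I2) * MW I2 x"
proof -
  have *: "z = w - a1 * (1 / d1) - a2 * (1 / d2)"
    if "(w - z) * (- d1) * (- d2) + a1 * (- d2) + a2 * (- d1) = 0" "d1 \<noteq> 0" "d2 \<noteq> 0"
    for z w a1 a2 d1 d2 :: complex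
    using that by (simp add: field_simps)
  show ?thesis unfolding MW_def
    by (rule *) (use W_cub[of x] W_neq_B[of x I1] W_neq_B[of x I2] in \<open>auto simp: cub_alt\<close>)
qed

lemma W_chain_rule:
  assumes "a i < x" "x < b i" "(f has_field_derivative f') (at (W x))"
  shows "((\<lambda>x. f (W x)) has_vector_derivative f' * dW x) (at x)"
  using field_vector_diff_chain_at[OF W_deriv[OF assms(1,2)] assms(3)] by (simp add: o_def mult.commute)

text \<open>Differentiate x = h(W x): the first factor is h' at \<open>W x\<close>. Read backwards
  it rewrites dx as h'(W) dW, which is how integrals over x become integrals over w.\<close>

lemma dW_eq:
  assumes "a i < x" "x < b i"
  shows "(1 - of_real (A I1) * (MW I1 x)\<^sup>2 - of_real (A I2) * (MW I2 x)\<^sup>2) * dW x = 1"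
proof -
  let ?F = "\<lambda>w. w - of_real (A I1) * (1 / (of_real (B I1) - w)) - of_real (A I2) * (1 / (of_real (B I2) - w))"
  have "(?F has_field_derivative (1 - of_real (A I1) * (MW I1 x)\<^sup>2 - of_real (A I2) * (MW I2 x)\<^sup>2)) (at (W x))"
  proof -
    have "((\<lambda>w. 1 / (of_real (B j) - w)) has_field_derivative (MW j x)\<^sup>2) (at (W x))" for j
      using W_neq_B[of x j] by (auto intro!: derivative_eq_intros simp: MW_def power2_eq_square)
    then show ?thesis by (intro DERIV_diff DERIV_ident DERIV_cmult)
  qed
  from W_chain_rule[OF assms this]
  have "((\<lambda>x. ?F (W x)) has_vector_derivative (1 - of_real (A I1) * (MW I1 x)\<^sup>2 - of_real (A I2) * (MW I2 x)\<^sup>2) * dW x) (at x)" .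
  moreover have "(\<lambda>x. ?F (W x)) = complex_of_real"
    by (rule ext) (rule x_eq[symmetric, unfolded MW_def])
  ultimately have 1: "(complex_of_real has_vector_derivative (1 - of_real (A I1) * (MW I1 x)\<^sup>2 - of_real (A I2) * (MW I2 x)\<^sup>2) * dW x) (at x)"
    by (simp only:)
  have 2: "(complex_of_real has_vector_derivative 1) (at x)"
    using has_vector_derivative_real_field[OF DERIV_ident, of x UNIV] by simp
  show ?thesis using vector_derivative_unique_at[OF 1 2] .
qed

lemma MW_continuous: "continuous_on {a i..b i} (MW j)"
  unfolding MW_def[abs_def] by (intro continuous_intros W_continuous) (metis W_neq_B right_minus_eq)

text \<open>Partial fractions; a mixed product of the two \<open>MW\<close> is reduced by this to
  terms with one factor fewer.\<close>

lemma MW_diff: "MW I1 x - MW I2 x = of_real (B I2 - B I1) * (MW I1 x * MW I2 x)"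
proof -
  have "1 / d1 - 1 / d2 = (d2 - d1) * (1 / d1 * (1 / d2))" if "d1 \<noteq> 0" "d2 \<noteq> 0" for d1 d2 :: complex
    using that by (simp add: field_simps)
  from this[of "of_real (B I1) - W x" "of_real (B I2) - W x"] show ?thesis
    using W_neq_B[of x I1] W_neq_B[of x I2] by (simp add: MW_def)
qed

text \<open>\<open>W\<close> behaves like a square root at the ends of the cut, so its derivative is
  available in the interior only. The interior form of the fundamental theorem needs just continuity
  at the ends.\<close>

lemma ftc_W:
  assumes "\<And>x. a i \<le> x \<Longrightarrow> x \<le> b i \<Longrightarrow> (f has_field_derivative f' (W x)) (at (W x))"
  shows "((\<lambda>x. f' (W x) * dW x) has_integral f (W (b i)) - f (W (a i))) {a i..b i}"
proof (rule fundamental_theorem_of_calculus_interior)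
  show "a i \<le> b i" using cut_less[of i] by simp
  have "isCont f (W x)" if "x \<in> {a i..b i}" for x using assms that by (auto intro: DERIV_isCont)
  then have "continuous_on (W ` {a i..b i}) f" by (auto intro!: continuous_at_imp_continuous_on)
  then show "continuous_on {a i..b i} (\<lambda>x. f (W x))"
    using continuous_on_compose2[OF _ W_continuous] by blast
  show "((\<lambda>x. f (W x)) has_vector_derivative f' (W x) * dW x) (at x)" if "x \<in> {a i<..<b i}" for x
    using that assms by (intro W_chain_rule[of i]) auto
qed

section \<open>Contour integrals along the arcs traced by \<open>W\<close>\<close>

definition pt where "pt x = Re (X S0 (of_real x))"

lemma W_pt: "W (a i) = of_real (pt (a i))" "W (b i) = of_real (pt (b i))"
  using W_end[of "a i"] W_end[of "b i"] by (auto simp: bp_def pt_def)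

text \<open>Each arc traced by \<open>W\<close> in the upper half-plane passes from the left to the
  right of its own \<open>B i\<close> and has the other \<open>B\<close> entirely on one
  side.\<close>

lemma pt_order: "pt (a i) < B i" "B i < pt (b i)"
  "pt (a I2) > B I1" "pt (b I2) > B I1" "pt (a I1) < B I2" "pt (b I1) < B I2"
  unfolding pt_def
  using X0_end_left X0_end_right X0_inner by (cases i; simp)+

text \<open>The arcs end at real points. For powers other than the first the antiderivative is real
  there, so nothing imaginary remains. For m = 1 it is minus a logarithm, whose imaginary part
  changes by pi on the arc that passes over \<open>B j\<close> and returns to the same value on the
  other arc.\<close>

lemma moment_base:
  "\<exists>P. (\<forall>i. ((\<lambda>x. (MW j x) ^ m * dW x) has_integral P i) {a i..b i}) \<and>
     Im (P I1 + P I2) = (if m = 1 then pi else 0)"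
proof -
  consider "m = 0" | "m = 1" | n where "m = Suc (Suc n)" by (metis One_nat_def not0_implies_Suc)
  then show ?thesis
  proof cases
    case 1
    have "((\<lambda>x. 1 * dW x) has_integral W (b i) - W (a i)) {a i..b i}" for i
      by (rule ftc_W[of i "\<lambda>w. w" "\<lambda>w. 1"]) (rule DERIV_ident)
    then show ?thesis using 1 by (intro exI[of _ "\<lambda>i. W (b i) - W (a i)"]) (auto simp: W_pt)
  next
    case 2
    let ?L = "\<lambda>w. - half_log (w - of_real (B j))"
    have "(?L has_field_derivative MW j x) (at (W x))" for x
    proof -
      have "((\<lambda>w. half_log (w - of_real (B j))) has_field_derivative (1 / (W x - of_real (B j))) * 1) (at (W x))"
        by (rule DERIV_chain2[OF half_log_deriv])
          (use Im_W_nonneg[of x] W_neq_B[of x j] in \<open>auto intro!: derivative_eq_intros\<close>)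
      then have "(?L has_field_derivative - ((1 / (W x - of_real (B j))) * 1)) (at (W x))"
        by (rule DERIV_minus)
      also have "- ((1 / (W x - of_real (B j))) * 1) = MW j x"
        by (metis MW_def minus_diff_eq minus_divide_right mult.right_neutral)
      finally show ?thesis .
    qed
    then have 1: "((\<lambda>x. MW j x * dW x) has_integral ?L (W (b i)) - ?L (W (a i))) {a i..b i}" for i
      using ftc_W[of i ?L "\<lambda>w. 1 / (of_real (B j) - w)"] by (simp add: MW_def)
    have im: "Im (?L (W e)) = (if pt e > B j then pi / 2 else - (pi / 2))" if "e \<in> bp" for e
    proof -
      have "W e - of_real (B j) = of_real (pt e - B j)" using W_end[OF that] by (simp add: pt_def)
      moreover have "pt e \<noteq> B j" using X0_bp_neq[OF that] by (simp add: pt_def)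
      ultimately show ?thesis using half_log_real[of "pt e - B j"] by auto
    qed
    have "Im ((?L (W (b I1)) - ?L (W (a I1))) + (?L (W (b I2)) - ?L (W (a I2)))) = pi"
      using im[of "b I1"] im[of "a I1"] im[of "b I2"] im[of "a I2"] pt_order(1,2)[of j] pt_order(3-6)
      by (cases j) (simp_all add: bp_eq)
    then show ?thesis using 1 2 by (intro exI[of _ "\<lambda>i. ?L (W (b i)) - ?L (W (a i))"]) simp
  next
    case 3
    let ?L = "\<lambda>w. of_real (1 / real (Suc n)) * (1 / (of_real (B j) - w)) ^ Suc n"
    have "(?L has_field_derivative MW j x ^ m) (at (W x))" for x
    proof -
      have "((\<lambda>w. 1 / (of_real (B j) - w)) has_field_derivative (MW j x)\<^sup>2) (at (W x))"
        using W_neq_B[of x j] by (auto intro!: derivative_eq_intros simp: MW_def power2_eq_square)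
      from DERIV_cmult[OF DERIV_power[OF this, of "Suc n"], of "of_real (1 / real (Suc n))"]
      show ?thesis
        unfolding 3 MW_def by (simp add: power2_eq_square field_simps del: of_nat_Suc)
    qed
    then have 1: "((\<lambda>x. MW j x ^ m * dW x) has_integral ?L (W (b i)) - ?L (W (a i))) {a i..b i}" for i
      using ftc_W[of i ?L "\<lambda>w. (1 / (of_real (B j) - w)) ^ m"] by (simp add: MW_def)
    have "Im (?L (W e)) = 0" if "e \<in> bp" for e
    proof -
      have "?L (W e) = of_real (1 / real (Suc n) * (1 / (B j - pt e)) ^ Suc n)"
        using W_end[OF that] by (simp add: pt_def)
      then show ?thesis by (metis Im_complex_of_real)
    qed
    then have "Im ((?L (W (b I1)) - ?L (W (a I1))) + (?L (W (b I2)) - ?L (W (a I2)))) = 0"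
      unfolding plus_complex.sel minus_complex.sel by (simp only: bp_eq insert_iff simp_thms)
    then show ?thesis using 1 3 by (intro exI[of _ "\<lambda>i. ?L (W (b i)) - ?L (W (a i))"]) simp
  qed
qed

text \<open>\<open>MW_diff\<close> lowers the total degree by one. For m = n = 1 both resulting
  terms have degree 1 and contribute pi each, and their difference cancels.\<close>

lemma moment_dW:
  "\<exists>P. (\<forall>i. ((\<lambda>x. (MW I1 x) ^ m * (MW I2 x) ^ n * dW x) has_integral P i) {a i..b i}) \<and>
     Im (P I1 + P I2) = (if m + n = 1 then pi else 0)"
proof (induction "m + n" arbitrary: m n rule: less_induct)
  case less
  show ?case
  proof (cases "m = 0 \<or> n = 0")
    case True
    then show ?thesis using moment_base[of I1 m] moment_base[of I2 n] by (cases "m = 0") auto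
  next
    case False
    then obtain m' n' where mn: "m = Suc m'" "n = Suc n'" by (metis not0_implies_Suc)
    define d where "d = B I2 - B I1"
    have d: "d \<noteq> 0" using B_neq by (simp add: d_def)
    from less[of m n'] less[of m' n] obtain P Q where
      P: "\<And>i. ((\<lambda>x. (MW I1 x) ^ m * (MW I2 x) ^ n' * dW x) has_integral P i) {a i..b i}"
        "Im (P I1 + P I2) = (if m + n' = 1 then pi else 0)" and
      Q: "\<And>i. ((\<lambda>x. (MW I1 x) ^ m' * (MW I2 x) ^ n * dW x) has_integral Q i) {a i..b i}"
        "Im (Q I1 + Q I2) = (if m' + n = 1 then pi else 0)"
      using mn by auto
    have e: "of_real (1 / d) * ((MW I1 x) ^ m * (MW I2 x) ^ n' * dW x - (MW I1 x) ^ m' * (MW I2 x) ^ n * dW x)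
       = (MW I1 x) ^ m * (MW I2 x) ^ n * dW x" for x
    proof -
      have "(MW I1 x) ^ m * (MW I2 x) ^ n' * dW x - (MW I1 x) ^ m' * (MW I2 x) ^ n * dW x
        = (MW I1 x - MW I2 x) * ((MW I1 x) ^ m' * (MW I2 x) ^ n' * dW x)"
        unfolding mn by (simp add: algebra_simps)
      also have "\<dots> = of_real d * ((MW I1 x) ^ m * (MW I2 x) ^ n * dW x)"
        unfolding MW_diff d_def[symmetric] mn by (simp add: algebra_simps)
      finally show ?thesis using d by simp
    qed
    have "((\<lambda>x. (MW I1 x) ^ m * (MW I2 x) ^ n * dW x) has_integral of_real (1 / d) * (P i - Q i)) {a i..b i}" for i
      using has_integral_mult_right[OF has_integral_diff[OF P(1) Q(1)], of "of_real (1 / d)" i] unfolding e .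
    moreover have "Im (of_real (1 / d) * (P I1 - Q I1) + of_real (1 / d) * (P I2 - Q I2)) = 0"
    proof -
      have "Im (of_real (1 / d) * (P I1 - Q I1) + of_real (1 / d) * (P I2 - Q I2)) =
         1 / d * (Im (P I1 + P I2) - Im (Q I1 + Q I2))"
        by (simp add: algebra_simps diff_divide_distrib add_divide_distrib)
      also have "m + n' = 1 \<longleftrightarrow> m' + n = 1" using mn by auto
      then have "Im (P I1 + P I2) - Im (Q I1 + Q I2) = 0" using P(2) Q(2) by simp
      finally show ?thesis by simp
    qed
    ultimately show ?thesis using mn
      by (intro exI[of _ "\<lambda>i. of_real (1 / d) * (P i - Q i)"]) auto
  qed
qed

text \<open>Replacing dx by h'(W) dW turns the moment of order (m, n) into those of orders (m, n),
  (m + 2, n) and (m, n + 2). The last two have total degree at least 3 because m + n is at least 1,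
  so they add no imaginary part.\<close>

lemma moment_dx:
  assumes "m + n \<ge> 1"
  shows "\<exists>P. (\<forall>i. ((\<lambda>x. Im ((MW I1 x) ^ m * (MW I2 x) ^ n)) has_integral P i) {a i..b i}) \<and>
     P I1 + P I2 = (if m + n = 1 then pi else 0)"
proof -
  obtain P Q R where
      P: "\<And>i. ((\<lambda>x. (MW I1 x) ^ m * (MW I2 x) ^ n * dW x) has_integral P i) {a i..b i}"
        "Im (P I1 + P I2) = (if m + n = 1 then pi else 0)" and
      Q: "\<And>i. ((\<lambda>x. (MW I1 x) ^ (m + 2) * (MW I2 x) ^ n * dW x) has_integral Q i) {a i..b i}"
        "Im (Q I1 + Q I2) = 0" and
      R: "\<And>i. ((\<lambda>x. (MW I1 x) ^ m * (MW I2 x) ^ (n + 2) * dW x) has_integral R i) {a i..b i}"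
        "Im (R I1 + R I2) = 0"
    using moment_dW[of m n] moment_dW[of "m + 2" n] moment_dW[of m "n + 2"] assms by auto
  let ?T = "\<lambda>i. P i - of_real (A I1) * Q i - of_real (A I2) * R i"
  have "((\<lambda>x. (MW I1 x) ^ m * (MW I2 x) ^ n) has_integral ?T i) {a i..b i}" for i
  \<comment> \<open>\<open>dW_eq\<close> holds in the open cut; the two endpoints form a finite
    exceptional set.\<close>
  proof (rule has_integral_spike_finite)
    show "((\<lambda>x. (MW I1 x) ^ m * (MW I2 x) ^ n * dW x
        - of_real (A I1) * ((MW I1 x) ^ (m + 2) * (MW I2 x) ^ n * dW x)
        - of_real (A I2) * ((MW I1 x) ^ m * (MW I2 x) ^ (n + 2) * dW x)) has_integral ?T i) {a i..b i}"
      by (intro has_integral_diff has_integral_mult_right P Q R)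
    show "(MW I1 x) ^ m * (MW I2 x) ^ n = (MW I1 x) ^ m * (MW I2 x) ^ n * dW x
        - of_real (A I1) * ((MW I1 x) ^ (m + 2) * (MW I2 x) ^ n * dW x)
        - of_real (A I2) * ((MW I1 x) ^ m * (MW I2 x) ^ (n + 2) * dW x)"
      if "x \<in> {a i..b i} - {a i, b i}" for x
    proof -
      have "(1 - of_real (A I1) * (MW I1 x)\<^sup>2 - of_real (A I2) * (MW I2 x)\<^sup>2) * dW x = 1"
        using that by (intro dW_eq[of i]) auto
      then have "(MW I1 x) ^ m * (MW I2 x) ^ n = (MW I1 x) ^ m * (MW I2 x) ^ n *
        ((1 - of_real (A I1) * (MW I1 x)\<^sup>2 - of_real (A I2) * (MW I2 x)\<^sup>2) * dW x)" by simp
      also have "\<dots> = (MW I1 x) ^ m * (MW I2 x) ^ n * dW x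
        - of_real (A I1) * ((MW I1 x) ^ (m + 2) * (MW I2 x) ^ n * dW x)
        - of_real (A I2) * ((MW I1 x) ^ m * (MW I2 x) ^ (n + 2) * dW x)"
        by (simp add: power_add power2_eq_square algebra_simps)
      finally show ?thesis .
    qed
  qed simp
  then have "((\<lambda>x. Im ((MW I1 x) ^ m * (MW I2 x) ^ n)) has_integral Im (?T i)) {a i..b i}" for i
    by (rule has_integral_linear[OF _ bounded_linear_Im, unfolded o_def])
  moreover have "Im (?T I1) + Im (?T I2) = Im (P I1 + P I2) - A I1 * Im (Q I1 + Q I2) - A I2 * Im (R I1 + R I2)"
    by (simp add: algebra_simps)
  ultimately show ?thesis using P(2) Q(2) R(2) by (intro exI[of _ "\<lambda>i. Im (?T i)"]) auto
qed

end

lemma Im_inverse_diff: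
  "Im (1 / (of_real r - w)) = Im w * (cmod (1 / (of_real r - w)))\<^sup>2"
  by (simp add: Im_divide_Reals cmod_power2 Im_divide norm_divide power_divide)

lemma abs_Im_mult_le: "\<bar>Im (z * u)\<bar> \<le> \<bar>Im z\<bar> * cmod u + cmod z * \<bar>Im u\<bar>"
proof -
  have "\<bar>Im (z * u)\<bar> \<le> \<bar>Im z\<bar> * \<bar>Re u\<bar> + \<bar>Re z\<bar> * \<bar>Im u\<bar>"
    by (simp add: abs_mult[symmetric])
  also have "\<dots> \<le> \<bar>Im z\<bar> * cmod u + cmod z * \<bar>Im u\<bar>"
    by (intro add_mono mult_mono abs_Re_le_cmod) auto
  finally show ?thesis .
qed

lemma path_star_simps: "path_star [] = {}" "path_star (j # V) = insert (j # V) (path_star V)"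
  by (auto simp: path_star_def suffix_Cons)

lemma path_star_not_in: "j # V \<notin> path_star V"
  by (auto simp: path_star_def dest: suffix_length_le)

lemma finite_path_star: "finite (path_star V)"
  by (induction V) (auto simp: path_star_simps)

section \<open>Comparison of the spectral densities with \<open>omega_c\<close>\<close>

context surface_map
begin

definition K where "K = (\<Union>i. {a i..b i})"
definition Ko where "Ko = (\<Union>i. {a i<..<b i})"

lemma K_eq: "K = {a I1..b I1} \<union> {a I2..b I2}" by (simp add: K_def UNIV_idx)

lemma Ko_K: "Ko \<subseteq> K" by (auto simp: K_def Ko_def intro: less_imp_le)

lemma K_Ko: "x \<in> K \<Longrightarrow> x \<in> Ko \<or> x \<in> bp"
proof -
  assume "x \<in> K"
  then obtain i where "a i \<le> x" "x \<le> b i" by (auto simp: K_def)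
  then have "x = a i \<or> x = b i \<or> (a i < x \<and> x < b i)" by auto
  then show ?thesis by (auto simp: Ko_def bp_def)
qed

lemma compact_K: "compact K" by (simp add: K_eq compact_Un)

lemma K_nonempty: "K \<noteq> {}" using cut_less[of I1] by (auto simp: K_eq)

lemma continuous_on_K:
  fixes f :: "real \<Rightarrow> 'a::topological_space"
  shows "(\<And>i. continuous_on {a i..b i} f) \<Longrightarrow> continuous_on K f"
  unfolding K_eq by (intro continuous_on_closed_Un) auto

text \<open>The roots of the cubic over x sum to x + B1 + B2, so inside a cut this is the real root
  left over beside the pair \<open>W x\<close> and its conjugate.\<close>

definition third_root where "third_root x = x + B I1 + B I2 - 2 * Re (W x)"
definition gap where "gap x = cmod (W x - of_real (third_root x))"

text \<open>The sum relation for the three sheets passes to the limit at e, where sheets 0 and i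
  acquire the same value.\<close>

lemma third_sheet_end:
  assumes i: "e = a i \<or> e = b i"
  shows "X (S (other i)) (of_real e) = - cp (of_real e) - X S0 (of_real e) - X S0 (of_real e)"
proof -
  let ?e = "complex_of_real e" and ?j = "other i"
  have l: "(X S0 \<longlongrightarrow> X S0 ?e) (at ?e)" using branch_lim(1)[OF i] by (simp add: isCont_def)
  have cpl: "(cp \<longlongrightarrow> cp ?e) (at ?e)" unfolding cp_def[abs_def] by (intro tendsto_intros)
  have lim: "((\<lambda>z. - cp z - X S0 z - X (S i) z) \<longlongrightarrow> - cp ?e - X S0 ?e - X S0 ?e) (at ?e)"
    by (intro tendsto_intros l branch_lim(2)[OF i] cpl)
  have "\<not> ?e islimpt (complex_of_real ` bp)" using finite_bp by (intro islimpt_finite) simp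
  then have "\<forall>\<^sub>F z in at ?e. z \<notin> complex_of_real ` bp" by (simp add: islimpt_iff_eventually)
  then have "\<forall>\<^sub>F z in at ?e. - cp z - X S0 z - X (S i) z = X (S ?j) z"
  proof eventually_elim
    case (elim z)
    show ?case using cub_roots(2)[OF elim] by (cases i) auto
  qed
  from Lim_transform_eventually[OF lim this]
  have "(X (S ?j) \<longlongrightarrow> - cp ?e - X S0 ?e - X S0 ?e) (at ?e)" .
  moreover have "isCont (X (S ?j)) ?e"
    using i cuts by (intro isCont_X) (cases i; auto)
  ultimately show ?thesis by (metis LIM_unique isCont_def)
qed

text \<open>Inside a cut a nonreal number differs from a real one. At a branch point the third root
  is the value on the uninvolved sheet, a different point of the surface, so injectivity of
  \<open>chi\<close> rules out a triple root.\<close>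

lemma gap_pos: assumes "x \<in> K" shows "gap x > 0"
proof (cases "x \<in> Ko")
  case True
  then have "Im (W x) > 0" using Im_W_pos by (auto simp: Ko_def)
  then have "W x \<noteq> of_real (third_root x)" by (auto simp: complex_eq_iff)
  then show ?thesis by (simp add: gap_def)
next
  case False
  then have e: "x \<in> bp" using assms K_Ko by blast
  then obtain i where i: "x = a i \<or> x = b i" by (auto simp: bp_def)
  have W: "W x = X S0 (of_real x)" using W_cases[of x] X0_bp_real[OF e] by (auto simp: complex_eq_iff)
  have "complex_of_real (third_root x) = - cp (of_real x) - X S0 (of_real x) - X S0 (of_real x)"
    using X0_bp_real[OF e] by (simp add: third_root_def W cp_def complex_eq_iff)
  also have "\<dots> = X (S (other i)) (of_real x)" using third_sheet_end[OF i] by simp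
  finally have rr: "complex_of_real (third_root x) = X (S (other i)) (of_real x)" .
  have "(S (other i), Some (complex_of_real x)) \<in> surface a b"
    using i a_neq_b by (cases i) (auto simp: surface_def)
  then have "X S0 (of_real x) \<noteq> X (S (other i)) (of_real x)"
    using X_eq_iff[OF in_surface(2)] by blast
  then show ?thesis using rr by (simp add: gap_def W)
qed

text \<open>Square root of the identity in \<open>nonreal_root\<close>. As \<open>gap\<close> is
  bounded away from 0 on the compact set K, \<open>Im (W x)\<close> decays at the ends of the cuts
  exactly like the density of \<open>omega_c\<close>.\<close>

lemma Im_W_gap:
  assumes "x \<in> K" shows "2 * Im (W x) * (gap x)\<^sup>2 = \<bar>B I1 - B I2\<bar> * sqrt \<bar>prd x\<bar>"
proof (cases "x \<in> bp")
  case True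
  then show ?thesis using W_end[OF True] prd_0_iff[of x] by simp
next
  case False
  then have "x \<in> Ko" using assms K_Ko by blast
  then obtain i where i: "a i < x" "x < b i" by (auto simp: Ko_def)
  have im: "Im (W x) > 0" using Im_W_pos i by blast
  then have "(B I1 - B I2)\<^sup>2 * prd x = - 4 * (Im (W x))\<^sup>2 * ((gap x)\<^sup>2)\<^sup>2"
    using nonreal_root[OF W_cub[of x]] unfolding gap_def third_root_def by simp
  then have "(B I1 - B I2)\<^sup>2 * \<bar>prd x\<bar> = (2 * Im (W x) * (gap x)\<^sup>2)\<^sup>2"
    using prd_neg[OF i] by (simp add: power_mult_distrib)
  then have "sqrt ((B I1 - B I2)\<^sup>2 * \<bar>prd x\<bar>) = 2 * Im (W x) * (gap x)\<^sup>2"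
    using im by (simp add: real_sqrt_unique)
  then show ?thesis by (simp add: real_sqrt_mult)
qed

text \<open>By \<open>Im_W_gap\<close> this is \<open>\<Im> M\<^sup>j(x\<^sub>+) / \<pi>\<close> divided by the density of \<open>omega_c\<close>, in a form that is
  continuous and positive up to the endpoints of the cuts.\<close>

definition dens where
  "dens j x = \<bar>B I1 - B I2\<bar> / (2 * pi * (gap x)\<^sup>2) * (cmod (MW j x))\<^sup>2"

lemma dens_pos: "x \<in> K \<Longrightarrow> dens j x > 0"
  using gap_pos[of x] B_neq MW_nz[of j x] by (auto simp: dens_def intro!: divide_pos_pos mult_pos_pos)

lemma dens_eq: assumes "x \<in> K" shows "dens j x * sqrt \<bar>prd x\<bar> = Im (MW j x) / pi"
proof -
  have "dens j x * sqrt \<bar>prd x\<bar> = (\<bar>B I1 - B I2\<bar> * sqrt \<bar>prd x\<bar>) / (2 * pi * (gap x)\<^sup>2) * (cmod (MW j x))\<^sup>2"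
    by (simp add: dens_def)
  also have "\<dots> = Im (W x) / pi * (cmod (MW j x))\<^sup>2"
    unfolding Im_W_gap[OF assms, symmetric] using gap_pos[OF assms] by simp
  also have "\<dots> = Im (MW j x) / pi"
    unfolding MW_def Im_inverse_diff by simp
  finally show ?thesis .
qed

lemma dens_continuous: "continuous_on K (dens j)"
proof (rule continuous_on_K)
  fix i
  have "x \<in> K" if "x \<in> {a i..b i}" for x using that by (auto simp: K_def)
  then show "continuous_on {a i..b i} (dens j)"
    unfolding dens_def[abs_def] using gap_pos
    by (intro continuous_intros MW_continuous) 
      (force simp: gap_def[abs_def] third_root_def intro!: continuous_intros W_continuous)+
qed

text \<open>The value 1 off the cuts makes the two-sided bounds hold at every real x; these points
  carry no mass of \<open>omega_c\<close>.\<close>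

definition kap where "kap j x = (if x \<in> K then dens j x else 1)"

lemma kap_bounds: "\<exists>m M. 0 < m \<and> (\<forall>j x. m \<le> kap j x \<and> kap j x \<le> M)"
proof -
  have ex: "\<exists>m M. 0 < m \<and> (\<forall>x\<in>K. m \<le> dens j x \<and> dens j x \<le> M)" for j
    using continuous_attains_inf[OF compact_K K_nonempty dens_continuous, of j]
      continuous_attains_sup[OF compact_K K_nonempty dens_continuous, of j] dens_pos by metis
  obtain m1 M1 where 1: "0 < m1" "\<And>x. x \<in> K \<Longrightarrow> m1 \<le> dens I1 x \<and> dens I1 x \<le> M1" using ex[of I1] by blast
  obtain m2 M2 where 2: "0 < m2" "\<And>x. x \<in> K \<Longrightarrow> m2 \<le> dens I2 x \<and> dens I2 x \<le> M2" using ex[of I2] by blast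
  have "min 1 (min m1 m2) \<le> kap j x \<and> kap j x \<le> max 1 (max M1 M2)" for j x
    using 1(2)[of x] 2(2)[of x] by (cases j) (auto simp: kap_def min_def max_def)
  then show ?thesis using 1 2 by (intro exI[of _ "min 1 (min m1 m2)"] exI[of _ "max 1 (max M1 M2)"]) auto
qed

lemma kap_measurable: "kap j \<in> borel_measurable borel"
  unfolding kap_def[abs_def]
  by (rule borel_measurable_continuous_on_if[OF _ dens_continuous])
    (use compact_K in \<open>auto intro: borel_compact\<close>)

section \<open>Generalized eigenfunctions on the tree\<close>

definition QW :: "vertex \<Rightarrow> real \<Rightarrow> complex" where
  "QW V x = (\<Prod>Y\<in>path_star V. - of_real (sqrt (A (hd Y))) * MW (hd Y) x)"

lemma QW_simps: "QW [] x = 1" "QW (j # V) x = - of_real (sqrt (A j)) * MW j x * QW V x"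
  unfolding QW_def path_star_simps
  by (simp_all add: prod.insert[OF finite_path_star path_star_not_in])

text \<open>Almost every point for \<open>omega_c\<close> lies in \<open>Ko\<close>. Off
  \<open>Ko\<close> bounded filler values are used, chosen so that the function at the root vertex
  is 1 at every x.\<close>

definition psiW :: "idx \<Rightarrow> vertex \<Rightarrow> real \<Rightarrow> real" where
  "psiW i V x = (if x \<in> Ko then Im (MW i x * QW V x) / Im (MW i x) else if V = [] then 1 else 0)"

lemma Im_MW_pos: "x \<in> Ko \<Longrightarrow> Im (MW i x) > 0"
  using Im_W_pos[of _ x] MW_nz[of i x] unfolding MW_def Im_inverse_diff
  by (auto simp: Ko_def)

lemma psiW_root: "psiW i [] x = 1"
  using Im_MW_pos[of x i] by (auto simp: psiW_def QW_simps)

lemma sqrt_A_mult: "of_real (sqrt (A j)) * of_real (sqrt (A j)) = complex_of_real (A j)"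
  using A_pos[of j] by (simp flip: of_real_mult)

lemma W_MW: "(of_real (B j) - W x) * MW j x = 1"
  using W_neq_B[of x j] by (simp add: MW_def)

lemma MW_recursion: "of_real (B j) - of_real x - of_real (A I1) * MW I1 x - of_real (A I2) * MW I2 x = of_real (B j) - W x"
  using x_eq[of x] by (simp add: algebra_simps)

text \<open>\<open>MW i x * QW V x\<close> is a Green function: by \<open>x_eq\<close> it solves the
  difference equation with right side 1 at the root and 0 elsewhere. That right side is real, so the
  imaginary part solves the homogeneous equation at the root as well.\<close>

lemma psiW_eigen:
  assumes x: "x \<in> Ko"
  shows "(\<Sum>j\<in>{I1, I2}. sqrt (A j) * psiW i (j # V) x) + (if V = [] then 0 else sqrt (A (hd V)) * psiW i (tl V) x)
     + B (if V = [] then i else hd V) * psiW i V x = x * psiW i V x"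
proof -
  let ?G = "\<lambda>V. MW i x * QW V x"
  have "(\<Sum>j\<in>{I1, I2}. of_real (sqrt (A j)) * ?G (j # V)) + (if V = [] then 0 else of_real (sqrt (A (hd V))) * ?G (tl V))
     + of_real (B (if V = [] then i else hd V)) * ?G V - of_real x * ?G V = (if V = [] then 1 else 0)"
  proof -
    have s: "(\<Sum>j\<in>{I1, I2}. of_real (sqrt (A j)) * ?G (j # V)) = - (of_real (A I1) * MW I1 x + of_real (A I2) * MW I2 x) * ?G V"
      by (simp add: QW_simps sqrt_A_mult[symmetric] algebra_simps)
    have t: "(\<Sum>j\<in>{I1, I2}. of_real (sqrt (A j)) * ?G (j # V)) + of_real (B k) * ?G V - of_real x * ?G V = (of_real (B k) - W x) * ?G V" for k
      unfolding s MW_recursion[symmetric] by (simp add: algebra_simps)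
    show ?thesis
    proof (cases V)
      case Nil
      then show ?thesis using t[of i] W_MW[of i x] by (simp add: QW_simps)
    next
      case (Cons j U)
      have "(of_real (B j) - W x) * ?G V = - of_real (sqrt (A j)) * ?G U * ((of_real (B j) - W x) * MW j x)"
        unfolding Cons QW_simps by (simp add: algebra_simps)
      then have "(of_real (B j) - W x) * ?G V = - (of_real (sqrt (A j)) * ?G U)" unfolding W_MW by simp
      moreover have "p + e + q - r = 0" if "p + q - r = y" "y = - e" for p q r y e :: complex
        using that by (simp add: algebra_simps)
      ultimately show ?thesis using t[of j] unfolding Cons by (simp only: list.simps list.sel if_False)
    qed
  qed
  from arg_cong[OF this, of Im]
  have ImG: "(\<Sum>j\<in>{I1, I2}. sqrt (A j) * Im (?G (j # V))) + (if V = [] then 0 else sqrt (A (hd V)) * Im (?G (tl V)))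
     + B (if V = [] then i else hd V) * Im (?G V) - x * Im (?G V) = 0"
    by (auto simp del: sum.insert simp: if_distrib[of Im] cong: if_cong split: if_splits)
  have G: "Im (?G V) = Im (MW i x) * psiW i V x" for V
    using Im_MW_pos[OF x, of i] x by (simp add: psiW_def)
  from ImG[unfolded G] have "Im (MW i x) * ((\<Sum>j\<in>{I1, I2}. sqrt (A j) * psiW i (j # V) x) + (if V = [] then 0 else sqrt (A (hd V)) * psiW i (tl V) x)
     + B (if V = [] then i else hd V) * psiW i V x - x * psiW i V x) = 0"
    by (simp add: algebra_simps split: if_splits)
  then show ?thesis using Im_MW_pos[OF x, of i] by simp
qed

lemma MW_continuous_K: "continuous_on K (MW j)"
  by (rule continuous_on_K) (rule MW_continuous)

lemma QW_continuous: "continuous_on K (QW V)"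
  unfolding QW_def[abs_def] by (intro continuous_intros MW_continuous_K)

lemma psiW_measurable: "psiW i V \<in> borel_measurable borel"
  unfolding psiW_def[abs_def]
proof (rule borel_measurable_continuous_on_if)
  show "Ko \<in> sets borel" by (auto simp: Ko_def intro!: borel_open)
  show "continuous_on Ko (\<lambda>x. Im (MW i x * QW V x) / Im (MW i x))"
    using Im_MW_pos[of _ i] continuous_on_subset[OF MW_continuous_K Ko_K] continuous_on_subset[OF QW_continuous Ko_K]
    by (intro continuous_intros) force+
qed auto

lemma MW_bounded: "\<exists>c\<ge>1. \<forall>x\<in>K. \<forall>j. cmod (MW j x) \<le> c"
proof -
  have "\<exists>c. \<forall>x\<in>K. cmod (MW j x) \<le> c" for j
    using compact_imp_bounded[OF compact_continuous_image[OF MW_continuous_K compact_K, of j]]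
    by (auto simp: bounded_iff)
  then obtain c where c: "\<And>j x. x \<in> K \<Longrightarrow> cmod (MW j x) \<le> c j" by metis
  have "cmod (MW j x) \<le> max 1 (max (c I1) (c I2))" if "x \<in> K" for j x
    using c[OF that, of j] by (cases j) auto
  then show ?thesis by (intro exI[of _ "max 1 (max (c I1) (c I2))"]) auto
qed

text \<open>Each \<open>Im (MW j x)\<close> is \<open>Im (W x)\<close> times a bounded factor, and
  the imaginary part of a product inherits such a bound. Hence the quotient in \<open>psiW\<close>
  stays bounded at the ends of the cuts, where numerator and denominator both vanish.\<close>

lemma QW_bounded:
  "\<exists>C\<ge>0. \<forall>x\<in>K. cmod (MW i x * QW V x) \<le> C \<and> \<bar>Im (MW i x * QW V x)\<bar> \<le> C * Im (W x)"
proof -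
  obtain c where c: "c \<ge> 1" "\<And>x j. x \<in> K \<Longrightarrow> cmod (MW j x) \<le> c" using MW_bounded by blast
  have im: "\<bar>Im (MW j x)\<bar> \<le> c\<^sup>2 * Im (W x)" if "x \<in> K" for j x
  proof -
    have "\<bar>Im (MW j x)\<bar> = (cmod (MW j x))\<^sup>2 * Im (W x)"
      using Im_W_nonneg[of x] unfolding MW_def Im_inverse_diff by (simp add: abs_mult)
    also have "\<dots> \<le> c\<^sup>2 * Im (W x)"
      using c(2)[OF that, of j] Im_W_nonneg[of x] by (intro mult_right_mono power_mono) auto
    finally show ?thesis .
  qed
  show ?thesis
  proof (induction V)
    case Nil
    have "c \<le> c\<^sup>2" using c(1) by (simp add: power2_eq_square)
    then show ?case using c(1) im
      by (intro exI[of _ "c\<^sup>2"]) (auto simp: QW_simps intro: order_trans[OF c(2)])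
  next
    case (Cons j V)
    then obtain C where C: "C \<ge> 0" "\<And>x. x \<in> K \<Longrightarrow> cmod (MW i x * QW V x) \<le> C"
      "\<And>x. x \<in> K \<Longrightarrow> \<bar>Im (MW i x * QW V x)\<bar> \<le> C * Im (W x)" by blast
    let ?s = "sqrt (A j)"
    have s: "?s \<ge> 0" using A_pos[of j] by simp
    have e: "MW i x * QW (j # V) x = of_real (- ?s) * (MW j x * (MW i x * QW V x))" for x
      by (simp add: QW_simps)
    have 1: "cmod (MW i x * QW (j # V) x) \<le> ?s * (c * C)" if "x \<in> K" for x
      unfolding e norm_mult[of "of_real _"] norm_mult[of "MW j x"] norm_of_real abs_minus abs_of_nonneg[OF s]
      using c(1) c(2)[OF that, of j] C(2)[OF that] C(1) s by (intro mult_left_mono mult_mono) auto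
    have 2: "\<bar>Im (MW i x * QW (j # V) x)\<bar> \<le> ?s * ((c\<^sup>2 * C + c * C) * Im (W x))" if "x \<in> K" for x
    proof -
      have "\<bar>Im (MW j x * (MW i x * QW V x))\<bar> \<le> \<bar>Im (MW j x)\<bar> * cmod (MW i x * QW V x) + cmod (MW j x) * \<bar>Im (MW i x * QW V x)\<bar>"
        by (rule abs_Im_mult_le)
      also have "\<dots> \<le> (c\<^sup>2 * Im (W x)) * C + c * (C * Im (W x))"
        using c(1) im[OF that, of j] c(2)[OF that, of j] C(1) C(2)[OF that] C(3)[OF that] Im_W_nonneg[of x]
        by (intro add_mono mult_mono) auto
      also have "\<dots> = (c\<^sup>2 * C + c * C) * Im (W x)" by (simp add: algebra_simps)
      finally have "?s * \<bar>Im (MW j x * (MW i x * QW V x))\<bar> \<le> ?s * ((c\<^sup>2 * C + c * C) * Im (W x))"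
        using s by (rule mult_left_mono)
      moreover have "Im (MW i x * QW (j # V) x) = - ?s * Im (MW j x * (MW i x * QW V x))"
        unfolding e by (subst times_complex.sel) simp
      ultimately show ?thesis using s by (simp add: abs_mult)
    qed
    let ?D = "?s * (c * C) + ?s * (c\<^sup>2 * C + c * C)"
    have p: "?s * (c * C) \<ge> 0" "?s * (c\<^sup>2 * C + c * C) \<ge> 0" using s C(1) c(1) by auto
    show ?case
    proof (intro exI[of _ ?D] conjI ballI)
      show "?D \<ge> 0" using p by simp
      fix x assume x: "x \<in> K"
      show "cmod (MW i x * QW (j # V) x) \<le> ?D" using 1[OF x] p by linarith
      have "?s * (c\<^sup>2 * C + c * C) * Im (W x) \<le> ?D * Im (W x)"
        using p Im_W_nonneg[of x] by (intro mult_right_mono) auto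
      then show "\<bar>Im (MW i x * QW (j # V) x)\<bar> \<le> ?D * Im (W x)" using 2[OF x] by (simp add: mult.assoc)
    qed
  qed
qed

lemma psiW_bounded: "\<exists>C. \<forall>x. \<bar>psiW i V x\<bar> \<le> C"
proof -
  obtain C where C: "C \<ge> 0" "\<And>x. x \<in> K \<Longrightarrow> \<bar>Im (MW i x * QW V x)\<bar> \<le> C * Im (W x)"
    using QW_bounded by blast
  have "continuous_on K (\<lambda>x. cmod (of_real (B i) - W x))"
    by (intro continuous_intros continuous_on_K W_continuous)
  then have "bounded ((\<lambda>x. cmod (of_real (B i) - W x)) ` K)"
    by (intro compact_imp_bounded compact_continuous_image compact_K)
  then obtain D where D: "\<And>x. x \<in> K \<Longrightarrow> cmod (of_real (B i) - W x) \<le> D"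
    unfolding bounded_iff by auto
  have "\<bar>psiW i V x\<bar> \<le> max 1 (C * D\<^sup>2)" for x
  proof (cases "x \<in> Ko")
    case True
    then have x: "x \<in> K" using Ko_K by blast
    have n: "cmod (of_real (B i) - W x) > 0" using W_neq_B[of x i] by auto
    have "Im (W x) = Im (MW i x) * (cmod (of_real (B i) - W x))\<^sup>2"
      unfolding MW_def Im_inverse_diff using n by (simp add: norm_divide power_divide)
    also have "\<dots> \<le> Im (MW i x) * D\<^sup>2"
      using Im_MW_pos[OF True, of i] D[OF x] by (intro mult_left_mono power_mono) auto
    finally have "\<bar>Im (MW i x * QW V x)\<bar> \<le> C * (Im (MW i x) * D\<^sup>2)"
      using C(2)[OF x] mult_left_mono[OF _ C(1)] order_trans by blast
    then have "\<bar>psiW i V x\<bar> \<le> C * D\<^sup>2"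
      using True Im_MW_pos[OF True, of i] by (simp add: psiW_def abs_divide divide_le_eq mult_ac)
    then show ?thesis by simp
  qed (auto simp: psiW_def)
  then show ?thesis by blast
qed

lemma M_fun_cases:
  "(\<forall>j. M_fun chi B j (S0, Some (of_real x)) = MW j x) \<or>
   (\<forall>j. M_fun chi B j (S0, Some (of_real x)) = cnj (MW j x))"
proof -
  have M: "M_fun chi B j (S0, Some (of_real x)) = 1 / (of_real (B j) - X S0 (of_real x))" for j
    using chi_finite(1)[OF in_surface(2), of "of_real x"] by (simp add: M_fun_def)
  show ?thesis using W_cases[of x]
  proof
    assume "W x = cnj (X S0 (of_real x))"
    then have "X S0 (of_real x) = cnj (W x)" by simp
    then show ?thesis unfolding M MW_def by simp
  qed (simp add: M MW_def)
qed

lemma Psi_eq: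
  assumes "x \<in> Ko" shows "Psi chi A B i V x = psiW i V x"
  using M_fun_cases[of x]
proof
  assume *: "\<forall>j. M_fun chi B j (S0, Some (of_real x)) = MW j x"
  show ?thesis using assms unfolding Psi_def * [rule_format] psiW_def QW_def by simp
next
  assume *: "\<forall>j. M_fun chi B j (S0, Some (of_real x)) = cnj (MW j x)"
  have "(\<Prod>Y\<in>path_star V. - of_real (sqrt (A (hd Y))) * cnj (MW (hd Y) x)) = cnj (QW V x)"
    unfolding QW_def cnj_prod by simp
  moreover have "1 / Im (cnj u) * Im (cnj u * cnj v) = Im (u * v) / Im u" for u v
  proof -
    have "1 / (- p) * (- q) = q / p" for p q :: real by simp
    then show ?thesis unfolding complex_cnj_mult[symmetric] cnj.simps .
  qed
  ultimately show ?thesis using assms unfolding Psi_def * [rule_format] psiW_def by (simp only: if_True)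
qed

section \<open>The measure \<open>omega_c\<close> and the moment formula\<close>

lemma K_borel: "K \<in> sets borel" using compact_K by (intro borel_compact)

lemma omega_eq: "omega_c a b = density lborel (\<lambda>x. ennreal (indicat_real K x * sqrt \<bar>prd x\<bar>))"
  unfolding omega_c_def K_def[symmetric] prd_def[symmetric]
  by (intro arg_cong[where f = "density lborel"]) (auto simp: indicator_def)

lemma prd_measurable [measurable]: "prd \<in> borel_measurable borel"
  unfolding prd_def[abs_def] by measurable

lemma omega_sets [simp, measurable_cong]: "sets (omega_c a b) = sets borel" by (simp add: omega_eq)

lemma omega_space [simp]: "space (omega_c a b) = UNIV" by (simp add: omega_eq)

lemma omega_dens_measurable: "(\<lambda>x. indicat_real K x * sqrt \<bar>prd x\<bar>) \<in> borel_measurable borel"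
  using K_borel by measurable

lemma omega_AE: "AE x in omega_c a b. x \<in> Ko"
proof -
  have "AE x in lborel. x \<notin> bp"
    by (rule AE_not_in) (use finite_bp in \<open>auto simp: finite_imp_null_set_lborel\<close>)
  then show ?thesis unfolding omega_eq
    by (subst AE_density) (use omega_dens_measurable K_Ko in \<open>auto simp: indicator_def elim!: eventually_mono\<close>)
qed

lemma set_integral_cut:
  assumes "continuous_on {a i..b i} (f :: real \<Rightarrow> real)"
  shows "integrable lborel (\<lambda>x. indicat_real {a i..b i} x * f x)"
    and "(\<integral>x. indicat_real {a i..b i} x * f x \<partial>lborel) = integral {a i..b i} f"
proof -
  have "set_integrable lborel {a i..b i} f" by (rule borel_integrable_atLeastAtMost'[OF assms])
  then show "integrable lborel (\<lambda>x. indicat_real {a i..b i} x * f x)"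
    and "(\<integral>x. indicat_real {a i..b i} x * f x \<partial>lborel) = integral {a i..b i} f"
    using set_borel_integral_eq_integral(2)[of "{a i..b i}" f]
    by (simp_all add: set_integrable_def set_lebesgue_integral_def)
qed

lemma omega_finite: "finite_measure (omega_c a b)"
proof -
  have c: "continuous_on T (\<lambda>x. sqrt \<bar>prd x\<bar>)" for T
    unfolding prd_def by (intro continuous_intros)
  have "integrable lborel (\<lambda>x. indicat_real {a I1..b I1} x * sqrt \<bar>prd x\<bar> + indicat_real {a I2..b I2} x * sqrt \<bar>prd x\<bar>)"
    by (intro Bochner_Integration.integrable_add set_integral_cut(1) c)
  moreover have "indicat_real {a I1..b I1} x * sqrt \<bar>prd x\<bar> + indicat_real {a I2..b I2} x * sqrt \<bar>prd x\<bar> = indicat_real K x * sqrt \<bar>prd x\<bar>" for x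
    using cuts by (auto simp: K_eq indicator_def)
  ultimately have "integrable lborel (\<lambda>x. indicat_real K x * sqrt \<bar>prd x\<bar>)" by simp
  then have "(\<integral>\<^sup>+x. ennreal (indicat_real K x * sqrt \<bar>prd x\<bar>) \<partial>lborel) < \<infinity>"
    by (subst nn_integral_eq_integral) auto
  then show ?thesis unfolding omega_eq
    by (intro finite_measureI) (use omega_dens_measurable in \<open>simp add: emeasure_density\<close>)
qed

text \<open>\<open>kap\<close> times the density of \<open>omega_c\<close> is
  \<open>Im (MW i x) / pi\<close>, which cancels the denominator of \<open>psiW\<close>. There
  remains the imaginary part of a product of length V + 1 factors, and only products with one factor
  have a nonzero integral, namely pi.\<close>

lemma psiW_moment:
  "(\<integral>x. psiW i V x * kap i x \<partial>(omega_c a b)) = (if V = [] then 1 else 0)"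
proof -
  let ?g = "\<lambda>x. Im (MW i x * QW V x)"
  have pm: "(\<lambda>x. psiW i V x * kap i x) \<in> borel_measurable lborel"
    using psiW_measurable kap_measurable by measurable
  have "(\<integral>x. psiW i V x * kap i x \<partial>(omega_c a b)) = (\<integral>x. (indicat_real K x * sqrt \<bar>prd x\<bar>) *\<^sub>R (psiW i V x * kap i x) \<partial>lborel)"
    unfolding omega_eq using omega_dens_measurable by (intro integral_density pm) auto
  also have "\<dots> = (\<integral>x. indicat_real {a I1..b I1} x * (1 / pi * ?g x) + indicat_real {a I2..b I2} x * (1 / pi * ?g x) \<partial>lborel)"
  proof (rule Bochner_Integration.integral_cong[OF refl])
    fix x
    have s: "indicat_real {a I1..b I1} x * y + indicat_real {a I2..b I2} x * y = indicat_real K x * y" for y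
      using cuts by (auto simp: K_eq indicator_def)
    have "sqrt \<bar>prd x\<bar> * (psiW i V x * kap i x) = 1 / pi * ?g x" if x: "x \<in> K"
    proof (cases "x \<in> bp")
      case True
      \<comment> \<open>At a branch point all \<open>MW\<close> are real and the density is 0, so
        both sides vanish whatever \<open>psiW\<close> is there.\<close>
      have "MW j x = of_real (1 / (B j - pt x))" for j using W_end[OF True] by (simp add: MW_def pt_def)
      then have "Im (MW j x) = 0" for j by (metis Im_complex_of_real)
      then have "MW j x \<in> \<real>" for j by (simp add: complex_is_Real_iff)
      then have "MW i x * QW V x \<in> \<real>" unfolding QW_def by (intro Reals_mult prod_in_Reals) auto
      then show ?thesis using True prd_0_iff[of x] by (simp add: complex_is_Real_iff)
    next
      case False
      then have o: "x \<in> Ko" using K_Ko x by blast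
      have "sqrt \<bar>prd x\<bar> * (psiW i V x * kap i x) = psiW i V x * (dens i x * sqrt \<bar>prd x\<bar>)"
        using x by (simp add: kap_def)
      also have "\<dots> = 1 / pi * ?g x"
        unfolding dens_eq[OF x] psiW_def using o Im_MW_pos[OF o, of i] by simp
      finally show ?thesis .
    qed
    then show "(indicat_real K x * sqrt \<bar>prd x\<bar>) *\<^sub>R (psiW i V x * kap i x) =
      indicat_real {a I1..b I1} x * (1 / pi * ?g x) + indicat_real {a I2..b I2} x * (1 / pi * ?g x)"
      unfolding s by (auto simp: indicator_def)
  qed
  also have "\<dots> = 1 / pi * (integral {a I1..b I1} ?g + integral {a I2..b I2} ?g)"
  proof -
    have c: "continuous_on {a j..b j} (\<lambda>x. 1 / pi * ?g x)" for j
      using continuous_on_subset[OF MW_continuous_K, of "{a j..b j}" i] continuous_on_subset[OF QW_continuous, of "{a j..b j}" V]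
      by (intro continuous_intros) (auto simp: K_def)
    show ?thesis
      unfolding Bochner_Integration.integral_add[OF set_integral_cut(1)[OF c] set_integral_cut(1)[OF c]] set_integral_cut(2)[OF c]
        Henstock_Kurzweil_Integration.integral_mult_right
      by (simp only: distrib_left)
  qed
  also have "\<dots> = (if V = [] then 1 else 0)"
  proof -
    \<comment> \<open>\<open>QW V\<close> is a real multiple of a monomial whose degree is the depth
      of V; the prefactor \<open>MW i\<close> raises the degree by one, so degree one means the
      root.\<close>
    have "\<exists>k m n. m + n = length V \<and> (\<forall>x. QW V x = of_real k * ((MW I1 x) ^ m * (MW I2 x) ^ n)) \<and> (V = [] \<longrightarrow> k = 1)"
    proof (induction V)
      case Nil
      show ?case by (intro exI[of _ 1] exI[of _ 0]) (auto simp: QW_simps)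
    next
      case (Cons j V)
      then obtain k m n where k: "m + n = length V" "\<And>x. QW V x = of_real k * ((MW I1 x) ^ m * (MW I2 x) ^ n)" by blast
      show ?case
      proof (cases j)
        case I1
        show ?thesis by (rule exI[of _ "- sqrt (A j) * k"], rule exI[of _ "Suc m"], rule exI[of _ n]) (use k I1 in \<open>auto simp: QW_simps\<close>)
      next
        case I2
        show ?thesis by (rule exI[of _ "- sqrt (A j) * k"], rule exI[of _ m], rule exI[of _ "Suc n"]) (use k I2 in \<open>auto simp: QW_simps\<close>)
      qed
    qed
    then obtain k m n where k: "m + n = length V" "\<And>x. QW V x = of_real k * ((MW I1 x) ^ m * (MW I2 x) ^ n)" "V = [] \<Longrightarrow> k = 1" by blast
    define m' n' where "m' = (if i = I1 then Suc m else m)" and "n' = (if i = I1 then n else Suc n)"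
    have g: "?g = (\<lambda>x. k * Im ((MW I1 x) ^ m' * (MW I2 x) ^ n'))"
    proof
      fix x
      have "MW i x * QW V x = of_real k * ((MW I1 x) ^ m' * (MW I2 x) ^ n')"
        unfolding k(2) m'_def n'_def by (cases i) auto
      then show "?g x = k * Im ((MW I1 x) ^ m' * (MW I2 x) ^ n')" by simp
    qed
    have mn: "m' + n' = Suc (length V)" using k(1) by (simp add: m'_def n'_def)
    then obtain P where P: "\<And>j. ((\<lambda>x. Im ((MW I1 x) ^ m' * (MW I2 x) ^ n')) has_integral P j) {a j..b j}"
      "P I1 + P I2 = (if m' + n' = 1 then pi else 0)" using moment_dx[of m' n'] by auto
    have "integral {a j..b j} ?g = k * P j" for j
      unfolding g by (rule integral_unique) (rule has_integral_mult_right[OF P(1)])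
    then have "integral {a I1..b I1} ?g + integral {a I2..b I2} ?g = k * (P I1 + P I2)" by (simp add: algebra_simps)
    then show ?thesis using P(2) mn k(3) by auto
  qed
  finally show ?thesis .
qed

end

section \<open>Square-integrable functions\<close>

text \<open>One set of notions serves both L^2 of the spectral variable and the sequence space, the
  latter as M = counting measure (\<open>l2_sqint\<close>).\<close>

definition sqint :: "'a measure \<Rightarrow> ('a \<Rightarrow> complex) \<Rightarrow> bool" where
  "sqint M f \<longleftrightarrow> f \<in> borel_measurable M \<and> integrable M (\<lambda>x. (cmod (f x))\<^sup>2)"

definition nrm :: "'a measure \<Rightarrow> ('a \<Rightarrow> complex) \<Rightarrow> real" where
  "nrm M f = sqrt (\<integral>x. (cmod (f x))\<^sup>2 \<partial>M)"

definition ip :: "'a measure \<Rightarrow> ('a \<Rightarrow> complex) \<Rightarrow> ('a \<Rightarrow> complex) \<Rightarrow> complex" where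
  "ip M f g = (\<integral>x. f x * cnj (g x) \<partial>M)"

lemma sqintD: "sqint M f \<Longrightarrow> f \<in> borel_measurable M" "sqint M f \<Longrightarrow> integrable M (\<lambda>x. (cmod (f x))\<^sup>2)"
  by (auto simp: sqint_def)

lemma borel_measurable_cnj [measurable (raw)]:
  "f \<in> borel_measurable M \<Longrightarrow> (\<lambda>x. cnj (f x)) \<in> borel_measurable M"
  by (rule borel_measurable_continuous_on[of cnj]) (auto intro!: continuous_intros)

lemma sqint_prod_norm:
  assumes "sqint M f" "sqint M g"
  shows "integrable M (\<lambda>x. cmod (f x) * cmod (g x))"
proof (rule Bochner_Integration.integrable_bound)
  show "integrable M (\<lambda>x. (cmod (f x))\<^sup>2 + (cmod (g x))\<^sup>2)"
    using assms by (intro Bochner_Integration.integrable_add sqintD)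
  show "(\<lambda>x. cmod (f x) * cmod (g x)) \<in> borel_measurable M"
    using sqintD(1)[OF assms(1)] sqintD(1)[OF assms(2)] by measurable
  have "u * v \<le> u\<^sup>2 + v\<^sup>2" if "u \<ge> 0" "v \<ge> 0" for u v :: real
    using sum_squares_bound[of u v] mult_nonneg_nonneg[OF that] unfolding mult.assoc by linarith
  then show "AE x in M. norm (cmod (f x) * cmod (g x)) \<le> norm ((cmod (f x))\<^sup>2 + (cmod (g x))\<^sup>2)"
    by (intro AE_I2) simp
qed

lemma sqint_prod:
  assumes "sqint M f" "sqint M g"
  shows "integrable M (\<lambda>x. f x * g x)" "integrable M (\<lambda>x. f x * cnj (g x))"
  using sqintD(1)[OF assms(1)] sqintD(1)[OF assms(2)]
  by (auto intro!: Bochner_Integration.integrable_bound[OF sqint_prod_norm[OF assms]] simp: norm_mult)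

lemma sqint_add: 
  assumes "sqint M f" "sqint M g" shows "sqint M (\<lambda>x. f x + g x)"
  unfolding sqint_def
proof
  show m: "(\<lambda>x. f x + g x) \<in> borel_measurable M"
    using sqintD(1)[OF assms(1)] sqintD(1)[OF assms(2)] by measurable
  show "integrable M (\<lambda>x. (cmod (f x + g x))\<^sup>2)"
  proof (rule Bochner_Integration.integrable_bound)
    show "integrable M (\<lambda>x. 2 * (cmod (f x))\<^sup>2 + 2 * (cmod (g x))\<^sup>2)"
      using assms by (auto simp: sqint_def)
    show "(\<lambda>x. (cmod (f x + g x))\<^sup>2) \<in> borel_measurable M" using m by measurable
    have "(cmod (u + v))\<^sup>2 \<le> 2 * (cmod u)\<^sup>2 + 2 * (cmod v)\<^sup>2" for u v
    proof -
      have "(cmod (u + v))\<^sup>2 \<le> (cmod u + cmod v)\<^sup>2" by (intro power_mono norm_triangle_ineq) auto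
      then show ?thesis using sum_squares_bound[of "cmod u" "cmod v"] by (simp add: power2_sum)
    qed
    then show "AE x in M. norm ((cmod (f x + g x))\<^sup>2) \<le> norm (2 * (cmod (f x))\<^sup>2 + 2 * (cmod (g x))\<^sup>2)"
      by (intro AE_I2) simp
  qed
qed

lemma sqint_cmult: "sqint M f \<Longrightarrow> sqint M (\<lambda>x. c * f x)"
  by (auto simp: sqint_def norm_mult power_mult_distrib)

lemma sqint_diff: "sqint M f \<Longrightarrow> sqint M g \<Longrightarrow> sqint M (\<lambda>x. f x - g x)"
  using sqint_add[of M f "\<lambda>x. (-1) * g x"] sqint_cmult[of M g "-1"] by simp

lemma sqint_0: "sqint M (\<lambda>x. 0)" by (simp add: sqint_def)

lemma sqint_sum: "finite T \<Longrightarrow> (\<And>i. i \<in> T \<Longrightarrow> sqint M (f i)) \<Longrightarrow> sqint M (\<lambda>x. \<Sum>i\<in>T. f i x)"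
  by (induction T rule: finite_induct) (auto intro: sqint_add sqint_0)

lemma sqint_bounded_mult:
  assumes "sqint M f" "g \<in> borel_measurable M" "\<And>x. cmod (g x) \<le> C"
  shows "sqint M (\<lambda>x. g x * f x)"
  unfolding sqint_def
proof
  show m: "(\<lambda>x. g x * f x) \<in> borel_measurable M" using assms by (auto simp: sqint_def)
  show "integrable M (\<lambda>x. (cmod (g x * f x))\<^sup>2)"
  proof (rule Bochner_Integration.integrable_bound)
    show "integrable M (\<lambda>x. C\<^sup>2 * (cmod (f x))\<^sup>2)" using assms by (auto simp: sqint_def)
    show "(\<lambda>x. (cmod (g x * f x))\<^sup>2) \<in> borel_measurable M" using m by measurable
    show "AE x in M. norm ((cmod (g x * f x))\<^sup>2) \<le> norm (C\<^sup>2 * (cmod (f x))\<^sup>2)"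
      using assms(3) by (intro AE_I2) (auto simp: norm_mult power_mult_distrib intro!: mult_right_mono power_mono)
  qed
qed

lemma nrm_nonneg: "nrm M f \<ge> 0" by (simp add: nrm_def)

lemma dist_nrm: "dist (nrm M f) 0 = nrm M f" by (simp add: dist_real_def nrm_nonneg)

lemma nrm_sq: "(nrm M f)\<^sup>2 = (\<integral>x. (cmod (f x))\<^sup>2 \<partial>M)" by (simp add: nrm_def)

lemma nrm_cmult: "nrm M (\<lambda>x. c * f x) = cmod c * nrm M f"
  by (simp add: nrm_def norm_mult power_mult_distrib real_sqrt_mult)

lemma nrm_0: "nrm M (\<lambda>x. 0) = 0" by (simp add: nrm_def)

lemma nrm_minus: "nrm M (\<lambda>x. f x - g x) = nrm M (\<lambda>x. g x - f x)"
  by (simp add: nrm_def norm_minus_commute)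

lemma nrm_mono:
  assumes "sqint M g" "f \<in> borel_measurable M" "AE x in M. cmod (f x) \<le> C * cmod (g x)" "C \<ge> 0"
  shows "nrm M f \<le> C * nrm M g"
proof -
  have "(\<integral>x. (cmod (f x))\<^sup>2 \<partial>M) \<le> (\<integral>x. C\<^sup>2 * (cmod (g x))\<^sup>2 \<partial>M)"
  proof (rule integral_mono_AE')
    show "integrable M (\<lambda>x. C\<^sup>2 * (cmod (g x))\<^sup>2)" using assms by (auto simp: sqint_def)
    show "AE x in M. (cmod (f x))\<^sup>2 \<le> C\<^sup>2 * (cmod (g x))\<^sup>2"
      using assms(3)
    proof eventually_elim
      case (elim x)
      then have "(cmod (f x))\<^sup>2 \<le> (C * cmod (g x))\<^sup>2" by (intro power_mono) auto
      then show ?case by (simp add: power_mult_distrib)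
    qed
  qed auto
  also have "\<dots> = (C * nrm M g)\<^sup>2" by (simp add: power_mult_distrib nrm_sq)
  finally have "(nrm M f)\<^sup>2 \<le> (C * nrm M g)\<^sup>2" by (simp add: nrm_sq)
  then show ?thesis by (rule power2_le_imp_le) (simp add: assms(4) nrm_nonneg)
qed

lemma cauchy_schwarz_norm:
  assumes f: "sqint M f" and g: "sqint M g"
  shows "(\<integral>x. cmod (f x) * cmod (g x) \<partial>M) \<le> nrm M f * nrm M g"
proof -
  define I where "I = (\<integral>x. cmod (f x) * cmod (g x) \<partial>M)"
  have I0: "I \<ge> 0" unfolding I_def by (rule Bochner_Integration.integral_nonneg) auto
  have q: "0 \<le> t\<^sup>2 * (nrm M f)\<^sup>2 - 2 * t * I + (nrm M g)\<^sup>2" for t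
  proof -
    have "0 \<le> (\<integral>x. (t * cmod (f x) - cmod (g x))\<^sup>2 \<partial>M)" by (rule Bochner_Integration.integral_nonneg) auto
    also have "\<dots> = (\<integral>x. t\<^sup>2 * (cmod (f x))\<^sup>2 - 2 * t * (cmod (f x) * cmod (g x)) + (cmod (g x))\<^sup>2 \<partial>M)"
      by (intro Bochner_Integration.integral_cong refl) (simp add: power2_diff power_mult_distrib)
    also have "\<dots> = t\<^sup>2 * (nrm M f)\<^sup>2 - 2 * t * I + (nrm M g)\<^sup>2"
      using sqintD(2)[OF f] sqintD(2)[OF g] sqint_prod_norm[OF f g] by (simp add: nrm_sq I_def)
    finally show ?thesis .
  qed
  have "I\<^sup>2 \<le> (nrm M f)\<^sup>2 * (nrm M g)\<^sup>2"
  proof (cases "nrm M f = 0")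
    case True
    have "I = 0"
    proof (rule ccontr)
      assume "I \<noteq> 0"
      \<comment> \<open>If \<open>nrm M f\<close> is 0, the quadratic in t is affine, and this t
        gives it the value -1.\<close>
      then show False using q[of "((nrm M g)\<^sup>2 + 1) / (2 * I)"] True I0 by simp
    qed
    then show ?thesis by simp
  next
    case False
    then have n: "(nrm M f)\<^sup>2 > 0" by simp
    have "0 \<le> (nrm M g)\<^sup>2 - I\<^sup>2 / (nrm M f)\<^sup>2"
      using q[of "I / (nrm M f)\<^sup>2"] False by (simp add: power2_eq_square field_simps)
    then show ?thesis using n by (simp add: field_simps)
  qed
  then have "I\<^sup>2 \<le> (nrm M f * nrm M g)\<^sup>2" by (simp add: power_mult_distrib)
  then show ?thesis unfolding I_def[symmetric] by (rule power2_le_imp_le) (simp add: nrm_nonneg)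
qed

lemma cauchy_schwarz:
  assumes "sqint M f" "sqint M g"
  shows "cmod (ip M f g) \<le> nrm M f * nrm M g" "cmod (\<integral>x. f x * g x \<partial>M) \<le> nrm M f * nrm M g"
proof -
  have "cmod (ip M f g) \<le> (\<integral>x. cmod (f x * cnj (g x)) \<partial>M)" unfolding ip_def by (rule integral_norm_bound)
  then show "cmod (ip M f g) \<le> nrm M f * nrm M g"
    using cauchy_schwarz_norm[OF assms] by (simp add: norm_mult)
  have "cmod (\<integral>x. f x * g x \<partial>M) \<le> (\<integral>x. cmod (f x * g x) \<partial>M)" by (rule integral_norm_bound)
  then show "cmod (\<integral>x. f x * g x \<partial>M) \<le> nrm M f * nrm M g"
    using cauchy_schwarz_norm[OF assms] by (simp add: norm_mult)
qed

lemma nrm_triangle: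
  assumes f: "sqint M f" and g: "sqint M g"
  shows "nrm M (\<lambda>x. f x + g x) \<le> nrm M f + nrm M g"
proof -
  have "(nrm M (\<lambda>x. f x + g x))\<^sup>2 \<le> (\<integral>x. (cmod (f x))\<^sup>2 + 2 * (cmod (f x) * cmod (g x)) + (cmod (g x))\<^sup>2 \<partial>M)"
    unfolding nrm_sq
  proof (rule integral_mono)
    show "integrable M (\<lambda>x. (cmod (f x + g x))\<^sup>2)" using sqint_add[OF f g] by (rule sqintD)
    show "integrable M (\<lambda>x. (cmod (f x))\<^sup>2 + 2 * (cmod (f x) * cmod (g x)) + (cmod (g x))\<^sup>2)"
      using sqintD(2)[OF f] sqintD(2)[OF g] sqint_prod_norm[OF f g] by simp
    fix x
    have "(cmod (f x + g x))\<^sup>2 \<le> (cmod (f x) + cmod (g x))\<^sup>2" by (intro power_mono norm_triangle_ineq) auto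
    then show "(cmod (f x + g x))\<^sup>2 \<le> (cmod (f x))\<^sup>2 + 2 * (cmod (f x) * cmod (g x)) + (cmod (g x))\<^sup>2"
      by (simp add: power2_sum)
  qed
  also have "\<dots> = (nrm M f)\<^sup>2 + 2 * (\<integral>x. cmod (f x) * cmod (g x) \<partial>M) + (nrm M g)\<^sup>2"
    using sqintD(2)[OF f] sqintD(2)[OF g] sqint_prod_norm[OF f g] by (simp add: nrm_sq)
  also have "\<dots> \<le> (nrm M f + nrm M g)\<^sup>2"
    using cauchy_schwarz_norm[OF f g] by (simp add: power2_sum)
  finally show ?thesis by (rule power2_le_imp_le) (simp add: nrm_nonneg)
qed

lemma nrm_triangle_diff:
  assumes "sqint M f" "sqint M g" "sqint M h"
  shows "nrm M (\<lambda>x. f x - h x) \<le> nrm M (\<lambda>x. f x - g x) + nrm M (\<lambda>x. g x - h x)"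
  using nrm_triangle[OF sqint_diff[OF assms(1,2)] sqint_diff[OF assms(2,3)]] by simp

lemma nrm_tendsto:
  assumes "sqint N g" "\<And>n. sqint N (f n)" "(\<lambda>n. nrm N (\<lambda>x. g x - f n x)) \<longlonglongrightarrow> 0"
  shows "(\<lambda>n. nrm N (f n)) \<longlonglongrightarrow> nrm N g"
proof (rule LIM_zero_cancel, rule Lim_null_comparison[OF always_eventually assms(3)], intro allI)
  fix n
  have "nrm N g \<le> nrm N (\<lambda>x. g x - f n x) + nrm N (f n)"
    using nrm_triangle[OF sqint_diff[OF assms(1,2)] assms(2), of n n] by simp
  moreover have "nrm N (f n) \<le> nrm N (\<lambda>x. f n x - g x) + nrm N g"
    using nrm_triangle[OF sqint_diff[OF assms(2,1)] assms(1), of n] by simp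
  ultimately show "norm (nrm N (f n) - nrm N g) \<le> nrm N (\<lambda>x. g x - f n x)"
    unfolding nrm_minus[of N "f n" g] by simp
qed

lemma sqint_bounded:
  assumes "finite_measure M" "f \<in> borel_measurable M" "AE x in M. cmod (f x) \<le> C"
  shows "sqint M f"
proof -
  interpret finite_measure M by fact
  show ?thesis unfolding sqint_def
  proof
    show "integrable M (\<lambda>x. (cmod (f x))\<^sup>2)"
      by (rule integrable_const_bound[of _ "C\<^sup>2"])
        (use assms in \<open>auto elim!: eventually_mono intro!: power_mono\<close>)
  qed fact
qed

text \<open>Fatou's lemma in m, with n fixed, applied to |f m - f n|^2. It identifies the limit of a
  Cauchy sequence whenever the pointwise limit is already known.\<close>

lemma sqint_fatou:
  assumes sq: "\<And>n. sqint M (f n)" and g: "g \<in> borel_measurable M"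
    and lim: "AE x in M. (\<lambda>n. f n x) \<longlonglongrightarrow> g x"
    and cau: "\<And>\<epsilon>. \<epsilon> > 0 \<Longrightarrow> \<exists>N. \<forall>m\<ge>N. \<forall>n\<ge>N. nrm M (\<lambda>x. f m x - f n x) \<le> \<epsilon>"
  shows "sqint M g" "(\<lambda>n. nrm M (\<lambda>x. g x - f n x)) \<longlonglongrightarrow> 0"
proof -
  have key: "sqint M (\<lambda>x. g x - f n x) \<and> nrm M (\<lambda>x. g x - f n x) \<le> \<epsilon>"
    if N: "\<forall>m\<ge>N. \<forall>n\<ge>N. nrm M (\<lambda>x. f m x - f n x) \<le> \<epsilon>" and n: "n \<ge> N" and \<epsilon>: "\<epsilon> > 0" for \<epsilon> N n
  proof -
    have mf [measurable]: "f k \<in> borel_measurable M" for k using sq by (rule sqintD)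
    note g[measurable]
    have "(\<integral>\<^sup>+x. ennreal ((cmod (g x - f n x))\<^sup>2) \<partial>M) = (\<integral>\<^sup>+x. liminf (\<lambda>m. ennreal ((cmod (f m x - f n x))\<^sup>2)) \<partial>M)"
    proof (rule nn_integral_cong_AE)
      show "AE x in M. ennreal ((cmod (g x - f n x))\<^sup>2) = liminf (\<lambda>m. ennreal ((cmod (f m x - f n x))\<^sup>2))"
        using lim
      proof eventually_elim
        case (elim x)
        have "(\<lambda>m. ennreal ((cmod (f m x - f n x))\<^sup>2)) \<longlonglongrightarrow> ennreal ((cmod (g x - f n x))\<^sup>2)"
          by (intro tendsto_intros elim)
        from lim_imp_Liminf[OF _ this] show ?case by simp
      qed
    qed
    also have "\<dots> \<le> liminf (\<lambda>m. \<integral>\<^sup>+x. ennreal ((cmod (f m x - f n x))\<^sup>2) \<partial>M)"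
      by (rule nn_integral_liminf) measurable
    also have "\<dots> \<le> liminf (\<lambda>m. ennreal (\<epsilon>\<^sup>2))"
    proof (rule Liminf_mono, rule eventually_mono[OF eventually_ge_at_top[of N]])
      fix m assume m: "m \<ge> N"
      have "(\<integral>\<^sup>+x. ennreal ((cmod (f m x - f n x))\<^sup>2) \<partial>M) = ennreal (\<integral>x. (cmod (f m x - f n x))\<^sup>2 \<partial>M)"
        by (rule nn_integral_eq_integral) (use sqint_diff[OF sq sq] in \<open>auto simp: sqint_def\<close>)
      also have "\<dots> = ennreal ((nrm M (\<lambda>x. f m x - f n x))\<^sup>2)" by (simp add: nrm_sq)
      also have "\<dots> \<le> ennreal (\<epsilon>\<^sup>2)"
        using N m n nrm_nonneg by (intro ennreal_leI power_mono) auto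
      finally show "(\<integral>\<^sup>+x. ennreal ((cmod (f m x - f n x))\<^sup>2) \<partial>M) \<le> ennreal (\<epsilon>\<^sup>2)" .
    qed
    also have "liminf (\<lambda>m. ennreal (\<epsilon>\<^sup>2)) = ennreal (\<epsilon>\<^sup>2)" by (simp add: Liminf_const)
    finally have le: "(\<integral>\<^sup>+x. ennreal ((cmod (g x - f n x))\<^sup>2) \<partial>M) \<le> ennreal (\<epsilon>\<^sup>2)" .
    have int: "integrable M (\<lambda>x. (cmod (g x - f n x))\<^sup>2)"
    proof (rule integrableI_nonneg)
      show "(\<integral>\<^sup>+x. ennreal ((cmod (g x - f n x))\<^sup>2) \<partial>M) < \<infinity>" using le by (rule le_less_trans) simp
    qed auto
    then have "ennreal (\<integral>x. (cmod (g x - f n x))\<^sup>2 \<partial>M) \<le> ennreal (\<epsilon>\<^sup>2)"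
      using le nn_integral_eq_integral[OF int] by simp
    then have "(nrm M (\<lambda>x. g x - f n x))\<^sup>2 \<le> \<epsilon>\<^sup>2" by (simp add: nrm_sq)
    then have "nrm M (\<lambda>x. g x - f n x) \<le> \<epsilon>" by (rule power2_le_imp_le) (use \<epsilon> in simp)
    moreover have "(\<lambda>x. g x - f n x) \<in> borel_measurable M" by measurable
    ultimately show ?thesis using int unfolding sqint_def by blast
  qed
  obtain N where N: "\<forall>m\<ge>N. \<forall>n\<ge>N. nrm M (\<lambda>x. f m x - f n x) \<le> 1" using cau[of 1] by auto
  then have "sqint M (\<lambda>x. g x - f N x)" using key[OF N] by auto
  from sqint_add[OF this sq[of N]] show "sqint M g" by simp
  show "(\<lambda>n. nrm M (\<lambda>x. g x - f n x)) \<longlonglongrightarrow> 0"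
    unfolding LIMSEQ_def
  proof (intro allI impI)
    fix e :: real assume e: "e > 0"
    obtain N where N: "\<forall>m\<ge>N. \<forall>n\<ge>N. nrm M (\<lambda>x. f m x - f n x) \<le> e / 2" using cau[of "e/2"] e by auto
    have "nrm M (\<lambda>x. g x - f n x) \<le> e / 2" if "n \<ge> N" for n
      using key[OF N that] e by simp
    then show "\<exists>N. \<forall>n\<ge>N. dist (nrm M (\<lambda>x. g x - f n x)) 0 < e"
      unfolding dist_nrm using e by (intro exI[of _ N]) force
  qed
qed

lemma riesz_fischer:
  assumes fin: "finite_measure M" and sq: "\<And>n. sqint M (f n)"
    and cau: "\<And>\<epsilon>. \<epsilon> > 0 \<Longrightarrow> \<exists>N. \<forall>m\<ge>N. \<forall>n\<ge>N. nrm M (\<lambda>x. f m x - f n x) \<le> \<epsilon>"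
  shows "\<exists>g. sqint M g \<and> (\<lambda>n. nrm M (\<lambda>x. g x - f n x)) \<longlonglongrightarrow> 0"
proof -
  interpret finite_measure M by fact
  have mf [measurable]: "f k \<in> borel_measurable M" for k using sq by (rule sqintD)
  obtain N where N: "\<And>k m n. m \<ge> N k \<Longrightarrow> n \<ge> N k \<Longrightarrow> nrm M (\<lambda>x. f m x - f n x) \<le> (1/2) ^ k"
    using cau[of "(1/2) ^ _"] by (metis zero_less_power half_gt_zero_iff zero_less_one)
  \<comment> \<open>Summing all \<open>N i\<close> up to k makes both \<open>r k\<close> and
    \<open>r (Suc k)\<close> at least \<open>N k\<close>, so consecutive terms of the subsequence
    differ by at most (1/2)^k. As M is finite, these L^2 bounds give summable L^1 bounds.\<close>
  define r where "r k = (\<Sum>i\<le>k. N i) + k" for k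
  have rN: "r k \<ge> N k" for k unfolding r_def by (simp add: member_le_sum trans_le_add1)
  have rk: "r k \<ge> k" for k by (simp add: r_def)
  have rS: "r (Suc k) \<ge> N k" for k
    unfolding r_def using member_le_sum[of k "{..Suc k}" N] by simp
  define d where "d k x = f (r (Suc k)) x - f (r k) x" for k x
  have sd: "sqint M (d k)" for k unfolding d_def by (intro sqint_diff sq)
  have dm [measurable]: "d k \<in> borel_measurable M" for k using sd by (rule sqintD)
  have dn: "nrm M (d k) \<le> (1/2) ^ k" for k unfolding d_def by (intro N rN rS)
  have s1: "sqint M (\<lambda>x. 1)" using fin by (intro sqint_bounded[of _ _ 1]) auto
  have int_d: "integrable M (\<lambda>x. cmod (d k x))" for k
    using sqint_prod_norm[OF sd s1] by simp
  have L1: "(\<integral>\<^sup>+x. ennreal (cmod (d k x)) \<partial>M) \<le> ennreal ((1/2) ^ k * nrm M (\<lambda>x. 1))" for k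
  proof -
    have "(\<integral>\<^sup>+x. ennreal (cmod (d k x)) \<partial>M) = ennreal (\<integral>x. cmod (d k x) \<partial>M)"
      by (rule nn_integral_eq_integral[OF int_d]) auto
    also have "\<dots> \<le> ennreal ((1/2) ^ k * nrm M (\<lambda>x. 1))"
      using cauchy_schwarz_norm[OF sd[of k] s1] dn[of k] nrm_nonneg[of M "\<lambda>x. 1"]
      by (intro ennreal_leI) (auto intro: order_trans mult_right_mono)
    finally show ?thesis .
  qed
  have "(\<integral>\<^sup>+x. (\<Sum>k. ennreal (cmod (d k x))) \<partial>M) = (\<Sum>k. \<integral>\<^sup>+x. ennreal (cmod (d k x)) \<partial>M)"
    by (intro nn_integral_suminf) measurable
  also have "\<dots> \<le> (\<Sum>k. ennreal ((1/2) ^ k * nrm M (\<lambda>x. 1)))"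
    by (intro suminf_le L1) auto
  also have "\<dots> = ennreal (\<Sum>k. (1/2) ^ k * nrm M (\<lambda>x. 1))"
    by (rule suminf_ennreal2) (auto intro!: mult_nonneg_nonneg nrm_nonneg summable_mult2 summable_geometric)
  also have "\<dots> < \<infinity>" by simp
  finally have "(\<integral>\<^sup>+x. (\<Sum>k. ennreal (cmod (d k x))) \<partial>M) \<noteq> \<infinity>" by simp
  then have "AE x in M. (\<Sum>k. ennreal (cmod (d k x))) \<noteq> \<infinity>"
    by (intro nn_integral_PInf_AE) auto
  then have conv: "AE x in M. convergent (\<lambda>k. f (r k) x)"
  proof eventually_elim
    case (elim x)
    have "summable (\<lambda>k. cmod (d k x))"
      using elim by (intro summable_suminf_not_top) auto
    then have "summable (\<lambda>k. d k x)" by (rule summable_norm_cancel)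
    then have "convergent (\<lambda>n. \<Sum>k<n. d k x)" by (simp add: summable_iff_convergent)
    moreover have "(\<Sum>k<n. d k x) = f (r n) x - f (r 0) x" for n
      unfolding d_def by (rule sum_lessThan_telescope)
    ultimately have "convergent (\<lambda>n. f (r n) x - f (r 0) x)" by simp
    from convergent_add[OF this convergent_const[of "f (r 0) x"]] show ?case by simp
  qed
  define g where "g x = lim (\<lambda>k. f (r k) x)" for x
  have gm: "g \<in> borel_measurable M" unfolding g_def[abs_def] by measurable
  have lim: "AE x in M. (\<lambda>k. f (r k) x) \<longlonglongrightarrow> g x"
    using conv by eventually_elim (simp add: g_def convergent_LIMSEQ_iff)
  have cau': "\<exists>K. \<forall>m\<ge>K. \<forall>n\<ge>K. nrm M (\<lambda>x. f (r m) x - f (r n) x) \<le> \<epsilon>" if \<epsilon>: "\<epsilon> > 0" for \<epsilon>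
  proof -
    obtain K where K: "\<forall>m\<ge>K. \<forall>n\<ge>K. nrm M (\<lambda>x. f m x - f n x) \<le> \<epsilon>" using cau[OF \<epsilon>] by blast
    then show ?thesis using rk by (intro exI[of _ K]) (meson order_trans)
  qed
  note S = sqint_fatou[of M "\<lambda>k. f (r k)" g, OF sq gm lim cau']
  have "(\<lambda>n. nrm M (\<lambda>x. g x - f n x)) \<longlonglongrightarrow> 0"
    unfolding LIMSEQ_def
  proof (intro allI impI)
    fix e :: real assume e: "e > 0"
    obtain K where K: "\<forall>m\<ge>K. \<forall>n\<ge>K. nrm M (\<lambda>x. f m x - f n x) \<le> e / 2" using cau[of "e/2"] e by auto
    obtain K' where K': "\<forall>n\<ge>K'. nrm M (\<lambda>x. g x - f (r n) x) < e / 2"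
      using S(2) e nrm_nonneg unfolding LIMSEQ_def dist_real_def
      by (metis abs_of_nonneg diff_zero half_gt_zero)
    have "nrm M (\<lambda>x. g x - f n x) < e" if n: "n \<ge> K" for n
    proof -
      define m where "m = max K K'"
      have "nrm M (\<lambda>x. g x - f n x) \<le> nrm M (\<lambda>x. g x - f (r m) x) + nrm M (\<lambda>x. f (r m) x - f n x)"
        by (rule nrm_triangle_diff[OF S(1) sq sq])
      also have "nrm M (\<lambda>x. g x - f (r m) x) < e / 2" using K' by (simp add: m_def)
      also have "nrm M (\<lambda>x. f (r m) x - f n x) \<le> e / 2"
        using K n rk[of m] by (metis m_def max.cobounded1 order_trans)
      finally show ?thesis by simp
    qed
    then show "\<exists>N. \<forall>n\<ge>N. dist (nrm M (\<lambda>x. g x - f n x)) 0 < e"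
      unfolding dist_nrm by blast
  qed
  then show ?thesis using S(1) by blast
qed

section \<open>Closed subspaces of the sequence space\<close>

abbreviation cnt :: "'v measure" where "cnt \<equiv> count_space UNIV"

lemma l2_sqint: "\<psi> \<in> l2 \<longleftrightarrow> sqint cnt \<psi>"
proof -
  have "\<psi> \<in> l2 \<longleftrightarrow> Infinite_Sum.abs_summable_on (\<lambda>Y. (cmod (\<psi> Y))\<^sup>2) UNIV"
    by (simp add: l2_def)
  also have "\<dots> \<longleftrightarrow> Infinite_Set_Sum.abs_summable_on (\<lambda>Y. (cmod (\<psi> Y))\<^sup>2) UNIV"
    by (rule abs_summable_equivalent)
  also have "\<dots> \<longleftrightarrow> sqint cnt \<psi>" by (simp add: Infinite_Set_Sum.abs_summable_on_def sqint_def)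
  finally show ?thesis .
qed

lemma l2_norm_nrm: "\<psi> \<in> l2 \<Longrightarrow> l2_norm \<psi> = nrm cnt \<psi>"
proof -
  assume "\<psi> \<in> l2"
  then have "integrable cnt (\<lambda>Y. (cmod (\<psi> Y))\<^sup>2)" by (simp add: l2_sqint sqint_def)
  then have "Infinite_Set_Sum.abs_summable_on (\<lambda>Y. (cmod (\<psi> Y))\<^sup>2) UNIV"
    by (simp add: Infinite_Set_Sum.abs_summable_on_def)
  from infsetsum_infsum[OF this] show ?thesis
    by (simp add: l2_norm_def nrm_def infsetsum_def)
qed

lemma l2_inner_ip:
  assumes "\<phi> \<in> l2" "\<psi> \<in> l2" shows "l2_inner \<phi> \<psi> = ip cnt \<phi> \<psi>"
proof -
  have "integrable cnt (\<lambda>Y. \<phi> Y * cnj (\<psi> Y))" using assms by (intro sqint_prod) (auto simp: l2_sqint)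
  then have "Infinite_Set_Sum.abs_summable_on (\<lambda>Y. \<phi> Y * cnj (\<psi> Y)) UNIV"
    by (simp add: Infinite_Set_Sum.abs_summable_on_def)
  from infsetsum_infsum[OF this] show ?thesis by (simp add: l2_inner_def ip_def infsetsum_def)
qed

lemmas l2_add = sqint_add[of cnt, folded l2_sqint]
  and l2_diff = sqint_diff[of cnt, folded l2_sqint]
  and l2_cmult = sqint_cmult[of cnt, folded l2_sqint]
  and l2_zero = sqint_0[of cnt, folded l2_sqint]

abbreviation n2 where "n2 \<equiv> nrm cnt"

lemma finite_support:
  fixes f :: "'v \<Rightarrow> 'b::{banach, second_countable_topology}"
  assumes "finite T" "\<And>Y. Y \<notin> T \<Longrightarrow> f Y = 0"
  shows "integrable cnt f" "(\<integral>Y. f Y \<partial>cnt) = (\<Sum>Y\<in>T. f Y)"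
proof -
  have "Infinite_Set_Sum.abs_summable_on f T" using assms(1) by simp
  then have "Infinite_Set_Sum.abs_summable_on f UNIV"
    by (rule abs_summable_on_cong_neutral[THEN iffD1, rotated -1]) (use assms(2) in auto)
  then show "integrable cnt f" by (simp add: Infinite_Set_Sum.abs_summable_on_def)
  have "{Y \<in> UNIV. f Y \<noteq> 0} \<subseteq> T" using assms(2) by auto
  moreover from this have "finite {Y \<in> UNIV. f Y \<noteq> 0}" using assms(1) by (rule finite_subset)
  ultimately show "(\<integral>Y. f Y \<partial>cnt) = (\<Sum>Y\<in>T. f Y)"
    by (subst lebesgue_integral_count_space_finite_support) (auto intro!: sum.mono_neutral_left assms(1))
qed

lemma l2_finite_support: "finite T \<Longrightarrow> (\<And>Y. Y \<notin> T \<Longrightarrow> \<psi> Y = 0) \<Longrightarrow> \<psi> \<in> l2"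
  using finite_support(1)[of T "\<lambda>Y. (cmod (\<psi> Y))\<^sup>2"] by (simp add: l2_sqint sqint_def)

lemma ip_finite_support:
  assumes "finite T" "\<And>Y. Y \<notin> T \<Longrightarrow> \<psi> Y = 0"
  shows "ip cnt \<phi> \<psi> = (\<Sum>Y\<in>T. \<phi> Y * cnj (\<psi> Y))"
  unfolding ip_def by (rule finite_support(2)) (use assms in auto)

lemma norm_le_n2: assumes "\<psi> \<in> l2" shows "cmod (\<psi> Y) \<le> n2 \<psi>"
proof -
  have i: "integrable cnt (\<lambda>Y. (cmod (\<psi> Y))\<^sup>2)" using assms by (simp add: l2_sqint sqint_def)
  have "(cmod (\<psi> Y))\<^sup>2 = (\<integral>Z. (cmod (\<psi> Z))\<^sup>2 * indicator {Y} Z \<partial>cnt)"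
    by (subst finite_support(2)[of "{Y}"]) auto
  also have "\<dots> \<le> (\<integral>Z. (cmod (\<psi> Z))\<^sup>2 \<partial>cnt)"
    by (rule integral_mono_AE') (use i in \<open>auto simp: indicator_def\<close>)
  finally have "(cmod (\<psi> Y))\<^sup>2 \<le> (n2 \<psi>)\<^sup>2" by (simp add: nrm_sq)
  then show ?thesis by (rule power2_le_imp_le) (rule nrm_nonneg)
qed

lemma l2_complete:
  assumes sq: "\<And>n. f n \<in> l2"
    and cau: "\<And>\<epsilon>. \<epsilon> > 0 \<Longrightarrow> \<exists>N. \<forall>m\<ge>N. \<forall>n\<ge>N. n2 (\<lambda>x. f m x - f n x) \<le> \<epsilon>"
  shows "\<exists>g\<in>l2. (\<lambda>n. n2 (\<lambda>x. g x - f n x)) \<longlonglongrightarrow> 0"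
proof -
  have "Cauchy (\<lambda>n. f n x)" for x
  proof (rule metric_CauchyI)
    fix e :: real assume e: "e > 0"
    obtain N where N: "\<forall>m\<ge>N. \<forall>n\<ge>N. n2 (\<lambda>x. f m x - f n x) \<le> e / 2" using cau[of "e/2"] e by auto
    have "dist (f m x) (f n x) < e" if "m \<ge> N" "n \<ge> N" for m n
    proof -
      have "cmod (f m x - f n x) \<le> n2 (\<lambda>x. f m x - f n x)"
        by (rule norm_le_n2[OF l2_diff[OF sq sq]])
      also have "\<dots> \<le> e / 2" using N that by blast
      finally show ?thesis using e by (simp add: dist_norm)
    qed
    then show "\<exists>M. \<forall>m\<ge>M. \<forall>n\<ge>M. dist (f m x) (f n x) < e" by blast
  qed
  then have lim: "(\<lambda>n. f n x) \<longlonglongrightarrow> lim (\<lambda>n. f n x)" for x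
    by (simp add: Cauchy_convergent convergent_LIMSEQ_iff[symmetric])
  show ?thesis
    using sqint_fatou[of cnt f "\<lambda>x. lim (\<lambda>n. f n x)"] sq cau lim unfolding l2_sqint by (intro bexI[of _ "\<lambda>x. lim (\<lambda>n. f n x)"]) (auto simp: l2_sqint)
qed

definition subsp :: "('v \<Rightarrow> complex) set \<Rightarrow> bool" where
  "subsp E \<longleftrightarrow> (\<lambda>Y. 0) \<in> E \<and> (\<forall>\<phi>\<in>E. \<forall>\<psi>\<in>E. (\<lambda>Y. \<phi> Y + \<psi> Y) \<in> E) \<and> (\<forall>c. \<forall>\<phi>\<in>E. (\<lambda>Y. c * \<phi> Y) \<in> E)"

lemma subspD:
  assumes "subsp E"
  shows "(\<lambda>Y. 0) \<in> E" "\<phi> \<in> E \<Longrightarrow> \<psi> \<in> E \<Longrightarrow> (\<lambda>Y. \<phi> Y + \<psi> Y) \<in> E" "\<phi> \<in> E \<Longrightarrow> (\<lambda>Y. c * \<phi> Y) \<in> E"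
    "\<phi> \<in> E \<Longrightarrow> \<psi> \<in> E \<Longrightarrow> (\<lambda>Y. \<phi> Y - \<psi> Y) \<in> E"
proof -
  show 1: "(\<lambda>Y. 0) \<in> E" "\<phi> \<in> E \<Longrightarrow> \<psi> \<in> E \<Longrightarrow> (\<lambda>Y. \<phi> Y + \<psi> Y) \<in> E" "\<phi> \<in> E \<Longrightarrow> (\<lambda>Y. c * \<phi> Y) \<in> E" for \<phi> \<psi> c
    using assms by (auto simp: subsp_def)
  show "(\<lambda>Y. \<phi> Y - \<psi> Y) \<in> E" if "\<phi> \<in> E" "\<psi> \<in> E"
    using 1(2)[OF that(1) 1(3)[OF that(2), of "-1"]] by simp
qed

lemma subsp_sum:
  assumes "subsp E" "finite T" "\<And>i. i \<in> T \<Longrightarrow> f i \<in> E"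
  shows "(\<lambda>Y. \<Sum>i\<in>T. f i Y) \<in> E"
  using assms(2,3)
proof (induction T rule: finite_induct)
  case (insert i T)
  then show ?case using subspD(2)[OF assms(1), of "f i" "\<lambda>Y. \<Sum>i\<in>T. f i Y"] by simp
qed (simp add: subspD(1)[OF assms(1)])

lemma lin_span_superset: "G \<subseteq> lin_span G"
proof
  fix \<phi> assume "\<phi> \<in> G"
  then show "\<phi> \<in> lin_span G" unfolding lin_span_def
    by (intro CollectI exI[of _ "{\<phi>}"] exI[of _ "\<lambda>_. 1"]) auto
qed

lemma lin_span_subset: "subsp E \<Longrightarrow> G \<subseteq> E \<Longrightarrow> lin_span G \<subseteq> E"
  by (auto simp: lin_span_def intro!: subsp_sum subspD(3))

lemma subsp_lin_span: "subsp (lin_span G)"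
  unfolding subsp_def
proof (intro conjI ballI allI)
  show "(\<lambda>Y. 0) \<in> lin_span G" unfolding lin_span_def
    by (intro CollectI exI[of _ "{}"]) auto
  show "(\<lambda>Y. c * \<phi> Y) \<in> lin_span G" if "\<phi> \<in> lin_span G" for c \<phi>
  proof -
    from that obtain F k where "\<phi> = (\<lambda>Y. \<Sum>\<eta>\<in>F. k \<eta> * \<eta> Y)" "finite F" "F \<subseteq> G" by (auto simp: lin_span_def)
    then show ?thesis unfolding lin_span_def
      by (intro CollectI exI[of _ F] exI[of _ "\<lambda>\<eta>. c * k \<eta>"]) (auto simp: sum_distrib_left mult_ac)
  qed
  show "(\<lambda>Y. \<phi> Y + \<psi> Y) \<in> lin_span G" if "\<phi> \<in> lin_span G" "\<psi> \<in> lin_span G" for \<phi> \<psi>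
  proof -
    from that obtain F k F' k' where
      1: "\<phi> = (\<lambda>Y. \<Sum>\<eta>\<in>F. k \<eta> * \<eta> Y)" "finite F" "F \<subseteq> G" and
      2: "\<psi> = (\<lambda>Y. \<Sum>\<eta>\<in>F'. k' \<eta> * \<eta> Y)" "finite F'" "F' \<subseteq> G"
      by (auto simp: lin_span_def)
    define K K' where "K \<eta> = (if \<eta> \<in> F then k \<eta> else 0)" and "K' \<eta> = (if \<eta> \<in> F' then k' \<eta> else 0)" for \<eta>
    have "\<phi> Y = (\<Sum>\<eta>\<in>F \<union> F'. K \<eta> * \<eta> Y)" for Y
      unfolding 1 K_def using 1 2 by (intro sum.mono_neutral_cong_left) auto
    moreover have "\<psi> Y = (\<Sum>\<eta>\<in>F \<union> F'. K' \<eta> * \<eta> Y)" for Y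
      unfolding 2 K'_def using 1 2 by (intro sum.mono_neutral_cong_left) auto
    ultimately have "(\<lambda>Y. \<phi> Y + \<psi> Y) = (\<lambda>Y. \<Sum>\<eta>\<in>F \<union> F'. (K \<eta> + K' \<eta>) * \<eta> Y)"
      by (simp add: sum.distrib distrib_right)
    then show ?thesis unfolding lin_span_def using 1 2
      by (intro CollectI exI[of _ "F \<union> F'"] exI[of _ "\<lambda>\<eta>. K \<eta> + K' \<eta>"]) auto
  qed
qed

lemma lin_span_eq_iff: "lin_span E = E \<longleftrightarrow> subsp E"
  using subsp_lin_span[of E] lin_span_superset[of E] lin_span_subset[of E E] by auto

lemma subsp_l2: "subsp l2"
  unfolding subsp_def using l2_add l2_cmult l2_zero by blast

lemma l2_closure_iff:
  assumes "E \<subseteq> l2"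
  shows "\<psi> \<in> l2_closure E \<longleftrightarrow> \<psi> \<in> l2 \<and> (\<forall>\<epsilon>>0. \<exists>\<phi>\<in>E. n2 (\<lambda>Y. \<psi> Y - \<phi> Y) < \<epsilon>)"
proof -
  have "E \<inter> l2 = E" using assms by auto
  moreover have "l2_norm (\<lambda>Y. \<psi> Y - \<phi> Y) = n2 (\<lambda>Y. \<psi> Y - \<phi> Y)" if "\<psi> \<in> l2" "\<phi> \<in> E" for \<phi>
    using that assms by (intro l2_norm_nrm l2_diff) auto
  ultimately show ?thesis unfolding l2_closure_def mem_Collect_eq
    by (simp cong: conj_cong bex_cong)
qed

lemma l2_closure_seq:
  assumes "E \<subseteq> l2"
  shows "\<psi> \<in> l2_closure E \<longleftrightarrow> \<psi> \<in> l2 \<and> (\<exists>f. (\<forall>n. f n \<in> E) \<and> (\<lambda>n. n2 (\<lambda>Y. \<psi> Y - f n Y)) \<longlonglongrightarrow> 0)"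
proof (safe)
  assume "\<psi> \<in> l2_closure E"
  then show "\<psi> \<in> l2" using assms by (simp add: l2_closure_iff)
  have "\<exists>\<phi>\<in>E. n2 (\<lambda>Y. \<psi> Y - \<phi> Y) < inverse (real (Suc n))" for n
    using \<open>\<psi> \<in> l2_closure E\<close> by (simp add: l2_closure_iff[OF assms])
  then obtain f where f: "\<And>n. f n \<in> E" "\<And>n. n2 (\<lambda>Y. \<psi> Y - f n Y) < inverse (real (Suc n))" by metis
  have "(\<lambda>n. n2 (\<lambda>Y. \<psi> Y - f n Y)) \<longlonglongrightarrow> 0"
  proof (rule tendsto_sandwich[OF _ _ tendsto_const LIMSEQ_inverse_real_of_nat])
    show "\<forall>\<^sub>F n in sequentially. n2 (\<lambda>Y. \<psi> Y - f n Y) \<le> inverse (real (Suc n))"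
      by (rule always_eventually) (intro allI less_imp_le f)
  qed (simp add: nrm_nonneg)
  then show "\<exists>f. (\<forall>n. f n \<in> E) \<and> (\<lambda>n. n2 (\<lambda>Y. \<psi> Y - f n Y)) \<longlonglongrightarrow> 0" using f by blast
next
  fix f assume "\<psi> \<in> l2" "\<forall>n. f n \<in> E" "(\<lambda>n. n2 (\<lambda>Y. \<psi> Y - f n Y)) \<longlonglongrightarrow> 0"
  moreover have "\<exists>n. n2 (\<lambda>Y. \<psi> Y - f n Y) < \<epsilon>" if "\<epsilon> > 0" for \<epsilon>
    using order_tendstoD(2)[OF calculation(3) that] eventually_happens'[OF sequentially_bot] by blast
  ultimately show "\<psi> \<in> l2_closure E" unfolding l2_closure_iff[OF assms] by blast
qed

lemma l2_closure_superset: "E \<subseteq> l2 \<Longrightarrow> E \<subseteq> l2_closure E"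
proof
  fix \<psi> assume "E \<subseteq> l2" "\<psi> \<in> E"
  then show "\<psi> \<in> l2_closure E" unfolding l2_closure_iff[OF \<open>E \<subseteq> l2\<close>]
    by (auto simp: nrm_0 intro!: bexI[of _ \<psi>])
qed

lemma l2_closure_l2: "l2_closure E \<subseteq> l2" by (auto simp: l2_closure_def)

lemma subsp_l2_closure:
  assumes E: "E \<subseteq> l2" "subsp E" shows "subsp (l2_closure E)"
  unfolding subsp_def
proof (intro conjI ballI allI)
  show "(\<lambda>Y. 0) \<in> l2_closure E" using l2_closure_superset[OF E(1)] subspD(1)[OF E(2)] by blast
  fix \<phi> assume "\<phi> \<in> l2_closure E"
  then obtain f where p: "\<phi> \<in> l2" and f: "\<And>n. f n \<in> E" "(\<lambda>n. n2 (\<lambda>Y. \<phi> Y - f n Y)) \<longlonglongrightarrow> 0"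
    unfolding l2_closure_seq[OF E(1)] by blast
  show "(\<lambda>Y. c * \<phi> Y) \<in> l2_closure E" for c
    unfolding l2_closure_seq[OF E(1)]
  proof (intro conjI exI[of _ "\<lambda>n Y. c * f n Y"] allI)
    show "(\<lambda>Y. c * \<phi> Y) \<in> l2" by (rule l2_cmult[OF p])
    show "(\<lambda>Y. c * f n Y) \<in> E" for n by (rule subspD(3)[OF E(2) f(1)])
    have "(\<lambda>n. n2 (\<lambda>Y. c * \<phi> Y - c * f n Y)) = (\<lambda>n. cmod c * n2 (\<lambda>Y. \<phi> Y - f n Y))"
      unfolding nrm_cmult[symmetric] right_diff_distrib ..
    then show "(\<lambda>n. n2 (\<lambda>Y. c * \<phi> Y - c * f n Y)) \<longlonglongrightarrow> 0" using tendsto_mult_right_zero[OF f(2)] by simp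
  qed
  fix \<psi> assume "\<psi> \<in> l2_closure E"
  then obtain g where q: "\<psi> \<in> l2" and g: "\<And>n. g n \<in> E" "(\<lambda>n. n2 (\<lambda>Y. \<psi> Y - g n Y)) \<longlonglongrightarrow> 0"
    unfolding l2_closure_seq[OF E(1)] by blast
  show "(\<lambda>Y. \<phi> Y + \<psi> Y) \<in> l2_closure E"
    unfolding l2_closure_seq[OF E(1)]
  proof (intro conjI exI[of _ "\<lambda>n Y. f n Y + g n Y"] allI)
    show "(\<lambda>Y. \<phi> Y + \<psi> Y) \<in> l2" by (rule l2_add[OF p q])
    show "(\<lambda>Y. f n Y + g n Y) \<in> E" for n by (rule subspD(2)[OF E(2) f(1) g(1)])
    have le: "n2 (\<lambda>Y. (\<phi> Y + \<psi> Y) - (f n Y + g n Y)) \<le> n2 (\<lambda>Y. \<phi> Y - f n Y) + n2 (\<lambda>Y. \<psi> Y - g n Y)" for n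
    proof -
      have "(\<lambda>Y. (\<phi> Y + \<psi> Y) - (f n Y + g n Y)) = (\<lambda>Y. (\<phi> Y - f n Y) + (\<psi> Y - g n Y))" by auto
      moreover have "f n \<in> l2" "g n \<in> l2" using f g E by auto
      ultimately show ?thesis using nrm_triangle[OF sqint_diff sqint_diff] p q by (simp add: l2_sqint)
    qed
    show "(\<lambda>n. n2 (\<lambda>Y. (\<phi> Y + \<psi> Y) - (f n Y + g n Y))) \<longlonglongrightarrow> 0"
      by (rule tendsto_sandwich[OF _ _ tendsto_const tendsto_add_zero[OF f(2) g(2)]])
        (auto intro!: always_eventually le simp: nrm_nonneg)
  qed
qed

lemma l2_closure_idem:
  assumes "E \<subseteq> l2" shows "l2_closure (l2_closure E) = l2_closure E"
proof
  show "l2_closure E \<subseteq> l2_closure (l2_closure E)" by (rule l2_closure_superset[OF l2_closure_l2])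
  show "l2_closure (l2_closure E) \<subseteq> l2_closure E"
  proof
    fix \<psi> assume psi: "\<psi> \<in> l2_closure (l2_closure E)"
    then have l: "\<psi> \<in> l2" by (simp add: l2_closure_iff[OF l2_closure_l2])
    have "\<exists>\<eta>\<in>E. n2 (\<lambda>Y. \<psi> Y - \<eta> Y) < \<epsilon>" if e: "\<epsilon> > 0" for \<epsilon>
    proof -
      obtain \<phi> where p: "\<phi> \<in> l2_closure E" "n2 (\<lambda>Y. \<psi> Y - \<phi> Y) < \<epsilon> / 2"
        using psi e unfolding l2_closure_iff[OF l2_closure_l2] by (meson half_gt_zero)
      obtain \<eta> where c: "\<eta> \<in> E" "n2 (\<lambda>Y. \<phi> Y - \<eta> Y) < \<epsilon> / 2"
        using p(1) e unfolding l2_closure_iff[OF assms] by (meson half_gt_zero)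
      have "\<phi> \<in> l2" "\<eta> \<in> l2" using p c assms l2_closure_l2 by auto
      then have "n2 (\<lambda>Y. \<psi> Y - \<eta> Y) \<le> n2 (\<lambda>Y. \<psi> Y - \<phi> Y) + n2 (\<lambda>Y. \<phi> Y - \<eta> Y)"
        using l by (intro nrm_triangle_diff) (auto simp: l2_sqint)
      then show ?thesis using p(2) c by (intro bexI[of _ \<eta>]) auto
    qed
    then show "\<psi> \<in> l2_closure E" unfolding l2_closure_iff[OF assms] using l by blast
  qed
qed

lemma closed_subspace_closure:
  assumes "G \<subseteq> l2" shows "closed_subspace (l2_closure (lin_span G))"
proof -
  have s: "lin_span G \<subseteq> l2" by (rule lin_span_subset[OF subsp_l2 assms])
  show ?thesis unfolding closed_subspace_def lin_span_eq_iff
    using subsp_l2_closure[OF s subsp_lin_span] l2_closure_idem[OF s] by simp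
qed

lemma closed_subspaceD:
  assumes "closed_subspace E"
  shows "subsp E" "E \<subseteq> l2" "l2_closure E = E"
  using assms l2_closure_l2[of E] unfolding closed_subspace_def lin_span_eq_iff by auto

lemma closed_subspaceI:
  assumes "subsp E" "E \<subseteq> l2"
    and "\<And>\<psi> f. \<psi> \<in> l2 \<Longrightarrow> (\<And>n. f n \<in> E) \<Longrightarrow> (\<lambda>n. n2 (\<lambda>Y. \<psi> Y - f n Y)) \<longlonglongrightarrow> 0 \<Longrightarrow> \<psi> \<in> E"
  shows "closed_subspace E"
  unfolding closed_subspace_def lin_span_eq_iff
  using assms(1) l2_closure_superset[OF assms(2)] l2_closure_seq[OF assms(2)] assms(3) by blast

lemma closed_subspace_lim:
  assumes "closed_subspace E" "\<psi> \<in> l2" "\<And>n. f n \<in> E" "(\<lambda>n. n2 (\<lambda>Y. \<psi> Y - f n Y)) \<longlonglongrightarrow> 0"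
  shows "\<psi> \<in> E"
  using l2_closure_seq[OF closed_subspaceD(2)[OF assms(1)]] closed_subspaceD(3)[OF assms(1)] assms by blast

lemma l2_lim_pointwise:
  assumes "\<psi> \<in> l2" "\<And>n. f n \<in> l2" "(\<lambda>n. n2 (\<lambda>Y. \<psi> Y - f n Y)) \<longlonglongrightarrow> 0"
  shows "(\<lambda>n. f n V) \<longlonglongrightarrow> \<psi> V"
proof -
  have "(\<lambda>n. \<psi> V - f n V) \<longlonglongrightarrow> 0"
    by (rule Lim_null_comparison[OF always_eventually assms(3)])
      (use norm_le_n2[OF l2_diff[OF assms(1,2)]] in auto)
  from tendsto_diff[OF tendsto_const[of "\<psi> V"] this] show ?thesis by simp
qed

lemma ip_add: "\<phi> \<in> l2 \<Longrightarrow> \<psi> \<in> l2 \<Longrightarrow> \<eta> \<in> l2 \<Longrightarrow> ip cnt (\<lambda>Y. \<phi> Y + \<psi> Y) \<eta> = ip cnt \<phi> \<eta> + ip cnt \<psi> \<eta>"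
  unfolding ip_def distrib_right
  by (intro Bochner_Integration.integral_add sqint_prod) (auto simp: l2_sqint)

lemma ip_cmult: "ip cnt (\<lambda>Y. c * \<phi> Y) \<eta> = c * ip cnt \<phi> \<eta>"
  unfolding ip_def by (simp add: mult.assoc)

lemma ip_cnj: "ip cnt \<phi> \<eta> = cnj (ip cnt \<eta> \<phi>)"
  unfolding ip_def by (simp flip: Bochner_Integration.integral_cnj add: mult.commute)

lemma orthogonal_closure:
  assumes G: "G \<subseteq> l2" and c: "\<eta> \<in> l2" and o: "\<And>\<phi>. \<phi> \<in> G \<Longrightarrow> ip cnt \<phi> \<eta> = 0"
    and p: "\<phi> \<in> l2_closure (lin_span G)"
  shows "ip cnt \<phi> \<eta> = 0"
proof -
  have s: "lin_span G \<subseteq> l2" by (rule lin_span_subset[OF subsp_l2 G])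
  have "subsp {\<phi> \<in> l2. ip cnt \<phi> \<eta> = 0}"
    unfolding subsp_def using c l2_add l2_cmult l2_zero by (auto simp: ip_add ip_cmult) (simp add: ip_def)
  then have 1: "ip cnt \<psi> \<eta> = 0" if "\<psi> \<in> lin_span G" for \<psi>
    using lin_span_subset[of "{\<phi> \<in> l2. ip cnt \<phi> \<eta> = 0}" G] G o that by blast
  have pl: "\<phi> \<in> l2" using p l2_closure_l2 by blast
  have "cmod (ip cnt \<phi> \<eta>) \<le> 0"
  proof (rule field_le_epsilon)
    fix e :: real assume e: "e > 0"
    obtain \<psi> where psi: "\<psi> \<in> lin_span G" "n2 (\<lambda>Y. \<phi> Y - \<psi> Y) < e / (n2 \<eta> + 1)"
      using p e nrm_nonneg[of cnt \<eta>] unfolding l2_closure_iff[OF s] by (metis add_nonneg_pos divide_pos_pos zero_less_one)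
    have pl2: "\<psi> \<in> l2" using psi s by auto
    have "ip cnt (\<lambda>Y. (\<phi> Y - \<psi> Y) + \<psi> Y) \<eta> = ip cnt (\<lambda>Y. \<phi> Y - \<psi> Y) \<eta> + ip cnt \<psi> \<eta>"
      by (rule ip_add[OF l2_diff[OF pl pl2] pl2 c])
    then have "cmod (ip cnt \<phi> \<eta>) = cmod (ip cnt (\<lambda>Y. \<phi> Y - \<psi> Y) \<eta>)" using 1[OF psi(1)] by simp
    also have "\<dots> \<le> n2 (\<lambda>Y. \<phi> Y - \<psi> Y) * n2 \<eta>"
      using pl pl2 c by (intro cauchy_schwarz sqint_diff) (auto simp: l2_sqint)
    also have "\<dots> \<le> n2 (\<lambda>Y. \<phi> Y - \<psi> Y) * (n2 \<eta> + 1)" by (intro mult_left_mono nrm_nonneg) auto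
    also have "\<dots> \<le> e / (n2 \<eta> + 1) * (n2 \<eta> + 1)" using psi(2) nrm_nonneg[of cnt \<eta>] by (intro mult_right_mono) auto
    also have "\<dots> = 0 + e" using nrm_nonneg[of cnt \<eta>] by (auto simp: field_simps add_nonneg_eq_0_iff)
    finally show "cmod (ip cnt \<phi> \<eta>) \<le> 0 + e" .
  qed
  then show ?thesis by simp
qed

lemma n2_ip: "\<phi> \<in> l2 \<Longrightarrow> complex_of_real ((n2 \<phi>)\<^sup>2) = ip cnt \<phi> \<phi>"
  unfolding nrm_sq ip_def complex_norm_square[symmetric]
  by (simp flip: integral_complex_of_real)

lemma pythagoras:
  assumes "\<phi> \<in> l2" "\<psi> \<in> l2" "ip cnt \<phi> \<psi> = 0"
  shows "(n2 (\<lambda>Y. \<phi> Y + \<psi> Y))\<^sup>2 = (n2 \<phi>)\<^sup>2 + (n2 \<psi>)\<^sup>2"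
proof -
  have a: "ip cnt \<eta> (\<lambda>Y. \<phi> Y + \<psi> Y) = ip cnt \<eta> \<phi> + ip cnt \<eta> \<psi>" if "\<eta> \<in> l2" for \<eta>
    unfolding ip_cnj[of \<eta>] by (simp add: ip_add[OF assms(1,2) that])
  have "ip cnt \<psi> \<phi> = 0" using ip_cnj[of \<psi> \<phi>] assms(3) by simp
  then have "complex_of_real ((n2 (\<lambda>Y. \<phi> Y + \<psi> Y))\<^sup>2) = complex_of_real ((n2 \<phi>)\<^sup>2 + (n2 \<psi>)\<^sup>2)"
    unfolding of_real_add n2_ip[OF assms(1)] n2_ip[OF assms(2)] n2_ip[OF l2_add[OF assms(1,2)]] using assms
    by (simp add: ip_add[OF assms(1,2) l2_add[OF assms(1,2)]] a)
  then show ?thesis by (simp only: of_real_eq_iff)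
qed

lemma l2_truncate:
  assumes "\<phi> \<in> l2" "\<epsilon> > 0"
  shows "\<exists>T. finite T \<and> n2 (\<lambda>Y. \<phi> Y - (if Y \<in> T then \<phi> Y else 0)) < \<epsilon>"
proof -
  let ?g = "\<lambda>Y. (cmod (\<phi> Y))\<^sup>2"
  have i: "integrable cnt ?g" using assms(1) by (simp add: l2_sqint sqint_def)
  have "?g summable_on UNIV" using assms(1) by (simp add: l2_def)
  moreover have "0 < \<epsilon>\<^sup>2 / 2" using assms(2) by simp
  ultimately obtain T where T: "finite T" "dist (sum ?g T) (infsum ?g UNIV) \<le> \<epsilon>\<^sup>2 / 2"
    using infsum_finite_approximation[of ?g UNIV "\<epsilon>\<^sup>2 / 2"] by blast
  have "infsum ?g UNIV = (\<integral>Y. ?g Y \<partial>cnt)"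
    using l2_norm_nrm[OF assms(1)] by (simp add: l2_norm_def nrm_def)
  then have d: "(\<integral>Y. ?g Y \<partial>cnt) - sum ?g T \<le> \<epsilon>\<^sup>2 / 2" using T(2) unfolding dist_real_def by linarith
  have "(n2 (\<lambda>Y. \<phi> Y - (if Y \<in> T then \<phi> Y else 0)))\<^sup>2 = (\<integral>Y. ?g Y - (if Y \<in> T then ?g Y else 0) \<partial>cnt)"
    unfolding nrm_sq by (intro Bochner_Integration.integral_cong refl) auto
  also have "\<dots> = (\<integral>Y. ?g Y \<partial>cnt) - sum ?g T"
    using finite_support[of T "\<lambda>Y. if Y \<in> T then ?g Y else 0"] T(1) i by simp
  also have "\<dots> < \<epsilon>\<^sup>2" using d \<open>0 < \<epsilon>\<^sup>2 / 2\<close> by linarith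
  finally have "n2 (\<lambda>Y. \<phi> Y - (if Y \<in> T then \<phi> Y else 0)) < \<epsilon>"
    by (rule power_less_imp_less_base) (use assms(2) in simp)
  then show ?thesis using T(1) by blast
qed

text \<open>By Pythagoras each component of a difference is no longer than the difference itself, so
  the components of a convergent sequence are Cauchy and converge inside E and F.\<close>

lemma closed_subspace_sum:
  assumes E: "closed_subspace E" and F: "closed_subspace F"
    and o: "\<And>\<phi> \<psi>. \<phi> \<in> E \<Longrightarrow> \<psi> \<in> F \<Longrightarrow> ip cnt \<phi> \<psi> = 0"
  shows "closed_subspace {\<lambda>Y. \<phi> Y + \<psi> Y |\<phi> \<psi>. \<phi> \<in> E \<and> \<psi> \<in> F}" (is "closed_subspace ?S")
proof (rule closed_subspaceI)
  note E' = closed_subspaceD[OF E] and F' = closed_subspaceD[OF F]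
  show "?S \<subseteq> l2" using E'(2) F'(2) by (auto intro!: l2_add)
  show "subsp ?S" unfolding subsp_def
  proof (intro conjI ballI allI)
    show "(\<lambda>Y. 0) \<in> ?S"
      by (intro CollectI exI[of _ "\<lambda>Y. 0"]) (use subspD(1)[OF E'(1)] subspD(1)[OF F'(1)] in auto)
    show "(\<lambda>Y. c * \<phi> Y) \<in> ?S" if "\<phi> \<in> ?S" for c \<phi>
    proof -
      from that obtain p q where "\<phi> = (\<lambda>Y. p Y + q Y)" "p \<in> E" "q \<in> F" by blast
      then show ?thesis using subspD(3)[OF E'(1), of p c] subspD(3)[OF F'(1), of q c]
        by (intro CollectI exI[of _ "\<lambda>Y. c * p Y"] exI[of _ "\<lambda>Y. c * q Y"]) (auto simp: distrib_left)
    qed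
    show "(\<lambda>Y. \<phi> Y + \<psi> Y) \<in> ?S" if "\<phi> \<in> ?S" "\<psi> \<in> ?S" for \<phi> \<psi>
    proof -
      from that obtain p q p' q' where "\<phi> = (\<lambda>Y. p Y + q Y)" "p \<in> E" "q \<in> F"
        "\<psi> = (\<lambda>Y. p' Y + q' Y)" "p' \<in> E" "q' \<in> F" by blast
      then show ?thesis using subspD(2)[OF E'(1), of p p'] subspD(2)[OF F'(1), of q q']
        by (intro CollectI exI[of _ "\<lambda>Y. p Y + p' Y"] exI[of _ "\<lambda>Y. q Y + q' Y"]) (auto simp: add_ac)
    qed
  qed
  fix \<psi> f assume psi: "\<psi> \<in> l2" and fS: "\<And>n. f n \<in> ?S" and lim: "(\<lambda>n. n2 (\<lambda>Y. \<psi> Y - f n Y)) \<longlonglongrightarrow> 0"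
  have "\<forall>n. \<exists>p q. f n = (\<lambda>Y. p Y + q Y) \<and> p \<in> E \<and> q \<in> F" using fS by blast
  then obtain p q where pq: "\<And>n. f n = (\<lambda>Y. p n Y + q n Y)" "\<And>n. p n \<in> E" "\<And>n. q n \<in> F" by metis
  have pl: "p n \<in> l2" and ql: "q n \<in> l2" for n using pq E'(2) F'(2) by auto
  have fl: "f n \<in> l2" for n unfolding pq by (rule l2_add[OF pl ql])
  have le: "n2 (\<lambda>Y. p m Y - p n Y) \<le> n2 (\<lambda>Y. f m Y - f n Y) \<and> n2 (\<lambda>Y. q m Y - q n Y) \<le> n2 (\<lambda>Y. f m Y - f n Y)" for m n
  proof -
    have e: "(\<lambda>Y. f m Y - f n Y) = (\<lambda>Y. (p m Y - p n Y) + (q m Y - q n Y))" unfolding pq by auto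
    have "ip cnt (\<lambda>Y. p m Y - p n Y) (\<lambda>Y. q m Y - q n Y) = 0"
      by (intro o subspD(4)[OF E'(1)] subspD(4)[OF F'(1)] pq)
    from pythagoras[OF l2_diff[OF pl pl] l2_diff[OF ql ql] this]
    have "(n2 (\<lambda>Y. f m Y - f n Y))\<^sup>2 = (n2 (\<lambda>Y. p m Y - p n Y))\<^sup>2 + (n2 (\<lambda>Y. q m Y - q n Y))\<^sup>2"
      unfolding e .
    then have "(n2 (\<lambda>Y. p m Y - p n Y))\<^sup>2 \<le> (n2 (\<lambda>Y. f m Y - f n Y))\<^sup>2"
      "(n2 (\<lambda>Y. q m Y - q n Y))\<^sup>2 \<le> (n2 (\<lambda>Y. f m Y - f n Y))\<^sup>2" by simp_all
    then show ?thesis using power2_le_imp_le nrm_nonneg by blast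
  qed
  have cf: "\<exists>N. \<forall>m\<ge>N. \<forall>n\<ge>N. n2 (\<lambda>Y. f m Y - f n Y) \<le> \<epsilon>" if e: "\<epsilon> > 0" for \<epsilon>
  proof -
    obtain N where N: "\<And>n. n \<ge> N \<Longrightarrow> n2 (\<lambda>Y. \<psi> Y - f n Y) < \<epsilon> / 2"
      using order_tendstoD(2)[OF lim, of "\<epsilon> / 2"] e by (auto simp: eventually_sequentially)
    have "n2 (\<lambda>Y. f m Y - f n Y) \<le> \<epsilon>" if "m \<ge> N" "n \<ge> N" for m n
    proof -
      have "n2 (\<lambda>Y. f m Y - f n Y) \<le> n2 (\<lambda>Y. f m Y - \<psi> Y) + n2 (\<lambda>Y. \<psi> Y - f n Y)"
        using fl psi by (intro nrm_triangle_diff) (auto simp: l2_sqint)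
      then show ?thesis using N[OF that(1)] N[OF that(2)] nrm_minus[of cnt "f m" \<psi>] by simp
    qed
    then show ?thesis by blast
  qed
  have "\<exists>g\<in>l2. (\<lambda>n. n2 (\<lambda>Y. g Y - p n Y)) \<longlonglongrightarrow> 0"
  proof (rule l2_complete[OF pl])
    fix \<epsilon> :: real assume "\<epsilon> > 0"
    then obtain N where "\<forall>m\<ge>N. \<forall>n\<ge>N. n2 (\<lambda>Y. f m Y - f n Y) \<le> \<epsilon>" using cf by blast
    then show "\<exists>N. \<forall>m\<ge>N. \<forall>n\<ge>N. n2 (\<lambda>Y. p m Y - p n Y) \<le> \<epsilon>"
      by (intro exI[of _ N]) (blast intro: order_trans[OF le[THEN conjunct1]])
  qed
  then obtain P where P: "P \<in> l2" "(\<lambda>n. n2 (\<lambda>Y. P Y - p n Y)) \<longlonglongrightarrow> 0" by blast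
  have "\<exists>g\<in>l2. (\<lambda>n. n2 (\<lambda>Y. g Y - q n Y)) \<longlonglongrightarrow> 0"
  proof (rule l2_complete[OF ql])
    fix \<epsilon> :: real assume "\<epsilon> > 0"
    then obtain N where "\<forall>m\<ge>N. \<forall>n\<ge>N. n2 (\<lambda>Y. f m Y - f n Y) \<le> \<epsilon>" using cf by blast
    then show "\<exists>N. \<forall>m\<ge>N. \<forall>n\<ge>N. n2 (\<lambda>Y. q m Y - q n Y) \<le> \<epsilon>"
      by (intro exI[of _ N]) (blast intro: order_trans[OF le[THEN conjunct2]])
  qed
  then obtain Q where Q: "Q \<in> l2" "(\<lambda>n. n2 (\<lambda>Y. Q Y - q n Y)) \<longlonglongrightarrow> 0" by blast
  have PE: "P \<in> E" by (rule closed_subspace_lim[OF E P(1) pq(2) P(2)])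
  have QF: "Q \<in> F" by (rule closed_subspace_lim[OF F Q(1) pq(3) Q(2)])
  have "\<psi> V = P V + Q V" for V
  proof -
    have "(\<lambda>n. p n V) \<longlonglongrightarrow> P V"
      by (rule l2_lim_pointwise[OF P(1) pl P(2)])
    moreover have "(\<lambda>n. q n V) \<longlonglongrightarrow> Q V"
      by (rule l2_lim_pointwise[OF Q(1) ql Q(2)])
    ultimately have "(\<lambda>n. f n V) \<longlonglongrightarrow> P V + Q V" unfolding pq by (rule tendsto_add)
    moreover have "(\<lambda>n. f n V) \<longlonglongrightarrow> \<psi> V"
      by (rule l2_lim_pointwise[OF psi fl lim])
    ultimately show ?thesis by (rule LIMSEQ_unique[symmetric])
  qed
  then have "\<psi> = (\<lambda>Y. P Y + Q Y)" by auto
  then show "\<psi> \<in> ?S" using PE QF by blast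
qed

text \<open>Finite truncations approximate every square-summable function and are finite
  combinations of unit vectors.\<close>

lemma closed_subspace_all:
  assumes E: "closed_subspace E" and d: "\<And>V. delta V \<in> E"
  shows "E = l2"
proof
  note E' = closed_subspaceD[OF E]
  show "E \<subseteq> l2" by (rule E')
  show "l2 \<subseteq> E"
  proof
    fix \<phi> :: "'a \<Rightarrow> complex" assume p: "\<phi> \<in> l2"
    have "\<exists>\<eta>\<in>E. n2 (\<lambda>Y. \<phi> Y - \<eta> Y) < \<epsilon>" if e: "\<epsilon> > 0" for \<epsilon>
    proof -
      obtain T where T: "finite T" "n2 (\<lambda>Y. \<phi> Y - (if Y \<in> T then \<phi> Y else 0)) < \<epsilon>"
        using l2_truncate[OF p e] by blast
      have "(\<lambda>Y. if Y \<in> T then \<phi> Y else 0) = (\<lambda>Y. \<Sum>V\<in>T. \<phi> V * delta V Y)"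
        using T(1) by (auto simp: delta_def if_distrib sum.delta' cong: if_cong)
      moreover have "(\<lambda>Y. \<Sum>V\<in>T. \<phi> V * delta V Y) \<in> E"
        by (intro subsp_sum[OF E'(1) T(1)] subspD(3)[OF E'(1)] d)
      ultimately show ?thesis using T(2) by auto
    qed
    then have "\<phi> \<in> l2_closure E" unfolding l2_closure_iff[OF E'(2)] using p by blast
    then show "\<phi> \<in> E" using E' by simp
  qed
qed

section \<open>Density of polynomials\<close>

definition pol :: "complex poly \<Rightarrow> real \<Rightarrow> complex" where "pol p x = poly p (of_real x)"

lemma pol_simps: "pol (p + q) x = pol p x + pol q x" "pol (smult c p) x = c * pol p x"
  "pol (p - q) x = pol p x - pol q x" "pol (monom c n) x = c * of_real x ^ n" "pol 0 x = 0" "pol 1 x = 1"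
  by (simp_all add: pol_def poly_monom)

lemma pol_continuous: "continuous_on T (pol p)"
  unfolding pol_def[abs_def] by (intro continuous_intros)

locale compact_measure = finite_measure M for M :: "real measure" +
  fixes R :: real
  assumes sets_M [simp, measurable_cong]: "sets M = sets borel" and supp: "AE x in M. \<bar>x\<bar> \<le> R"
begin

lemma fin: "finite_measure M" by unfold_locales

lemma space_M [simp]: "space M = UNIV"
  using sets_eq_imp_space_eq[OF sets_M] by simp

lemma pol_measurable [measurable]: "pol p \<in> borel_measurable M"
  using borel_measurable_continuous_onI[OF pol_continuous] by simp

lemma pol_bounded: "\<exists>C. AE x in M. cmod (pol p x) \<le> C"
proof -
  have "bounded (pol p ` {-R..R})"
    by (intro compact_imp_bounded compact_continuous_image pol_continuous) auto
  then obtain C where C: "\<And>x. x \<in> {-R..R} \<Longrightarrow> cmod (pol p x) \<le> C" by (force simp: bounded_iff)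
  show ?thesis using supp by (intro exI[of _ C]) (auto elim!: eventually_mono intro!: C)
qed

lemma sqint_pol: "sqint M (pol p)"
  using pol_bounded sqint_bounded[OF fin pol_measurable] by blast

lemma sqint_AE_mult:
  assumes "sqint M f" "g \<in> borel_measurable M" "AE x in M. cmod (g x) \<le> C"
  shows "sqint M (\<lambda>x. g x * f x)"
proof -
  \<comment> \<open>Cutting g off where it exceeds C gives a function bounded at every point, as
    \<open>sqint_bounded_mult\<close> requires, and equal to g almost everywhere.\<close>
  let ?g = "\<lambda>x. if cmod (g x) \<le> C then g x else 0"
  note m = sqintD(1)[OF assms(1)] assms(2)
  have "sqint M (\<lambda>x. ?g x * f x)"
    by (rule sqint_bounded_mult[OF assms(1), of _ "max 0 C"]) (use assms(2) in \<open>measurable, auto\<close>)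
  moreover have "integrable M (\<lambda>x. (cmod (g x * f x))\<^sup>2) \<longleftrightarrow> integrable M (\<lambda>x. (cmod (?g x * f x))\<^sup>2)"
    by (rule integrable_cong_AE) (use m assms(3) in \<open>auto elim!: eventually_mono\<close>)
  ultimately show ?thesis using m unfolding sqint_def by auto
qed

text \<open>Membership in the L^2 closure of the polynomials. The class is shown to contain
  continuous functions by Stone-Weierstrass on the compact support, then indicators of half-lines,
  of Borel sets by a Dynkin argument, and limits of simple functions.\<close>

definition approx :: "(real \<Rightarrow> complex) \<Rightarrow> bool" where
  "approx f \<longleftrightarrow> sqint M f \<and> (\<forall>\<epsilon>>0. \<exists>p. nrm M (\<lambda>x. f x - pol p x) < \<epsilon>)"

lemma approx_sq: "approx f \<Longrightarrow> sqint M f" by (simp add: approx_def)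

lemma approx_pol: "approx (pol p)"
  unfolding approx_def using sqint_pol by (auto intro!: exI[of _ p] simp: nrm_0)

lemma approx_lim:
  assumes f: "\<And>n. approx (f n)" and g: "sqint M g" and l: "(\<lambda>n. nrm M (\<lambda>x. g x - f n x)) \<longlonglongrightarrow> 0"
  shows "approx g"
  unfolding approx_def
proof (intro conjI g allI impI)
  fix \<epsilon> :: real assume e: "\<epsilon> > 0"
  obtain n where n: "nrm M (\<lambda>x. g x - f n x) < \<epsilon> / 2"
    using order_tendstoD(2)[OF l, of "\<epsilon> / 2"] e eventually_happens'[OF sequentially_bot] by auto
  obtain p where p: "nrm M (\<lambda>x. f n x - pol p x) < \<epsilon> / 2"
    using f[of n] e unfolding approx_def by (meson half_gt_zero)
  have "nrm M (\<lambda>x. g x - pol p x) \<le> nrm M (\<lambda>x. g x - f n x) + nrm M (\<lambda>x. f n x - pol p x)"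
    by (rule nrm_triangle_diff[OF g approx_sq[OF f] sqint_pol])
  then show "\<exists>p. nrm M (\<lambda>x. g x - pol p x) < \<epsilon>" using n p by (intro exI[of _ p]) simp
qed

lemma approx_add:
  assumes "approx f" "approx g" shows "approx (\<lambda>x. f x + g x)"
  unfolding approx_def
proof (intro conjI sqint_add approx_sq assms allI impI)
  fix \<epsilon> :: real assume e: "\<epsilon> > 0"
  obtain p where p: "nrm M (\<lambda>x. f x - pol p x) < \<epsilon> / 2" using assms(1) e unfolding approx_def by (meson half_gt_zero)
  obtain q where q: "nrm M (\<lambda>x. g x - pol q x) < \<epsilon> / 2" using assms(2) e unfolding approx_def by (meson half_gt_zero)
  have "(\<lambda>x. f x + g x - pol (p + q) x) = (\<lambda>x. (f x - pol p x) + (g x - pol q x))"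
    by (simp add: pol_simps algebra_simps)
  then have "nrm M (\<lambda>x. f x + g x - pol (p + q) x) \<le> nrm M (\<lambda>x. f x - pol p x) + nrm M (\<lambda>x. g x - pol q x)"
    using nrm_triangle[OF sqint_diff[OF approx_sq[OF assms(1)] sqint_pol] sqint_diff[OF approx_sq[OF assms(2)] sqint_pol]]
    by simp
  then show "\<exists>p. nrm M (\<lambda>x. f x + g x - pol p x) < \<epsilon>" using p q by (intro exI[of _ "p + q"]) simp
qed

lemma approx_cmult:
  assumes "approx f" shows "approx (\<lambda>x. c * f x)"
  unfolding approx_def
proof (intro conjI sqint_cmult approx_sq assms allI impI)
  fix \<epsilon> :: real assume e: "\<epsilon> > 0"
  have c: "cmod c + 1 > 0" by (simp add: add_nonneg_pos)
  obtain p where p: "nrm M (\<lambda>x. f x - pol p x) < \<epsilon> / (cmod c + 1)"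
    using assms e c unfolding approx_def by (meson divide_pos_pos)
  have "nrm M (\<lambda>x. c * f x - pol (smult c p) x) = cmod c * nrm M (\<lambda>x. f x - pol p x)"
    unfolding nrm_cmult[symmetric] by (simp add: pol_simps right_diff_distrib)
  also have "\<dots> \<le> (cmod c + 1) * nrm M (\<lambda>x. f x - pol p x)" by (intro mult_right_mono nrm_nonneg) simp
  also have "\<dots> < \<epsilon>" using p c by (simp add: field_simps)
  finally show "\<exists>p. nrm M (\<lambda>x. c * f x - pol p x) < \<epsilon>" by blast
qed

lemma approx_sum: "finite T \<Longrightarrow> (\<And>i. i \<in> T \<Longrightarrow> approx (f i)) \<Longrightarrow> approx (\<lambda>x. \<Sum>i\<in>T. f i x)"
proof (induction T rule: finite_induct)
  case empty
  show ?case using approx_pol[of 0] by (simp add: pol_simps[abs_def])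
qed (auto intro: approx_add)

lemma approx_dominated:
  assumes f: "\<And>n. approx (f n)" and g: "sqint M g" and lim: "\<And>x. (\<lambda>n. f n x) \<longlonglongrightarrow> g x"
    and w: "integrable M w" and b: "\<And>n x. (cmod (g x - f n x))\<^sup>2 \<le> w x"
  shows "approx g"
proof (rule approx_lim[OF f g])
  have m: "g \<in> borel_measurable M" "f n \<in> borel_measurable M" for n
    using g approx_sq[OF f] by (auto simp: sqint_def)
  have "(\<lambda>n. \<integral>x. (cmod (g x - f n x))\<^sup>2 \<partial>M) \<longlonglongrightarrow> (\<integral>x. 0 \<partial>M)"
  proof (rule integral_dominated_convergence[OF _ _ w])
    show "AE x in M. (\<lambda>n. (cmod (g x - f n x))\<^sup>2) \<longlonglongrightarrow> 0"
    proof (rule AE_I2)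
      fix x
      have "(\<lambda>n. (cmod (g x - f n x))\<^sup>2) \<longlonglongrightarrow> (cmod (g x - g x))\<^sup>2" by (intro tendsto_intros lim)
      then show "(\<lambda>n. (cmod (g x - f n x))\<^sup>2) \<longlonglongrightarrow> 0" by simp
    qed
    show "AE x in M. norm ((cmod (g x - f n x))\<^sup>2) \<le> w x" for n using b by (intro AE_I2) simp
  qed (use m in \<open>measurable\<close>)
  then show "(\<lambda>n. nrm M (\<lambda>x. g x - f n x)) \<longlonglongrightarrow> 0"
    unfolding nrm_def using tendsto_real_sqrt by fastforce
qed

lemma approx_continuous:
  assumes "continuous_on UNIV (h :: real \<Rightarrow> real)" "\<And>x. \<bar>h x\<bar> \<le> 1"
  shows "approx (\<lambda>x. of_real (h x))"
  unfolding approx_def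
proof (intro conjI allI impI)
  have hm: "(\<lambda>x. complex_of_real (h x)) \<in> borel_measurable M"
    using borel_measurable_continuous_onI[of "\<lambda>x. complex_of_real (h x)"] assms(1) by (simp add: continuous_on_of_real)
  show s: "sqint M (\<lambda>x. of_real (h x))" by (rule sqint_bounded[OF fin hm, of 1]) (use assms(2) in auto)
  fix \<epsilon> :: real assume e: "\<epsilon> > 0"
  define m where "m = nrm M (\<lambda>x. 1)"
  have m: "m + 1 > 0" using nrm_nonneg[of M "\<lambda>x. 1"] by (simp add: m_def)
  have "continuous_on {-R..R} h" using assms(1) by (rule continuous_on_subset) auto
  then obtain g where g: "real_polynomial_function g" "\<And>x. x \<in> {-R..R} \<Longrightarrow> \<bar>h x - g x\<bar> < \<epsilon> / (m + 1)"
    using Stone_Weierstrass_real_polynomial_function[of "{-R..R}" h "\<epsilon> / (m + 1)"] e m by auto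
  obtain k n where kn: "g = (\<lambda>x. \<Sum>i\<le>n. k i * x ^ i)" using g(1) unfolding real_polynomial_function_iff_sum by blast
  define p where "p = (\<Sum>i\<le>n. monom (complex_of_real (k i)) i)"
  have p: "pol p x = of_real (g x)" for x
    unfolding p_def pol_def kn poly_sum by (simp add: poly_monom)
  have "nrm M (\<lambda>x. of_real (h x) - pol p x) \<le> \<epsilon> / (m + 1) * nrm M (\<lambda>x. 1)"
  proof (rule nrm_mono)
    show "sqint M (\<lambda>x. 1)" by (rule sqint_bounded[OF fin, of _ 1]) auto
    show "(\<lambda>x. of_real (h x) - pol p x) \<in> borel_measurable M" using hm by measurable
    show "AE x in M. cmod (of_real (h x) - pol p x) \<le> \<epsilon> / (m + 1) * cmod 1"
      using supp
    proof eventually_elim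
      case (elim x)
      have "cmod (of_real (h x) - pol p x) = \<bar>h x - g x\<bar>" unfolding p by (simp flip: of_real_diff)
      moreover have "x \<in> {-R..R}" using elim by auto
      ultimately show ?case using g(2)[of x] by simp
    qed
  qed (use e m in simp)
  also have "\<dots> < \<epsilon>" using e m by (simp add: m_def[symmetric] field_simps)
  finally show "\<exists>p. nrm M (\<lambda>x. of_real (h x) - pol p x) < \<epsilon>" by blast
qed

lemma sqint_indicator: "T \<in> sets borel \<Longrightarrow> sqint M (indicator T)"
  by (rule sqint_bounded[OF fin, of _ 1]) (auto simp: indicator_def)

lemma int_const: "integrable M (\<lambda>x. c :: real)" by simp

lemma approx_atMost: "approx (indicator {..c})"
proof (rule approx_dominated[OF _ _ _ int_const[of 1]])
  \<comment> \<open>Ramps equal to 1 up to c that descend linearly to 0 on an interval of length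
    1/n.\<close>
  let ?h = "\<lambda>n x. max 0 (min 1 (1 - real n * (x - c)))"
  show "approx (\<lambda>x. complex_of_real (?h n x))" for n
    by (rule approx_continuous) (auto intro!: continuous_intros)
  show "sqint M (indicator {..c})" by (rule sqint_indicator) simp
  show "(\<lambda>n. complex_of_real (?h n x)) \<longlonglongrightarrow> indicator {..c} x" for x
  proof (cases "x \<le> c")
    case True
    then have "?h n x = 1" for n by (simp add: mult_nonneg_nonpos)
    then show ?thesis using True by simp
  next
    case False
    then obtain N where N: "real N * (x - c) > 1" using reals_Archimedean3[of "x - c"] by auto
    have "complex_of_real (?h n x) = 0" if "n \<ge> N" for n
    proof -
      have "real N * (x - c) \<le> real n * (x - c)" using that False by (intro mult_right_mono) auto
      then show ?thesis using N by simp
    qed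
    then have "\<forall>\<^sub>F n in sequentially. complex_of_real (?h n x) = 0" by (auto simp: eventually_sequentially)
    then show ?thesis using False by (simp add: tendsto_eventually)
  qed
  show "(cmod (indicator {..c} x - complex_of_real (?h n x)))\<^sup>2 \<le> 1" for n x
  proof -
    have "indicator {..c} x - complex_of_real (?h n x) = of_real (indicator {..c} x - ?h n x)"
      by (simp add: indicator_def)
    moreover have "\<bar>indicator {..c} x - ?h n x\<bar> \<le> 1" by (auto simp: indicator_def)
    ultimately show ?thesis by (simp add: abs_square_le_1 del: of_real_diff)
  qed
qed

lemma approx_indicator: "T \<in> sets borel \<Longrightarrow> approx (indicator T)"
proof -
  assume "T \<in> sets borel"
  then have T: "T \<in> sigma_sets UNIV (range (\<lambda>c::real. {..c}))" by (simp add: borel_eq_atMost)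
  have "Int_stable (range (\<lambda>c::real. {..c}))" by (auto simp: Int_stable_def)
  moreover have "range (\<lambda>c::real. {..c}) \<subseteq> Pow UNIV" by simp
  ultimately show ?thesis using T
  proof (induction rule: sigma_sets_induct_disjoint)
    case (basic A)
    then show ?case using approx_atMost by auto
  next
    case empty
    then show ?case using approx_pol[of 0] by (simp add: pol_simps[abs_def] indicator_def)
  next
    case (compl A)
    have "indicator (UNIV - A) = (\<lambda>x. pol 1 x + (-1) * (indicator A x :: complex))"
      by (auto simp: indicator_def pol_simps)
    then show ?case using approx_add[OF approx_pol[of 1] approx_cmult[OF compl(2), of "-1"]] by simp
  next
    case (union A)
    have mA: "A i \<in> sets borel" for i using union(2) by (auto simp: borel_eq_atMost)
    show ?case
    proof (rule approx_dominated[OF _ _ _ int_const[of 1]])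
      show "approx (\<lambda>x. \<Sum>i<n. indicator (A i) x)" for n by (rule approx_sum) (use union in auto)
      show "sqint M (indicator (\<Union>i. A i))" by (rule sqint_indicator) (use mA in auto)
      have s: "(\<Sum>i<n. indicator (A i) x) = (indicator (\<Union>i<n. A i) x :: complex)" for n x
        by (rule indicator_UN_disjoint[symmetric]) (use union(1) in \<open>auto simp: disjoint_family_on_def\<close>)
      show "(\<lambda>n. \<Sum>i<n. indicator (A i) x) \<longlonglongrightarrow> (indicator (\<Union>i. A i) x :: complex)" for x
        unfolding s by (rule LIMSEQ_indicator_UN)
      show "(cmod (indicator (\<Union>i. A i) x - (\<Sum>i<n. indicator (A i) x)))\<^sup>2 \<le> 1" for n x
        unfolding s by (auto simp: indicator_def)
    qed
  qed
qed

theorem polynomials_dense: assumes "sqint M f" shows "approx f"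
proof -
  from borel_measurable_implies_sequence_metric[OF sqintD(1)[OF assms], of 0]
  obtain s where s: "\<And>i. simple_function M (s i)" "\<And>x. (\<lambda>i. s i x) \<longlonglongrightarrow> f x" "\<And>i x. cmod (s i x) \<le> 2 * cmod (f x)"
    by auto
  have a: "approx (s n)" for n
  proof -
    have "approx (\<lambda>x. \<Sum>y\<in>s n ` UNIV. y * indicator (s n -` {y}) x)"
      using s(1)[of n] by (intro approx_sum approx_cmult approx_indicator) (auto simp: simple_function_def)
    moreover have "(\<Sum>y\<in>s n ` UNIV. y * indicator (s n -` {y}) x) = s n x" for x
    proof -
      have "(\<Sum>y\<in>s n ` UNIV. y * indicator (s n -` {y}) x) = (\<Sum>y\<in>s n ` UNIV. if y = s n x then y else 0)"
        by (intro sum.cong) (auto simp: indicator_def)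
      then show ?thesis using s(1)[of n] by (simp add: simple_function_def sum.delta)
    qed
    ultimately show ?thesis by simp
  qed
  show ?thesis
  proof (rule approx_dominated[OF a assms s(2)])
    \<comment> \<open>The simple functions satisfy |s n| \<le> 2 |f|, so the error is at most 3 |f|,
      and 9 = 3^2.\<close>
    show "integrable M (\<lambda>x. 9 * (cmod (f x))\<^sup>2)" using assms by (simp add: sqint_def)
    show "(cmod (f x - s n x))\<^sup>2 \<le> 9 * (cmod (f x))\<^sup>2" for n x
    proof -
      have "cmod (f x - s n x) \<le> 3 * cmod (f x)" using norm_triangle_ineq4[of "f x" "s n x"] s(3)[of n x] by linarith
      then have "(cmod (f x - s n x))\<^sup>2 \<le> (3 * cmod (f x))\<^sup>2" by (intro power_mono) auto
      then show ?thesis by (simp add: power_mult_distrib)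
    qed
  qed
qed

text \<open>T is only assumed to distort norms by bounded factors. The lower bound makes preimages
  of a convergent sequence Cauchy, so the range is closed; the upper bound carries density of the
  polynomial multiples of w into the range. Used with w = \<open>kap i\<close> for the root and w =
  1 for the attached spaces.\<close>

lemma isometric_range:
  fixes T :: "(real \<Rightarrow> complex) \<Rightarrow> 'v \<Rightarrow> complex" and w :: "real \<Rightarrow> complex"
  assumes add: "\<And>f g. sqint M f \<Longrightarrow> sqint M g \<Longrightarrow> T (\<lambda>x. f x + g x) = (\<lambda>Y. T f Y + T g Y)"
    and mult: "\<And>c f. sqint M f \<Longrightarrow> T (\<lambda>x. c * f x) = (\<lambda>Y. c * T f Y)"
    and l2: "\<And>f. sqint M f \<Longrightarrow> T f \<in> l2"
    and up: "\<And>f. sqint M f \<Longrightarrow> n2 (T f) \<le> C * nrm M f" "0 < C"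
    and low: "\<And>f. sqint M f \<Longrightarrow> nrm M f \<le> D * n2 (T f)" "0 < D"
    and dense: "\<And>f \<epsilon>. sqint M f \<Longrightarrow> \<epsilon> > 0 \<Longrightarrow> \<exists>p. nrm M (\<lambda>x. f x - pol p x * w x) < \<epsilon>"
    and sqw: "\<And>p. sqint M (\<lambda>x. pol p x * w x)"
  shows "closed_subspace {T f |f. sqint M f}"
    and "l2_closure (lin_span (range (\<lambda>n. T (\<lambda>x. of_real x ^ n * w x)))) = {T f |f. sqint M f}"
proof -
  let ?E = "{T f |f. sqint M f}"
  have sub: "subsp ?E" unfolding subsp_def
  proof (intro conjI ballI allI)
    have "T (\<lambda>x. 0 * 0) = (\<lambda>Y. 0 * T (\<lambda>x. 0) Y)" by (rule mult[OF sqint_0])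
    then show "(\<lambda>Y. 0) \<in> ?E" using sqint_0 by (intro CollectI exI[of _ "\<lambda>x. 0"]) auto
    show "(\<lambda>Y. \<phi> Y + \<psi> Y) \<in> ?E" if *: "\<phi> \<in> ?E" "\<psi> \<in> ?E" for \<phi> \<psi>
    proof -
      obtain f g where "\<phi> = T f" "\<psi> = T g" "sqint M f" "sqint M g" using * by blast
      then show ?thesis using sqint_add add by (intro CollectI exI[of _ "\<lambda>x. f x + g x"]) simp
    qed
    show "(\<lambda>Y. c * \<phi> Y) \<in> ?E" if *: "\<phi> \<in> ?E" for c \<phi>
    proof -
      obtain f where "\<phi> = T f" "sqint M f" using * by blast
      then show ?thesis using sqint_cmult mult by (intro CollectI exI[of _ "\<lambda>x. c * f x"]) simp
    qed
  qed
  have E2: "?E \<subseteq> l2" using l2 by auto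
  have diff: "T (\<lambda>x. f x - g x) = (\<lambda>Y. T f Y - T g Y)" if "sqint M f" "sqint M g" for f g
    using add[OF that(1) sqint_cmult[OF that(2), of "-1"]] mult[OF that(2), of "-1"] by simp
  show cl: "closed_subspace ?E"
  proof (rule closed_subspaceI[OF sub E2])
    fix \<psi> \<phi> assume psi: "\<psi> \<in> l2" and ph: "\<And>n. \<phi> n \<in> ?E" and lim: "(\<lambda>n. n2 (\<lambda>Y. \<psi> Y - \<phi> n Y)) \<longlonglongrightarrow> 0"
    have "\<forall>n. \<exists>f. \<phi> n = T f \<and> sqint M f" using ph by blast
    then obtain f where f: "\<And>n. \<phi> n = T (f n)" "\<And>n. sqint M (f n)" by metis
    have cau: "\<exists>N. \<forall>m\<ge>N. \<forall>n\<ge>N. nrm M (\<lambda>x. f m x - f n x) \<le> \<epsilon>" if e: "\<epsilon> > 0" for \<epsilon>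
    proof -
      have e2: "\<epsilon> / (2 * D) > 0" using e low(2) by simp
      obtain N where N: "\<And>n. n \<ge> N \<Longrightarrow> n2 (\<lambda>Y. \<psi> Y - \<phi> n Y) < \<epsilon> / (2 * D)"
        using order_tendstoD(2)[OF lim e2] by (auto simp: eventually_sequentially)
      have "nrm M (\<lambda>x. f m x - f n x) \<le> \<epsilon>" if mn: "m \<ge> N" "n \<ge> N" for m n
      proof -
        have "n2 (\<lambda>Y. \<phi> m Y - \<phi> n Y) \<le> n2 (\<lambda>Y. \<phi> m Y - \<psi> Y) + n2 (\<lambda>Y. \<psi> Y - \<phi> n Y)"
          using l2[OF f(2)] psi unfolding f by (intro nrm_triangle_diff) (auto simp: l2_sqint)
        also have "\<dots> \<le> \<epsilon> / (2 * D) + \<epsilon> / (2 * D)"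
          using N[OF mn(1)] N[OF mn(2)] nrm_minus[of cnt "\<phi> m" \<psi>] by (intro add_mono) auto
        also have "\<dots> = \<epsilon> / D" using low(2) by (simp add: field_simps)
        finally have "D * n2 (\<lambda>Y. \<phi> m Y - \<phi> n Y) \<le> \<epsilon>" using low(2) by (simp add: field_simps)
        then show ?thesis using low(1)[OF sqint_diff[OF f(2) f(2)], of m n] diff[OF f(2) f(2), of m n] unfolding f by simp
      qed
      then show ?thesis by blast
    qed
    obtain g where g: "sqint M g" "(\<lambda>n. nrm M (\<lambda>x. g x - f n x)) \<longlonglongrightarrow> 0"
      using riesz_fischer[OF fin f(2) cau] by blast
    have "(\<lambda>n. n2 (\<lambda>Y. T g Y - \<phi> n Y)) \<longlonglongrightarrow> 0"
    proof (rule tendsto_sandwich[OF _ _ tendsto_const])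
      show "\<forall>\<^sub>F n in sequentially. n2 (\<lambda>Y. T g Y - \<phi> n Y) \<le> C * nrm M (\<lambda>x. g x - f n x)"
        using up(1)[OF sqint_diff[OF g(1) f(2)]] diff[OF g(1) f(2)] unfolding f by (intro always_eventually) simp
      show "(\<lambda>n. C * nrm M (\<lambda>x. g x - f n x)) \<longlonglongrightarrow> 0" using tendsto_mult_right_zero[OF g(2)] .
    qed (simp add: nrm_nonneg)
    then have "(\<lambda>n. \<phi> n V) \<longlonglongrightarrow> T g V" for V
      using l2[OF g(1)] l2[OF f(2)] unfolding f by (intro l2_lim_pointwise)
    moreover have "(\<lambda>n. \<phi> n V) \<longlonglongrightarrow> \<psi> V" for V
      using psi l2[OF f(2)] lim unfolding f by (intro l2_lim_pointwise)
    ultimately have "\<psi> = T g" using LIMSEQ_unique by blast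
    then show "\<psi> \<in> ?E" using g(1) by blast
  qed
  let ?G = "range (\<lambda>n. T (\<lambda>x. of_real x ^ n * w x))"
  have sqm: "sqint M (\<lambda>x. of_real x ^ n * w x)" for n
    using sqw[of "monom 1 n"] by (simp add: pol_simps)
  have GE: "?G \<subseteq> ?E" using sqm by blast
  have sG: "lin_span ?G \<subseteq> ?E" by (rule lin_span_subset[OF sub GE])
  have polG: "T (\<lambda>x. pol p x * w x) \<in> lin_span ?G" for p
  proof -
    have s: "T (\<lambda>x. \<Sum>i\<in>I. c i * (of_real x ^ i * w x)) \<in> lin_span ?G" if "finite I" for I and c :: "nat \<Rightarrow> complex"
      using that
    proof (induction I rule: finite_induct)
      case empty
      have "T (\<lambda>x. 0 * 0) = (\<lambda>Y. 0 * T (\<lambda>x. 0) Y)" by (rule mult[OF sqint_0])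
      then show ?case using subspD(1)[OF subsp_lin_span] by simp
    next
      case (insert i I)
      have s: "sqint M (\<lambda>x. \<Sum>i\<in>I. c i * (of_real x ^ i * w x))"
        by (intro sqint_sum sqint_cmult sqm insert)
      have "T (\<lambda>x. c i * (of_real x ^ i * w x)) \<in> lin_span ?G"
        unfolding mult[OF sqm] by (rule subspD(3)[OF subsp_lin_span subsetD[OF lin_span_superset rangeI]])
      from subspD(2)[OF subsp_lin_span this insert.IH]
      show ?case unfolding add[OF sqint_cmult[OF sqm] s, symmetric] using insert by simp
    qed
    have "pol p x * w x = (\<Sum>i\<le>degree p. coeff p i * (of_real x ^ i * w x))" for x
      unfolding pol_def poly_altdef by (simp add: sum_distrib_right mult.assoc)
    then show ?thesis using s[of "{..degree p}" "coeff p"] by simp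
  qed
  show "l2_closure (lin_span ?G) = ?E"
  proof
    show "l2_closure (lin_span ?G) \<subseteq> ?E"
    proof
      fix \<psi> assume "\<psi> \<in> l2_closure (lin_span ?G)"
      then obtain h where h: "\<psi> \<in> l2" "\<And>n. h n \<in> lin_span ?G" "(\<lambda>n. n2 (\<lambda>Y. \<psi> Y - h n Y)) \<longlonglongrightarrow> 0"
        using l2_closure_seq[OF order_trans[OF sG E2]] by blast
      show "\<psi> \<in> ?E" by (rule closed_subspace_lim[OF cl h(1) subsetD[OF sG h(2)] h(3)])
    qed
    show "?E \<subseteq> l2_closure (lin_span ?G)"
    proof
      fix \<psi> assume "\<psi> \<in> ?E"
      then obtain f where f: "\<psi> = T f" "sqint M f" by blast
      have "\<exists>\<phi>\<in>lin_span ?G. n2 (\<lambda>Y. \<psi> Y - \<phi> Y) < \<epsilon>" if e: "\<epsilon> > 0" for \<epsilon>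
      proof -
        have "\<epsilon> / C > 0" using e up(2) by simp
        then obtain p where p: "nrm M (\<lambda>x. f x - pol p x * w x) < \<epsilon> / C" using dense[OF f(2)] by blast
        have "n2 (\<lambda>Y. \<psi> Y - T (\<lambda>x. pol p x * w x) Y) \<le> C * nrm M (\<lambda>x. f x - pol p x * w x)"
          using up(1)[OF sqint_diff[OF f(2) sqw]] diff[OF f(2) sqw] unfolding f by simp
        also have "\<dots> < \<epsilon>" using p up(2) by (simp add: field_simps)
        finally show ?thesis using polG by blast
      qed
      then show "\<psi> \<in> l2_closure (lin_span ?G)"
        unfolding l2_closure_iff[OF order_trans[OF sG E2]] using l2[OF f(2)] unfolding f(1) by blast
    qed
  qed
qed

end

section \<open>Jacobi operators on the binary tree\<close>

lemma tree_nbrs: "{Y'. tree_adj V Y'} = {I1 # V, I2 # V} \<union> (if V = [] then {} else {tl V})"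
proof -
  have "tree_adj V Y \<longleftrightarrow> Y \<in> {I1 # V, I2 # V} \<union> (if V = [] then {} else {tl V})" for Y
    unfolding tree_adj_def by (cases V) (auto, (metis idx.exhaust)+)
  then show ?thesis by blast
qed

lemma jacobi_op_eq:
  "jacobi_op A B l \<psi> V = of_real (sqrt (A I1)) * \<psi> (I1 # V) + of_real (sqrt (A I2)) * \<psi> (I2 # V)
     + (if V = [] then 0 else of_real (sqrt (A (hd V))) * \<psi> (tl V))
     + of_real (B (if V = [] then l else hd V)) * \<psi> V"
proof -
  have "tl V \<noteq> j # V" for j
  proof
    assume "tl V = j # V"
    from arg_cong[OF this, of length] show False by simp
  qed
  then show ?thesis unfolding jacobi_op_def tree_nbrs by (cases V) (auto simp: edge_type_def)
qed

lemma jacobi_op_add: "jacobi_op A B l (\<lambda>Y. \<phi> Y + \<psi> Y) = (\<lambda>Y. jacobi_op A B l \<phi> Y + jacobi_op A B l \<psi> Y)"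
  by (rule ext) (simp add: jacobi_op_eq algebra_simps)

lemma jacobi_op_cmult: "jacobi_op A B l (\<lambda>Y. c * \<phi> Y) = (\<lambda>Y. c * jacobi_op A B l \<phi> Y)"
  by (rule ext) (simp add: jacobi_op_eq algebra_simps)

text \<open>Balls around the root. The n-th iterate of the operator at the root lives in
  \<open>lev n\<close>, so pairings with it are finite sums.\<close>

definition lev :: "nat \<Rightarrow> vertex set" where "lev n = {V. length V \<le> n}"

lemma finite_lev: "finite (lev n)"
proof -
  have "finite (UNIV :: idx set)" by (simp add: UNIV_idx)
  from finite_lists_length_le[OF this, of n] show ?thesis by (simp add: lev_def)
qed

lemma lev_0: "lev 0 = {[]}" by (auto simp: lev_def)

lemma sum_lev:
  fixes f :: "vertex \<Rightarrow> complex"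
  shows "(\<Sum>V\<in>lev (Suc n). f V) = f [] + (\<Sum>V\<in>lev n. f (I1 # V) + f (I2 # V))"
proof -
  have "lev (Suc n) = insert [] (Cons I1 ` lev n \<union> Cons I2 ` lev n)"
  proof (rule set_eqI)
    fix V show "V \<in> lev (Suc n) \<longleftrightarrow> V \<in> insert [] (Cons I1 ` lev n \<union> Cons I2 ` lev n)"
    proof (cases V)
      case (Cons j U) then show ?thesis by (cases j) (auto simp: lev_def)
    qed (auto simp: lev_def)
  qed
  moreover have "[] \<notin> Cons I1 ` lev n \<union> Cons I2 ` lev n" "Cons I1 ` lev n \<inter> Cons I2 ` lev n = {}" by auto
  ultimately show ?thesis using finite_lev[of n]
    by (simp add: sum.union_disjoint sum.reindex sum.distrib)
qed

text \<open>Summation by parts over the edges, without conjugation: the terms from children on one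
  side match those from parents on the other. Finite support of psi lets phi be arbitrary. The left
  sum runs one level further because the operator spreads psi by one edge.\<close>

lemma jacobi_symmetric:
  assumes supp: "\<And>V. V \<notin> lev n \<Longrightarrow> \<psi> V = 0"
  shows "(\<Sum>V\<in>lev (Suc n). \<phi> V * jacobi_op A B l \<psi> V) = (\<Sum>V\<in>lev n. jacobi_op A B l \<phi> V * \<psi> V)"
proof -
  let ?s = "\<lambda>j. complex_of_real (sqrt (A j))"
  let ?B = "\<lambda>V. complex_of_real (B (if V = [] then l else hd V))"
  let ?g = "\<lambda>V. if V = [] then 0 else \<phi> (tl V) * (?s (hd V) * \<psi> V)"
  have sub: "lev n \<subseteq> lev (Suc n)" "lev n \<subseteq> lev (Suc (Suc n))" by (auto simp: lev_def)
  have drop: "(\<Sum>V\<in>lev k. h V) = (\<Sum>V\<in>lev n. h V)"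
    if "lev n \<subseteq> lev k" "\<And>V. \<psi> V = 0 \<Longrightarrow> h V = 0" for k and h :: "vertex \<Rightarrow> complex"
    using that supp finite_lev by (intro sum.mono_neutral_right) auto
  have a: "(\<Sum>V\<in>lev (Suc n). \<phi> V * (?s I1 * \<psi> (I1 # V)) + \<phi> V * (?s I2 * \<psi> (I2 # V))) = (\<Sum>V\<in>lev n. ?g V)"
    using sum_lev[of ?g "Suc n"] drop[OF sub(2), of ?g] by simp
  have b: "(\<Sum>V\<in>lev (Suc n). if V = [] then 0 else \<phi> V * (?s (hd V) * \<psi> (tl V)))
     = (\<Sum>V\<in>lev n. \<phi> (I1 # V) * (?s I1 * \<psi> V) + \<phi> (I2 # V) * (?s I2 * \<psi> V))"
    using sum_lev[of "\<lambda>V. if V = [] then 0 else \<phi> V * (?s (hd V) * \<psi> (tl V))" n] by simp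
  have c: "(\<Sum>V\<in>lev (Suc n). \<phi> V * (?B V * \<psi> V)) = (\<Sum>V\<in>lev n. \<phi> V * (?B V * \<psi> V))"
    by (rule drop[OF sub(1)]) simp
  have "(\<Sum>V\<in>lev (Suc n). \<phi> V * jacobi_op A B l \<psi> V) =
    (\<Sum>V\<in>lev (Suc n). \<phi> V * (?s I1 * \<psi> (I1 # V)) + \<phi> V * (?s I2 * \<psi> (I2 # V)))
    + (\<Sum>V\<in>lev (Suc n). if V = [] then 0 else \<phi> V * (?s (hd V) * \<psi> (tl V)))
    + (\<Sum>V\<in>lev (Suc n). \<phi> V * (?B V * \<psi> V))"
    unfolding sum.distrib[symmetric] by (intro sum.cong refl) (simp add: jacobi_op_eq algebra_simps)
  also have "\<dots> = (\<Sum>V\<in>lev n. jacobi_op A B l \<phi> V * \<psi> V)"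
    unfolding a b c sum.distrib[symmetric] by (intro sum.cong refl) (simp add: jacobi_op_eq algebra_simps)
  finally show ?thesis .
qed

text \<open>Transport along W |-> W @ Z to the subtree at Z, extended by 0. When Z is a suffix of Y,
  the \<open>take\<close> recovers the W with Y = W @ Z.\<close>

definition sh :: "vertex \<Rightarrow> (vertex \<Rightarrow> complex) \<Rightarrow> vertex \<Rightarrow> complex" where
  "sh Z \<phi> Y = (if suffix Z Y then \<phi> (take (length Y - length Z) Y) else 0)"

lemma sh_append [simp]: "sh Z \<phi> (W @ Z) = \<phi> W"
  by (simp add: sh_def suffix_def)

lemma sh_outside: "\<not> suffix Z Y \<Longrightarrow> sh Z \<phi> Y = 0" by (simp add: sh_def)

lemma sh_Nil: "sh [] \<phi> = \<phi>" by (rule ext) (simp add: sh_def)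

lemma sh_eqI:
  assumes "\<And>W. \<eta> (W @ Z) = \<phi> W" "\<And>Y. \<not> suffix Z Y \<Longrightarrow> \<eta> Y = 0"
  shows "sh Z \<phi> = \<eta>"
proof
  fix Y show "sh Z \<phi> Y = \<eta> Y"
  proof (cases "suffix Z Y")
    case True
    then obtain W where "Y = W @ Z" by (auto simp: suffix_def)
    then show ?thesis using assms(1) by simp
  qed (simp add: sh_outside assms(2))
qed

lemma sh_sh: "sh Z (sh W \<phi>) = sh (W @ Z) \<phi>"
proof (rule sh_eqI)
  show "sh (W @ Z) \<phi> (U @ Z) = sh W \<phi> U" for U
    by (cases "suffix W U") (auto simp: sh_outside suffix_def)
  show "sh (W @ Z) \<phi> Y = 0" if "\<not> suffix Z Y" for Y
    using that by (intro sh_outside) (auto simp: suffix_def)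
qed

lemma sh_add: "sh Z (\<lambda>Y. \<phi> Y + \<psi> Y) = (\<lambda>Y. sh Z \<phi> Y + sh Z \<psi> Y)"
  and sh_cmult: "sh Z (\<lambda>Y. c * \<phi> Y) = (\<lambda>Y. c * sh Z \<phi> Y)"
  and sh_zero: "sh Z (\<lambda>Y. 0) = (\<lambda>Y. 0)"
  by (auto simp: sh_def)

lemma sh_delta: "sh Z (delta []) = delta Z"
  by (rule sh_eqI) (auto simp: delta_def)

lemma sh_l2: "\<phi> \<in> l2 \<Longrightarrow> sh Z \<phi> \<in> l2"
proof -
  assume "\<phi> \<in> l2"
  then have "(\<lambda>W. (cmod (\<phi> W))\<^sup>2) summable_on UNIV" by (simp add: l2_def)
  then have "((\<lambda>Y. (cmod (sh Z \<phi> Y))\<^sup>2) \<circ> (\<lambda>W. W @ Z)) summable_on UNIV" by (simp add: o_def)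
  then have "(\<lambda>Y. (cmod (sh Z \<phi> Y))\<^sup>2) summable_on range (\<lambda>W. W @ Z)"
    by (subst summable_on_reindex) (auto simp: inj_on_def)
  then have "(\<lambda>Y. (cmod (sh Z \<phi> Y))\<^sup>2) summable_on UNIV"
    by (rule summable_on_cong_neutral[THEN iffD1, rotated -1]) (auto simp: sh_def suffix_def)
  then show ?thesis by (simp add: l2_def)
qed

lemma sh_ip:
  assumes "\<phi> \<in> l2" "\<psi> \<in> l2"
  shows "ip cnt (sh Z \<phi>) (sh Z \<psi>) = ip cnt \<phi> \<psi>"
proof -
  have "ip cnt (sh Z \<phi>) (sh Z \<psi>) = (\<Sum>\<^sub>\<infinity>Y. sh Z \<phi> Y * cnj (sh Z \<psi> Y))"
    using l2_inner_ip[OF sh_l2[OF assms(1)] sh_l2[OF assms(2)], of Z Z] by (simp add: l2_inner_def)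
  also have "\<dots> = (\<Sum>\<^sub>\<infinity>Y\<in>range (\<lambda>W. W @ Z). sh Z \<phi> Y * cnj (sh Z \<psi> Y))"
    by (rule infsum_cong_neutral) (auto simp: sh_def suffix_def)
  also have "\<dots> = infsum ((\<lambda>Y. sh Z \<phi> Y * cnj (sh Z \<psi> Y)) \<circ> (\<lambda>W. W @ Z)) UNIV"
    by (rule infsum_reindex) (auto simp: inj_on_def)
  also have "\<dots> = ip cnt \<phi> \<psi>"
    using l2_inner_ip[OF assms] by (simp add: l2_inner_def o_def)
  finally show ?thesis .
qed

lemma sh_n2: "\<phi> \<in> l2 \<Longrightarrow> n2 (sh Z \<phi>) = n2 \<phi>"
proof -
  assume "\<phi> \<in> l2"
  then have "complex_of_real ((n2 (sh Z \<phi>))\<^sup>2) = complex_of_real ((n2 \<phi>)\<^sup>2)"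
    unfolding n2_ip[OF \<open>\<phi> \<in> l2\<close>] n2_ip[OF sh_l2[OF \<open>\<phi> \<in> l2\<close>]] by (simp add: sh_ip)
  then have "(n2 (sh Z \<phi>))\<^sup>2 = (n2 \<phi>)\<^sup>2" by (simp only: of_real_eq_iff)
  then show ?thesis using nrm_nonneg by (metis power2_eq_imp_eq)
qed

lemma sh_disjoint:
  assumes "\<not> suffix Z Z'" "\<not> suffix Z' Z"
  shows "ip cnt (sh Z \<phi>) (sh Z' \<psi>) = 0"
proof -
  have "sh Z \<phi> Y * cnj (sh Z' \<psi> Y) = 0" for Y
    using suffix_same_cases[of Z Y Z'] assms by (auto simp: sh_def)
  then show ?thesis unfolding ip_def by (simp only: Bochner_Integration.integral_zero)
qed

text \<open>The diagonal entry at the top of the subtree is \<open>B j\<close>, so inside it the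
  operator looks like the one with root type j. The sole leak is along the edge of type j to the
  parent Z.\<close>

lemma jacobi_sh:
  "jacobi_op A B l (sh (j # Z) \<phi>) =
   (\<lambda>Y. sh (j # Z) (jacobi_op A B j \<phi>) Y + (if Y = Z then of_real (sqrt (A j)) * \<phi> [] else 0))"
proof
  fix Y
  consider W where "Y = W @ j # Z" | "Y = Z" | "\<not> suffix (j # Z) Y" "Y \<noteq> Z"
    by (auto simp: suffix_def)
  then show "jacobi_op A B l (sh (j # Z) \<phi>) Y =
    sh (j # Z) (jacobi_op A B j \<phi>) Y + (if Y = Z then of_real (sqrt (A j)) * \<phi> [] else 0)"
  proof cases
    case 1
    have ne: "Y \<noteq> Z" using 1 by (metis append_self_conv2 append.assoc append_Cons append_Nil list.distinct(1) self_append_conv2)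
    have c: "sh (j # Z) \<phi> (i # Y) = \<phi> (i # W)" for i
      using sh_append[of "j # Z" \<phi> "i # W"] 1 by simp
    have p: "sh (j # Z) \<phi> (tl Y) = (if W = [] then 0 else \<phi> (tl W))"
    proof (cases W)
      case Nil
      have "\<not> suffix (j # Z) Z" by (auto dest: suffix_length_le)
      then show ?thesis using 1 Nil by (simp add: sh_outside)
    next
      case (Cons k U) then show ?thesis using 1 by simp
    qed
    have v: "sh (j # Z) \<eta> Y = \<eta> W" for \<eta> using 1 by simp
    have h: "hd Y = (if W = [] then j else hd W)" "Y \<noteq> []" using 1 by auto
    show ?thesis unfolding jacobi_op_eq[of A B l] c p v h(1) using ne h(2) by (simp add: jacobi_op_eq)
  next
    case 2
    have ns: "\<not> suffix (j # Z) Z" "\<not> suffix (j # Z) (tl Z)"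
      by (auto dest!: suffix_length_le)
    have c: "sh (j # Z) \<phi> (i # Z) = (if i = j then \<phi> [] else 0)" for i
      using sh_append[of "j # Z" \<phi> "[]"] ns(1) by (auto simp: sh_def suffix_Cons)
    show ?thesis using 2 ns unfolding jacobi_op_eq[of A B l] c 2 by (cases j) (auto simp: sh_outside)
  next
    case 3
    have "\<not> suffix (j # Z) (i # Y)" for i using 3 by (auto simp: suffix_Cons)
    moreover have "\<not> suffix (j # Z) (tl Y)" using 3 by (metis list.sel(2) suffix_tl suffix_order.trans)
    ultimately show ?thesis using 3 by (simp add: jacobi_op_eq[of A B l] sh_outside)
  qed
qed

lemma suffix_cases:
  assumes "suffix Z Z'" "Z \<noteq> Z'" obtains W i where "Z' = W @ i # Z"
proof -
  obtain V where V: "Z' = V @ Z" using assms(1) by (auto simp: suffix_def)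
  then have "V \<noteq> []" using assms(2) by auto
  then have "Z' = butlast V @ last V # Z" using V by (metis append_butlast_last_id append.assoc append_Cons append_Nil)
  then show ?thesis by (rule that)
qed

text \<open>What the decomposition requires of the weights. Together, \<open>psi_eigen\<close> and
  \<open>psi_moment\<close> express that \<open>kap i\<close> times M is the spectral measure of the
  root for root type i; the bounds on \<open>kap\<close> make the L^2 norms for both types
  comparable.\<close>

locale tree_model = compact_measure M R for M R +
  fixes A B :: "idx \<Rightarrow> real" and kap :: "idx \<Rightarrow> real \<Rightarrow> real" and psi :: "idx \<Rightarrow> vertex \<Rightarrow> real \<Rightarrow> real"
    and k0 k1 :: real
  assumes A_pos: "A i > 0"
    and kap_meas [measurable]: "kap i \<in> borel_measurable borel"
    and kap_bounds: "0 < k0" "k0 \<le> kap i x" "kap i x \<le> k1"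
    and psi_meas [measurable]: "psi i V \<in> borel_measurable borel"
    and psi_bounded: "\<exists>C. \<forall>x. \<bar>psi i V x\<bar> \<le> C"
    and psi_root: "psi i [] x = 1"
    and psi_eigen: "AE x in M. \<forall>i V. jacobi_op A B i (\<lambda>V. of_real (psi i V x)) V = of_real (x * psi i V x)"
    and psi_moment: "(\<integral>x. psi i V x * kap i x \<partial>M) = (if V = [] then 1 else 0)"
begin

section \<open>The spectral transform of the root\<close>

abbreviation "J l \<equiv> jacobi_op A B l"

text \<open>Superposition of generalized eigenfunctions. For f = \<open>kap i\<close> times a
  polynomial p it is p(J i) applied to the unit vector at the root, as \<open>U_pol\<close> shows; f
  itself ranges over L^2(M), without the factor \<open>kap i\<close>.\<close>

definition U :: "idx \<Rightarrow> (real \<Rightarrow> complex) \<Rightarrow> vertex \<Rightarrow> complex" where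
  "U i f V = (\<integral>x. f x * of_real (psi i V x) \<partial>M)"

lemma k1_pos: "0 < k1" using kap_bounds(1) kap_bounds(2,3)[of undefined undefined] by linarith

lemma kap_pos: "0 < kap i x" using kap_bounds(1,2) by (rule less_le_trans)

lemma psi_sq: "sqint M (\<lambda>x. of_real (psi i V x))"
proof -
  obtain C where "\<forall>x. \<bar>psi i V x\<bar> \<le> C" using psi_bounded by blast
  then show ?thesis by (intro sqint_bounded[OF fin, of _ C]) auto
qed

lemma U_integrable: "sqint M f \<Longrightarrow> integrable M (\<lambda>x. f x * of_real (psi i V x))"
  using sqint_prod(1)[OF _ psi_sq] by blast

lemma U_add: "sqint M f \<Longrightarrow> sqint M g \<Longrightarrow> U i (\<lambda>x. f x + g x) = (\<lambda>V. U i f V + U i g V)"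
  unfolding U_def distrib_right by (rule ext) (intro Bochner_Integration.integral_add U_integrable)

lemma U_cmult: "U i (\<lambda>x. c * f x) = (\<lambda>V. c * U i f V)"
  unfolding U_def mult.assoc by simp

lemma U_diff: "sqint M f \<Longrightarrow> sqint M g \<Longrightarrow> U i (\<lambda>x. f x - g x) = (\<lambda>V. U i f V - U i g V)"
  unfolding U_def left_diff_distrib by (rule ext) (intro Bochner_Integration.integral_diff U_integrable)

lemma U_root: "U i f [] = (\<integral>x. f x \<partial>M)" by (simp add: U_def psi_root)

lemma sq_x: "sqint M f \<Longrightarrow> sqint M (\<lambda>x. of_real x * f x)"
  by (rule sqint_AE_mult[of _ _ R]) (use supp in auto)

lemma sq_xn: "sqint M f \<Longrightarrow> sqint M (\<lambda>x. of_real x ^ n * f x)"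
proof (induction n)
  case (Suc n)
  from sq_x[OF Suc.IH[OF Suc.prems]] show ?case by (simp add: mult.assoc)
qed simp

lemma U_x: assumes f: "sqint M f" shows "U i (\<lambda>x. of_real x * f x) = J i (U i f)"
proof
  fix V
  have "U i (\<lambda>x. of_real x * f x) V = (\<integral>x. f x * J i (\<lambda>V. of_real (psi i V x)) V \<partial>M)"
    unfolding U_def
  proof (rule integral_cong_AE)
    note m = sqintD(1)[OF f, measurable]
    show "(\<lambda>x. of_real x * f x * of_real (psi i V x)) \<in> borel_measurable M" by measurable
    show "(\<lambda>x. f x * J i (\<lambda>V. of_real (psi i V x)) V) \<in> borel_measurable M"
      unfolding jacobi_op_eq by measurable
    show "AE x in M. of_real x * f x * of_real (psi i V x) = f x * J i (\<lambda>V. of_real (psi i V x)) V"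
      using psi_eigen by eventually_elim simp
  qed
  also have "\<dots> = J i (U i f) V"
    unfolding jacobi_op_eq U_def using U_integrable[OF f]
    by (cases V) (simp_all add: distrib_left mult.left_commute[of "f _"])
  finally show "U i (\<lambda>x. of_real x * f x) V = J i (U i f) V" .
qed

abbreviation "ck i \<equiv> \<lambda>x. complex_of_real (kap i x)"

lemma ck_bound: "cmod (ck i x) \<le> k1" using kap_pos[of i x] kap_bounds(3)[of i x] by simp

lemma sq_kap: "sqint M f \<Longrightarrow> sqint M (\<lambda>x. f x * ck i x)"
  using sqint_bounded_mult[of M f "ck i" k1] ck_bound by (simp add: mult.commute)

lemma sq_kap_inv: "sqint M f \<Longrightarrow> sqint M (\<lambda>x. f x / ck i x)"
proof -
  assume "sqint M f"
  moreover have "cmod (1 / ck i x) \<le> 1 / k0" for x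
    using kap_bounds(1) kap_bounds(2)[of i x] kap_pos[of i x] by (simp add: norm_divide frac_le)
  ultimately show ?thesis using sqint_bounded_mult[of M f "\<lambda>x. 1 / ck i x" "1 / k0"] by simp
qed

lemma dense_kap:
  assumes f: "sqint M f" and e: "\<epsilon> > 0"
  shows "\<exists>p. nrm M (\<lambda>x. f x - pol p x * ck i x) < \<epsilon>"
proof -
  have "\<epsilon> / k1 > 0" using e k1_pos by simp
  then obtain p where p: "nrm M (\<lambda>x. f x / ck i x - pol p x) < \<epsilon> / k1"
    using polynomials_dense[OF sq_kap_inv[OF f]] unfolding approx_def by blast
  have s: "sqint M (\<lambda>x. f x / ck i x - pol p x)" by (intro sqint_diff sq_kap_inv f sqint_pol)
  have eq: "f x - pol p x * ck i x = (f x / ck i x - pol p x) * ck i x" for x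
    using kap_pos[of i x] by (simp add: field_simps)
  have "nrm M (\<lambda>x. f x - pol p x * ck i x) \<le> k1 * nrm M (\<lambda>x. f x / ck i x - pol p x)"
    unfolding eq
  proof (rule nrm_mono[OF s])
    show "(\<lambda>x. (f x / ck i x - pol p x) * ck i x) \<in> borel_measurable M" by (rule sqintD(1)[OF sq_kap[OF s]])
    show "AE x in M. cmod ((f x / ck i x - pol p x) * ck i x) \<le> k1 * cmod (f x / ck i x - pol p x)"
      by (rule AE_I2) (simp only: norm_mult mult.commute[of k1], intro mult_left_mono ck_bound norm_ge_zero)
  qed (use k1_pos in simp)
  also have "\<dots> < \<epsilon>" using p k1_pos by (simp add: field_simps)
  finally show ?thesis by blast
qed

lemma sq_pk: "sqint M (\<lambda>x. pol p x * ck i x)" by (intro sq_kap sqint_pol)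

definition dn :: "idx \<Rightarrow> nat \<Rightarrow> vertex \<Rightarrow> complex" where "dn i n = (J i ^^ n) (delta [])"

lemma dn_simps: "dn i 0 = delta []" "dn i (Suc n) = J i (dn i n)" by (simp_all add: dn_def)

lemma sq_1: "sqint M (\<lambda>x. 1)" by (rule sqint_bounded[OF fin, of _ 1]) auto

lemma sq_ck: "sqint M (ck i)" using sq_kap[OF sq_1] by simp

lemma U_ck: "U i (ck i) = delta []"
proof
  fix V
  have "U i (ck i) V = (\<integral>x. complex_of_real (psi i V x * kap i x) \<partial>M)"
    unfolding U_def by (simp add: mult.commute)
  also have "\<dots> = of_real (\<integral>x. psi i V x * kap i x \<partial>M)" by (rule integral_complex_of_real)
  finally show "U i (ck i) V = delta [] V" by (simp add: psi_moment delta_def)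
qed

lemma dn_U: "dn i n = U i (\<lambda>x. of_real x ^ n * ck i x)"
proof (induction n)
  case 0 show ?case by (simp add: dn_simps U_ck)
next
  case (Suc n)
  show ?case unfolding dn_simps Suc U_x[OF sq_xn[OF sq_ck], symmetric] by (simp add: mult.assoc)
qed

lemma dn_support: "V \<notin> lev n \<Longrightarrow> dn i n V = 0"
proof (induction n arbitrary: V)
  case 0 then show ?case by (simp add: dn_simps lev_0 delta_def)
next
  case (Suc n)
  have "j # V \<notin> lev n" "V \<notin> lev n" "V \<noteq> [] \<and> tl V \<notin> lev n" for j using Suc.prems by (auto simp: lev_def)
  then show ?case unfolding dn_simps jacobi_op_eq using Suc.IH by simp
qed

lemma dn_real: "cnj (dn i n V) = dn i n V"
proof (induction n arbitrary: V)
  case 0 show ?case by (simp add: dn_simps delta_def)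
next
  case (Suc n) then show ?case by (simp add: dn_simps jacobi_op_eq)
qed

lemma dn_l2: "dn i n \<in> l2"
  by (rule l2_finite_support[OF finite_lev dn_support])

text \<open>Symmetry moves the n applications of J from the unit vector to \<open>F f\<close>, where
  they become multiplication by x^n, and what is left is the value at the root. F is kept general
  because both \<open>U i\<close> and \<open>Vop Z\<close> intertwine in this way.\<close>

lemma pairing:
  assumes F: "\<And>f. sqint M f \<Longrightarrow> J i (F f) = F (\<lambda>x. of_real x * f x)" and f: "sqint M f"
  shows "(\<Sum>V\<in>lev n. F f V * dn i n V) = F (\<lambda>x. of_real x ^ n * f x) []"
  using f
proof (induction n arbitrary: f)
  case 0 then show ?case by (simp add: lev_0 dn_simps delta_def)
next
  case (Suc n)
  have "(\<Sum>V\<in>lev (Suc n). F f V * dn i (Suc n) V) = (\<Sum>V\<in>lev n. J i (F f) V * dn i n V)"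
    unfolding dn_simps by (rule jacobi_symmetric) (rule dn_support)
  also have "\<dots> = F (\<lambda>x. of_real x ^ n * (of_real x * f x)) []"
    unfolding F[OF Suc.prems] by (rule Suc.IH[OF sq_x[OF Suc.prems]])
  finally show ?case by (simp add: mult_ac)
qed

lemma ip_dn:
  assumes F: "\<And>f. sqint M f \<Longrightarrow> J i (F f) = F (\<lambda>x. of_real x * f x)" and f: "sqint M f"
  shows "ip cnt (F f) (dn i n) = F (\<lambda>x. of_real x ^ n * f x) []"
  using ip_finite_support[of "lev n" "dn i n" "F f", OF finite_lev dn_support] pairing[of i F f n, OF assms] by (simp add: dn_real)

lemma U_pol: "U i (\<lambda>x. pol p x * ck i x) = (\<lambda>V. \<Sum>n\<le>degree p. coeff p n * dn i n V)"
proof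
  fix V
  have "U i (\<lambda>x. pol p x * ck i x) V = (\<integral>x. (\<Sum>n\<le>degree p. coeff p n * (of_real x ^ n * ck i x * of_real (psi i V x))) \<partial>M)"
    unfolding U_def pol_def poly_altdef by (simp add: sum_distrib_right mult.assoc)
  also have "\<dots> = (\<Sum>n\<le>degree p. coeff p n * dn i n V)"
    unfolding dn_U U_def
    by (subst Bochner_Integration.integral_sum) (auto intro!: U_integrable sq_xn sq_ck)
  finally show "U i (\<lambda>x. pol p x * ck i x) V = (\<Sum>n\<le>degree p. coeff p n * dn i n V)" .
qed

lemma U_pol_l2: "U i (\<lambda>x. pol p x * ck i x) \<in> l2"
proof (rule l2_finite_support[OF finite_lev])
  show "U i (\<lambda>x. pol p x * ck i x) V = 0" if "V \<notin> lev (degree p)" for V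
  proof -
    have "V \<notin> lev n" if "n \<le> degree p" for n using that \<open>V \<notin> lev (degree p)\<close> by (auto simp: lev_def)
    then show ?thesis unfolding U_pol by (intro sum.neutral) (simp add: dn_support)
  qed
qed

text \<open>Parseval for polynomials: expanding one factor in the vectors \<open>dn i n\<close>
  reduces the norm, by \<open>ip_dn\<close>, to values of transforms at the root, which are plain
  integrals because psi is 1 there.\<close>

lemma U_pol_norm:
  "(n2 (U i (\<lambda>x. pol p x * ck i x)))\<^sup>2 = (\<integral>x. (cmod (pol p x))\<^sup>2 * kap i x \<partial>M)"
proof -
  let ?g = "\<lambda>x. pol p x * ck i x"
  have "ip cnt (U i ?g) (U i ?g) = cnj (\<Sum>n\<le>degree p. coeff p n * ip cnt (dn i n) (U i ?g))"
  proof -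
    have "ip cnt (\<lambda>V. \<Sum>n\<in>T. c n * dn i n V) \<eta> = (\<Sum>n\<in>T. c n * ip cnt (dn i n) \<eta>)"
      if e: "\<eta> \<in> l2" "finite T" for T and c :: "nat \<Rightarrow> complex" and \<eta>
      using e(2)
    proof (induction T rule: finite_induct)
      case empty show ?case by (simp add: ip_def)
    next
      case (insert n T)
      have "(\<lambda>V. \<Sum>n\<in>T. c n * dn i n V) \<in> l2"
        by (intro subsp_sum[OF subsp_l2 insert(1)] l2_cmult dn_l2)
      from ip_add[OF l2_cmult[OF dn_l2] this e(1), of "c n" i n] show ?case using insert by (simp add: ip_cmult)
    qed
    from this[OF U_pol_l2[of i p] finite_atMost, of "coeff p" "degree p"]
    show ?thesis unfolding U_pol[symmetric] using ip_cnj[of "U i ?g" "U i ?g"] by simp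
  qed
  also have "\<dots> = (\<Sum>n\<le>degree p. cnj (coeff p n) * ip cnt (U i ?g) (dn i n))"
    by (simp add: ip_cnj[of "dn i _"])
  also have "\<dots> = (\<Sum>n\<le>degree p. cnj (coeff p n) * (\<integral>x. of_real x ^ n * ?g x \<partial>M))"
    using ip_dn[of i "U i" ?g, OF U_x[symmetric] sq_pk] by (simp add: U_root)
  also have "\<dots> = (\<integral>x. (\<Sum>n\<le>degree p. cnj (coeff p n) * (of_real x ^ n * ?g x)) \<partial>M)"
  proof -
    have "integrable M (\<lambda>x. of_real x ^ n * ?g x)" for n
      using sqint_prod(1)[OF sq_xn[OF sq_pk] sq_1] by simp
    then show ?thesis by (subst Bochner_Integration.integral_sum) auto
  qed
  also have "\<dots> = (\<integral>x. complex_of_real ((cmod (pol p x))\<^sup>2 * kap i x) \<partial>M)"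
  proof (rule Bochner_Integration.integral_cong[OF refl])
    fix x
    have "(\<Sum>n\<le>degree p. cnj (coeff p n) * (of_real x ^ n * ?g x)) = cnj (pol p x) * ?g x"
      unfolding pol_def poly_altdef by (simp add: sum_distrib_right mult.assoc)
    then show "(\<Sum>n\<le>degree p. cnj (coeff p n) * (of_real x ^ n * ?g x)) = complex_of_real ((cmod (pol p x))\<^sup>2 * kap i x)"
      by (simp add: complex_norm_square mult_ac del: of_real_power)
  qed
  also have "\<dots> = complex_of_real (\<integral>x. (cmod (pol p x))\<^sup>2 * kap i x \<partial>M)"
    by (rule integral_complex_of_real)
  finally show ?thesis unfolding n2_ip[OF U_pol_l2, symmetric] by (simp only: of_real_eq_iff)
qed

lemma U_pol_bounds:
  "n2 (U i (\<lambda>x. pol p x * ck i x)) \<le> sqrt (1 / k0) * nrm M (\<lambda>x. pol p x * ck i x)"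
  "nrm M (\<lambda>x. pol p x * ck i x) \<le> sqrt k1 * n2 (U i (\<lambda>x. pol p x * ck i x))"
proof -
  let ?g = "\<lambda>x. pol p x * ck i x"
  have gi: "integrable M (\<lambda>x. (cmod (?g x))\<^sup>2)" using sq_pk by (rule sqintD)
  \<comment> \<open>In terms of g = p times \<open>kap i\<close>, the Parseval weight is |g|^2 /
    kap; bounding kap by k0 and k1 gives the two constants.\<close>
  have eq: "(cmod (pol p x))\<^sup>2 * kap i x = (cmod (?g x))\<^sup>2 / kap i x" for x
    using kap_pos[of i x] by (simp add: norm_mult power_mult_distrib power2_eq_square)
  have le1: "(cmod (pol p x))\<^sup>2 * kap i x \<le> 1 / k0 * (cmod (?g x))\<^sup>2" for x
    unfolding eq using kap_bounds(1) kap_bounds(2)[of i x] by (simp add: frac_le)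
  have le2: "(cmod (?g x))\<^sup>2 \<le> k1 * ((cmod (pol p x))\<^sup>2 * kap i x)" for x
    unfolding eq using kap_pos[of i x] kap_bounds(3)[of i x] by (simp add: field_simps mult_right_mono)
  have i2: "integrable M (\<lambda>x. (cmod (pol p x))\<^sup>2 * kap i x)"
    by (rule Bochner_Integration.integrable_bound[OF integrable_mult_right[OF gi, of "1 / k0"]])
      (use le1 kap_pos[THEN less_imp_le] kap_bounds(1) in \<open>auto simp: abs_mult intro!: AE_I2\<close>)
  have "(n2 (U i ?g))\<^sup>2 \<le> (\<integral>x. 1 / k0 * (cmod (?g x))\<^sup>2 \<partial>M)"
    unfolding U_pol_norm by (rule integral_mono[OF i2 integrable_mult_right[OF gi]]) (rule le1)
  also have "\<dots> = (sqrt (1 / k0) * nrm M ?g)\<^sup>2"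
    using kap_bounds(1) by (simp add: power_mult_distrib nrm_sq)
  finally show "n2 (U i ?g) \<le> sqrt (1 / k0) * nrm M ?g"
    by (rule power2_le_imp_le) (intro mult_nonneg_nonneg nrm_nonneg, use kap_bounds(1) in simp)
  have "(nrm M ?g)\<^sup>2 \<le> (\<integral>x. k1 * ((cmod (pol p x))\<^sup>2 * kap i x) \<partial>M)"
    unfolding nrm_sq by (rule integral_mono[OF gi integrable_mult_right[OF i2]]) (rule le2)
  also have "\<dots> = (sqrt k1 * n2 (U i ?g))\<^sup>2"
    using k1_pos by (simp add: power_mult_distrib U_pol_norm)
  finally show "nrm M ?g \<le> sqrt k1 * n2 (U i ?g)"
    by (rule power2_le_imp_le) (intro mult_nonneg_nonneg nrm_nonneg, use k1_pos in simp)
qed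

text \<open>Extension from the dense set of polynomial multiples of \<open>kap i\<close>. The
  transforms of the approximants are Cauchy in the sequence space and converge pointwise to
  \<open>U i f\<close> by Cauchy-Schwarz, so Fatou identifies the limit.\<close>

lemma U_bounds:
  assumes f: "sqint M f"
  shows "U i f \<in> l2" "n2 (U i f) \<le> sqrt (1 / k0) * nrm M f" "nrm M f \<le> sqrt k1 * n2 (U i f)"
proof -
  have "\<exists>p. nrm M (\<lambda>x. f x - pol p x * ck i x) < inverse (real (Suc n))" for n
    by (rule dense_kap[OF f]) simp
  then obtain p where p: "\<And>n. nrm M (\<lambda>x. f x - pol (p n) x * ck i x) < inverse (real (Suc n))" by metis
  let ?g = "\<lambda>n x. pol (p n) x * ck i x"
  have lim: "(\<lambda>n. nrm M (\<lambda>x. f x - ?g n x)) \<longlonglongrightarrow> 0"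
  proof (rule tendsto_sandwich[OF _ _ tendsto_const LIMSEQ_inverse_real_of_nat])
    show "\<forall>\<^sub>F n in sequentially. nrm M (\<lambda>x. f x - ?g n x) \<le> inverse (real (Suc n))"
      by (rule always_eventually) (intro allI less_imp_le p)
  qed (simp add: nrm_nonneg)
  have pt: "(\<lambda>n. U i (?g n) V) \<longlonglongrightarrow> U i f V" for V
  proof -
    have "(\<lambda>n. nrm M (\<lambda>x. f x - ?g n x) * nrm M (\<lambda>x. of_real (psi i V x))) \<longlonglongrightarrow> 0"
      using tendsto_mult_left_zero[OF lim] .
    then have "(\<lambda>n. U i f V - U i (?g n) V) \<longlonglongrightarrow> 0"
    proof (rule Lim_null_comparison[OF always_eventually, rotated], intro allI)
      fix n
      have "U i f V - U i (?g n) V = (\<integral>x. (f x - ?g n x) * of_real (psi i V x) \<partial>M)"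
        using U_diff[OF f sq_pk, THEN fun_cong, of i "p n" i V] by (simp add: U_def)
      then show "norm (U i f V - U i (?g n) V) \<le> nrm M (\<lambda>x. f x - ?g n x) * nrm M (\<lambda>x. of_real (psi i V x))"
        using cauchy_schwarz(2)[OF sqint_diff[OF f sq_pk] psi_sq] by simp
    qed
    from tendsto_diff[OF tendsto_const[of "U i f V"] this] show ?thesis by simp
  qed
  have gd: "U i (\<lambda>x. pol (p m - p n) x * ck i x) = (\<lambda>V. U i (?g m) V - U i (?g n) V)" for m n
    using U_diff[OF sq_pk sq_pk, of i "p m" i "p n" i] by (simp add: pol_simps left_diff_distrib)
  have cau: "\<exists>N. \<forall>m\<ge>N. \<forall>n\<ge>N. n2 (\<lambda>V. U i (?g m) V - U i (?g n) V) \<le> \<epsilon>" if e: "\<epsilon> > 0" for \<epsilon>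
  proof -
    define s where "s = sqrt (1 / k0)"
    have s: "s > 0" using kap_bounds(1) by (simp add: s_def)
    have "\<epsilon> / (2 * s) > 0" using e s by simp
    then obtain N where N: "\<And>n. n \<ge> N \<Longrightarrow> nrm M (\<lambda>x. f x - ?g n x) < \<epsilon> / (2 * s)"
      using order_tendstoD(2)[OF lim] by (force simp: eventually_sequentially)
    have "n2 (\<lambda>V. U i (?g m) V - U i (?g n) V) \<le> \<epsilon>" if mn: "m \<ge> N" "n \<ge> N" for m n
    proof -
      have "n2 (\<lambda>V. U i (?g m) V - U i (?g n) V) \<le> s * nrm M (\<lambda>x. ?g m x - ?g n x)"
        using U_pol_bounds(1)[of i "p m - p n"] unfolding gd s_def by (simp add: pol_simps left_diff_distrib)
      also have "nrm M (\<lambda>x. ?g m x - ?g n x) \<le> nrm M (\<lambda>x. ?g m x - f x) + nrm M (\<lambda>x. f x - ?g n x)"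
        by (rule nrm_triangle_diff[OF sq_pk f sq_pk])
      also have "\<dots> \<le> \<epsilon> / (2 * s) + \<epsilon> / (2 * s)"
        using N[OF mn(1)] N[OF mn(2)] nrm_minus[of M "?g m" f] by (intro add_mono) auto
      also have "s * (\<epsilon> / (2 * s) + \<epsilon> / (2 * s)) = \<epsilon>" using s by (simp add: field_simps)
      finally show ?thesis using s by simp
    qed
    then show ?thesis by blast
  qed
  have F: "sqint cnt (U i f)" "(\<lambda>n. n2 (\<lambda>V. U i f V - U i (?g n) V)) \<longlonglongrightarrow> 0"
    using sqint_fatou[of cnt "\<lambda>n. U i (?g n)" "U i f"] U_pol_l2 cau pt by (auto simp: l2_sqint)
  show "U i f \<in> l2" using F by (simp add: l2_sqint)
  have l1: "(\<lambda>n. n2 (U i (?g n))) \<longlonglongrightarrow> n2 (U i f)"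
    by (rule nrm_tendsto[OF F(1) _ F(2)]) (use U_pol_l2 in \<open>simp add: l2_sqint\<close>)
  have l2: "(\<lambda>n. nrm M (?g n)) \<longlonglongrightarrow> nrm M f"
    by (rule nrm_tendsto[OF f sq_pk lim])
  show "n2 (U i f) \<le> sqrt (1 / k0) * nrm M f"
    by (rule LIMSEQ_le[OF l1 tendsto_mult_left[OF l2]]) (use U_pol_bounds(1) in blast)
  show "nrm M f \<le> sqrt k1 * n2 (U i f)"
    by (rule LIMSEQ_le[OF l2 tendsto_mult_left[OF l1]]) (use U_pol_bounds(2) in blast)
qed

lemma U_range:
  "closed_subspace {U i f |f. sqint M f}" "cyclic_subspace (J i) (delta []) = {U i f |f. sqint M f}"
proof -
  have pos: "0 < sqrt (1 / k0)" "0 < sqrt k1" using kap_bounds(1) k1_pos by auto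
  note R = isometric_range[of "U i", OF U_add U_cmult U_bounds(1) U_bounds(2) pos(1) U_bounds(3) pos(2) dense_kap sq_pk]
  show "closed_subspace {U i f |f. sqint M f}" by (rule R(1))
  show "cyclic_subspace (J i) (delta []) = {U i f |f. sqint M f}"
    using R(2) unfolding cyclic_subspace_def dn_def[symmetric] dn_U .
qed

section \<open>The spaces attached to the vertices and their orthogonality\<close>

definition sg :: "idx \<Rightarrow> real" where "sg j = (if j = I1 then - (1 / sqrt (A j)) else 1 / sqrt (A j))"

definition pr :: "vertex \<Rightarrow> (real \<Rightarrow> complex) \<Rightarrow> idx \<Rightarrow> vertex \<Rightarrow> complex" where
  "pr Z f j = sh (j # Z) (\<lambda>V. of_real (sg j) * U j f V)"

text \<open>The integral of f against \<open>Psi_hat\<close> at Z, as the final identification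
  shows. The two summands live in the disjoint subtrees of the children of Z.\<close>

definition Vop :: "vertex \<Rightarrow> (real \<Rightarrow> complex) \<Rightarrow> vertex \<Rightarrow> complex" where
  "Vop Z f Y = pr Z f I1 Y + pr Z f I2 Y"

lemma Vop_fun: "Vop Z f = (\<lambda>Y. pr Z f I1 Y + pr Z f I2 Y)" by (rule ext) (rule Vop_def)

lemma sg_nz: "sg j \<noteq> 0" using A_pos[of j] by (auto simp: sg_def)

lemma pr_l2: "sqint M f \<Longrightarrow> pr Z f j \<in> l2"
  unfolding pr_def by (intro sh_l2 l2_cmult U_bounds(1))

lemma Vop_l2: "sqint M f \<Longrightarrow> Vop Z f \<in> l2"
  unfolding Vop_fun by (intro l2_add pr_l2)

lemma pr_add: "sqint M f \<Longrightarrow> sqint M g \<Longrightarrow> pr Z (\<lambda>x. f x + g x) j = (\<lambda>Y. pr Z f j Y + pr Z g j Y)"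
  unfolding pr_def U_add distrib_left sh_add ..

lemma pr_cmult: "pr Z (\<lambda>x. c * f x) j = (\<lambda>Y. c * pr Z f j Y)"
  unfolding pr_def U_cmult mult.left_commute[of _ c] sh_cmult ..

lemma Vop_add: "sqint M f \<Longrightarrow> sqint M g \<Longrightarrow> Vop Z (\<lambda>x. f x + g x) = (\<lambda>Y. Vop Z f Y + Vop Z g Y)"
  by (rule ext) (simp add: Vop_def pr_add)

lemma Vop_cmult: "Vop Z (\<lambda>x. c * f x) = (\<lambda>Y. c * Vop Z f Y)"
  by (rule ext) (simp add: Vop_def pr_cmult distrib_left)

lemma pr_n2: "sqint M f \<Longrightarrow> n2 (pr Z f j) = \<bar>sg j\<bar> * n2 (U j f)"
  unfolding pr_def by (simp add: sh_n2 l2_cmult U_bounds(1) nrm_cmult)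

lemma pr_orth: "i \<noteq> j \<Longrightarrow> ip cnt (pr Z f i) (pr Z g j) = 0"
  unfolding pr_def by (rule sh_disjoint) (auto simp: suffix_Cons dest: suffix_length_le)

lemma Vop_norm:
  assumes "sqint M f"
  shows "(n2 (Vop Z f))\<^sup>2 = (n2 (pr Z f I1))\<^sup>2 + (n2 (pr Z f I2))\<^sup>2"
  unfolding Vop_fun by (rule pythagoras) (use assms pr_l2 pr_orth in auto)

text \<open>By \<open>jacobi_sh\<close> the child subtree of type j sends
  \<open>sqrt (A j) * sg j\<close> times the integral of f to Z. The two coefficients are -1 and 1
  and cancel, so the operator acts as multiplication by x for every root type l.\<close>

lemma J_Vop: assumes f: "sqint M f" shows "J l (Vop Z f) = Vop Z (\<lambda>x. of_real x * f x)"
proof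
  fix Y
  have e: "J l (pr Z f j) Y = pr Z (\<lambda>x. of_real x * f x) j Y + (if Y = Z then of_real (sqrt (A j) * sg j) * (\<integral>x. f x \<partial>M) else 0)" for j
    unfolding pr_def jacobi_sh jacobi_op_cmult U_x[OF f] by (simp add: U_root)
  have "sqrt (A I1) * sg I1 = -1" "sqrt (A I2) * sg I2 = 1" using A_pos[of I1] A_pos[of I2] by (auto simp: sg_def)
  then show "J l (Vop Z f) Y = Vop Z (\<lambda>x. of_real x * f x) Y"
    unfolding Vop_fun jacobi_op_add e by simp
qed

lemma Vop_range:
  "closed_subspace {Vop Z f |f. sqint M f}"
  "cyclic_subspace (J l) (Vop Z (\<lambda>x. 1)) = {Vop Z f |f. sqint M f}"
proof -
  let ?s = "sqrt (1 / k0)"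
  have s: "?s > 0" using kap_bounds(1) by simp
  let ?C = "(\<bar>sg I1\<bar> + \<bar>sg I2\<bar>) * ?s"
  have C: "?C > 0" using s sg_nz[of I1] by (intro mult_pos_pos) auto
  have up: "n2 (Vop Z f) \<le> ?C * nrm M f" if f: "sqint M f" for f
  proof -
    have "n2 (Vop Z f) \<le> n2 (pr Z f I1) + n2 (pr Z f I2)"
      unfolding Vop_fun by (rule nrm_triangle) (use pr_l2[OF f] in \<open>auto simp: l2_sqint\<close>)
    also have "\<dots> \<le> \<bar>sg I1\<bar> * (?s * nrm M f) + \<bar>sg I2\<bar> * (?s * nrm M f)"
      unfolding pr_n2[OF f] by (intro add_mono mult_left_mono U_bounds(2)[OF f]) auto
    finally show ?thesis by (simp add: algebra_simps)
  qed
  \<comment> \<open>The first child component alone already controls f from below.\<close>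
  let ?D = "sqrt k1 / \<bar>sg I1\<bar>"
  have D: "?D > 0" using k1_pos sg_nz[of I1] by simp
  have low: "nrm M f \<le> ?D * n2 (Vop Z f)" if f: "sqint M f" for f
  proof -
    have "(n2 (pr Z f I1))\<^sup>2 \<le> (n2 (Vop Z f))\<^sup>2" unfolding Vop_norm[OF f] by simp
    then have "n2 (pr Z f I1) \<le> n2 (Vop Z f)" by (rule power2_le_imp_le) (rule nrm_nonneg)
    then have "n2 (U I1 f) \<le> n2 (Vop Z f) / \<bar>sg I1\<bar>"
      unfolding pr_n2[OF f] using sg_nz[of I1] by (simp add: field_simps)
    then have "sqrt k1 * n2 (U I1 f) \<le> sqrt k1 * (n2 (Vop Z f) / \<bar>sg I1\<bar>)"
      using k1_pos by (intro mult_left_mono) auto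
    then show ?thesis using U_bounds(3)[OF f, of I1] by simp
  qed
  have dense: "\<exists>p. nrm M (\<lambda>x. f x - pol p x * 1) < \<epsilon>" if "sqint M f" "\<epsilon> > 0" for f \<epsilon>
    using polynomials_dense[OF that(1)] that(2) by (simp add: approx_def)
  have sq: "sqint M (\<lambda>x. pol p x * 1)" for p using sqint_pol by simp
  note R = isometric_range[of "Vop Z", OF Vop_add Vop_cmult Vop_l2 up C low D dense sq]
  show "closed_subspace {Vop Z f |f. sqint M f}" by (rule R(1))
  have "(J l ^^ n) (Vop Z (\<lambda>x. 1)) = Vop Z (\<lambda>x. of_real x ^ n * 1)" for n
  proof (induction n)
    case (Suc n)
    show ?case using J_Vop[OF sq_xn[OF sq_1, of n], of l Z] by (simp add: Suc)
  qed simp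
  then have "(\<lambda>n. (J l ^^ n) (Vop Z (\<lambda>x. 1))) = (\<lambda>n. Vop Z (\<lambda>x. of_real x ^ n * 1))" by (rule ext)
  then show "cyclic_subspace (J l) (Vop Z (\<lambda>x. 1)) = {Vop Z f |f. sqint M f}"
    unfolding cyclic_subspace_def by (simp only: R(2))
qed

text \<open>Pairing with the n-th iterate of the root vector gives the root value of
  \<open>Vop Z\<close> applied to x^n f. This is 0, since \<open>Vop Z\<close> is supported strictly
  below Z; the closure then covers all of the cyclic subspace.\<close>

lemma Vop_orth_U:
  assumes f: "sqint M f" and g: "sqint M g"
  shows "ip cnt (U i g) (Vop Z f) = 0"
proof (rule orthogonal_closure[OF _ Vop_l2[OF f]])
  show "range (dn i) \<subseteq> l2" using dn_l2 by auto
  show "ip cnt \<phi> (Vop Z f) = 0" if "\<phi> \<in> range (dn i)" for \<phi>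
  proof -
    from that obtain n where n: "\<phi> = dn i n" by blast
    have "ip cnt (Vop Z f) (dn i n) = Vop Z (\<lambda>x. of_real x ^ n * f x) []"
      by (rule ip_dn[of i "Vop Z", OF J_Vop f])
    also have "\<dots> = 0" by (simp add: Vop_def pr_def sh_outside)
    finally show ?thesis unfolding n using ip_cnj[of "dn i n" "Vop Z f"] by simp
  qed
  show "U i g \<in> l2_closure (lin_span (range (dn i)))"
    using U_range(2)[of i] g unfolding cyclic_subspace_def dn_def[abs_def] by blast
qed

lemma Vop_append: "Vop (W @ Z) f = sh Z (Vop W f)"
  unfolding Vop_fun sh_add pr_def sh_sh by simp

text \<open>Seen inside the child subtree of type i, \<open>Vop Z g\<close> is a multiple of
  \<open>U i g\<close>, an element of the cyclic subspace of the top, and the lower vector is some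
  \<open>Vop W f\<close>. So orthogonality to the root's cyclic subspace applies there.\<close>

lemma Vop_orth_below:
  assumes f: "sqint M f" and g: "sqint M g"
  shows "ip cnt (Vop Z g) (Vop (W @ i # Z) f) = 0"
proof -
  have "ip cnt (pr Z g j) (sh (i # Z) (Vop W f)) = 0" for j
  proof (cases "j = i")
    case True
    have "ip cnt (pr Z g j) (sh (i # Z) (Vop W f)) = ip cnt (\<lambda>V. of_real (sg j) * U j g V) (Vop W f)"
      unfolding pr_def True by (rule sh_ip) (use f g in \<open>auto intro!: l2_cmult U_bounds(1) Vop_l2\<close>)
    then show ?thesis using Vop_orth_U[OF f g] by (simp add: ip_cmult)
  next
    case False
    then show ?thesis unfolding pr_def
      by (intro sh_disjoint) (auto simp: suffix_Cons dest: suffix_length_le)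
  qed
  then show ?thesis unfolding Vop_append
    unfolding Vop_fun[of Z] using ip_add[OF pr_l2[OF g] pr_l2[OF g] sh_l2[OF Vop_l2[OF f]]] by simp
qed

lemma Vop_orth:
  assumes f: "sqint M f" and g: "sqint M g" and ne: "Z \<noteq> Z'"
  shows "ip cnt (Vop Z f) (Vop Z' g) = 0"
proof -
  consider "suffix Z Z'" | "suffix Z' Z" | "\<not> suffix Z Z'" "\<not> suffix Z' Z" by blast
  then show ?thesis
  proof cases
    case 1
    then obtain W i where "Z' = W @ i # Z" using suffix_cases ne by metis
    then show ?thesis using Vop_orth_below[OF g f] by simp
  next
    case 2
    then obtain W i where "Z = W @ i # Z'" using suffix_cases ne by metis
    then show ?thesis using Vop_orth_below[OF f g] ip_cnj[of "Vop Z f"] by simp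
  next
    case 3
    have "ip cnt (sh Z (Vop [] f)) (sh Z' (Vop [] g)) = 0" by (rule sh_disjoint) (use 3 in auto)
    then show ?thesis using Vop_append[of "[]" Z f] Vop_append[of "[]" Z' g] by simp
  qed
qed

text \<open>The vectors \<open>Qop u\<close> are the elements of the cyclic subspace of the root that vanish at the root.\<close>

definition Qop :: "(real \<Rightarrow> complex) \<Rightarrow> vertex \<Rightarrow> complex" where
  "Qop u Y = sh [I1] (\<lambda>V. of_real (sqrt (A I1)) * U I1 (\<lambda>x. u x * ck I1 x) V) Y
           + sh [I2] (\<lambda>V. of_real (sqrt (A I2)) * U I2 (\<lambda>x. u x * ck I2 x) V) Y"

lemma Qop_l2: "sqint M u \<Longrightarrow> Qop u \<in> l2"
  unfolding Qop_def[abs_def] by (intro l2_add sh_l2 l2_cmult U_bounds(1) sq_kap)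

lemma Qop_add: "sqint M f \<Longrightarrow> sqint M g \<Longrightarrow> Qop (\<lambda>x. f x + g x) = (\<lambda>Y. Qop f Y + Qop g Y)"
  using sq_kap by (intro ext) (simp add: Qop_def distrib_right U_add distrib_left sh_add)

lemma Qop_cmult: "Qop (\<lambda>x. c * f x) = (\<lambda>Y. c * Qop f Y)"
  by (rule ext) (simp add: Qop_def mult.assoc U_cmult mult.left_commute[of _ c] sh_cmult distrib_left)

lemma Qop_bound: "\<exists>C>0. \<forall>u. sqint M u \<longrightarrow> n2 (Qop u) \<le> C * nrm M u"
proof -
  let ?s = "sqrt (1 / k0)"
  have s: "?s > 0" using kap_bounds(1) by simp
  have nk: "nrm M (\<lambda>x. u x * ck j x) \<le> k1 * nrm M u" if u: "sqint M u" for u j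
  proof (rule nrm_mono[OF u sqintD(1)[OF sq_kap[OF u]]])
    show "AE x in M. cmod (u x * ck j x) \<le> k1 * cmod (u x)"
      by (rule AE_I2) (simp only: norm_mult mult.commute[of k1], intro mult_left_mono ck_bound norm_ge_zero)
  qed (use k1_pos in simp)
  have n: "n2 (sh [j] (\<lambda>V. of_real (sqrt (A j)) * U j (\<lambda>x. u x * ck j x) V)) \<le> sqrt (A j) * (?s * (k1 * nrm M u))"
    if u: "sqint M u" for u j
  proof -
    have "n2 (sh [j] (\<lambda>V. of_real (sqrt (A j)) * U j (\<lambda>x. u x * ck j x) V)) = sqrt (A j) * n2 (U j (\<lambda>x. u x * ck j x))"
      using A_pos[of j] by (simp add: sh_n2 l2_cmult U_bounds(1) sq_kap u nrm_cmult)
    also have "\<dots> \<le> sqrt (A j) * (?s * nrm M (\<lambda>x. u x * ck j x))"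
      using A_pos[of j] by (intro mult_left_mono U_bounds(2) sq_kap u) simp
    also have "\<dots> \<le> sqrt (A j) * (?s * (k1 * nrm M u))"
      using A_pos[of j] s by (intro mult_left_mono nk u) auto
    finally show ?thesis .
  qed
  show ?thesis
  proof (intro exI[of _ "(sqrt (A I1) + sqrt (A I2)) * ?s * k1"] conjI allI impI)
    show "(sqrt (A I1) + sqrt (A I2)) * ?s * k1 > 0"
      using s k1_pos A_pos[of I1] A_pos[of I2] by (intro mult_pos_pos add_pos_pos) auto
    fix u assume u: "sqint M u"
    have "n2 (Qop u) \<le> n2 (sh [I1] (\<lambda>V. of_real (sqrt (A I1)) * U I1 (\<lambda>x. u x * ck I1 x) V))
      + n2 (sh [I2] (\<lambda>V. of_real (sqrt (A I2)) * U I2 (\<lambda>x. u x * ck I2 x) V))"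
      unfolding Qop_def[abs_def] by (rule nrm_triangle) (auto simp: l2_sqint[symmetric] intro!: sh_l2 l2_cmult U_bounds(1) sq_kap u)
    then show "n2 (Qop u) \<le> (sqrt (A I1) + sqrt (A I2)) * ?s * k1 * nrm M u"
      using n[OF u, of I1] n[OF u, of I2] by (simp add: algebra_simps)
  qed
qed

text \<open>Inside the two subtrees the operator multiplies u by x; the edges to the root no longer
  cancel and leave a multiple of the unit vector there.\<close>

lemma J_Qop:
  assumes u: "sqint M u"
  shows "\<exists>c. J l (Qop u) = (\<lambda>Y. Qop (\<lambda>x. of_real x * u x) Y + c * delta [] Y)"
proof -
  let ?c = "\<lambda>j. complex_of_real (sqrt (A j)) * (of_real (sqrt (A j)) * U j (\<lambda>x. u x * ck j x) [])"
  have e: "J l (sh [j] (\<lambda>V. of_real (sqrt (A j)) * U j (\<lambda>x. u x * ck j x) V)) =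
    (\<lambda>Y. sh [j] (\<lambda>V. of_real (sqrt (A j)) * U j (\<lambda>x. of_real x * u x * ck j x) V) Y + ?c j * delta [] Y)" for j
    unfolding jacobi_sh jacobi_op_cmult U_x[OF sq_kap[OF u], symmetric] mult.assoc by (auto simp: delta_def)
  show ?thesis
    by (rule exI[of _ "?c I1 + ?c I2"]) (auto simp: Qop_def[abs_def] jacobi_op_add e algebra_simps)
qed

text \<open>\<open>Qop\<close> of 1 is what the operator makes of the root vector, minus its
  component at the root. \<open>J_Qop\<close> then raises the power of x within the cyclic subspace,
  and boundedness of \<open>Qop\<close> with density of polynomials gives all u.\<close>

lemma Qop_in_range: assumes u: "sqint M u" shows "Qop u \<in> {U l f |f. sqint M f}"
proof -
  let ?E = "{U l f |f. sqint M f}"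
  note E = closed_subspaceD[OF U_range(1)[of l]]
  have d: "delta [] \<in> ?E" using U_ck[of l] sq_ck by (metis (mono_tags, lifting) mem_Collect_eq)
  have Jst: "J l \<phi> \<in> ?E" if "\<phi> \<in> ?E" for \<phi>
  proof -
    from that obtain f where "\<phi> = U l f" "sqint M f" by blast
    then show ?thesis using U_x sq_x by (metis (mono_tags, lifting) mem_Collect_eq)
  qed
  have mon: "Qop (\<lambda>x. of_real x ^ n) \<in> ?E" for n
  proof (induction n)
    case 0
    have "Qop (\<lambda>x. 1) = (\<lambda>Y. J l (delta []) Y - of_real (B l) * delta [] Y)"
    proof
      fix Y
      have "Qop (\<lambda>x. 1) Y = of_real (sqrt (A I1)) * delta [I1] Y + of_real (sqrt (A I2)) * delta [I2] Y"
        by (simp add: Qop_def U_ck sh_cmult sh_delta)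
      also have "\<dots> = J l (delta []) Y - of_real (B l) * delta [] Y"
        by (cases Y) (auto simp: jacobi_op_eq delta_def, (metis idx.exhaust)?)
      finally show "Qop (\<lambda>x. 1) Y = J l (delta []) Y - of_real (B l) * delta [] Y" .
    qed
    then show ?case using subspD(4)[OF E(1) Jst[OF d] subspD(3)[OF E(1) d]] by simp
  next
    case (Suc n)
    have s: "sqint M (\<lambda>x. of_real x ^ n)" using sq_xn[OF sq_1, of n] by simp
    obtain c where c: "J l (Qop (\<lambda>x. of_real x ^ n)) = (\<lambda>Y. Qop (\<lambda>x. of_real x * of_real x ^ n) Y + c * delta [] Y)"
      using J_Qop[OF s] by blast
    have "Qop (\<lambda>x. of_real x ^ Suc n) = (\<lambda>Y. J l (Qop (\<lambda>x. of_real x ^ n)) Y - c * delta [] Y)"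
      unfolding c by simp
    then show ?case using subspD(4)[OF E(1) Jst[OF Suc] subspD(3)[OF E(1) d]] by simp
  qed
  have sm: "sqint M (\<lambda>x. of_real x ^ n)" for n using sq_xn[OF sq_1, of n] by simp
  have sums: "Qop (\<lambda>x. \<Sum>i\<in>T. c i * of_real x ^ i) \<in> ?E" if "finite T" for T and c :: "nat \<Rightarrow> complex"
    using that
  proof (induction T rule: finite_induct)
    case empty
    have "Qop (\<lambda>x. 0 * 0) = (\<lambda>Y. 0 * Qop (\<lambda>x. 0) Y)" by (rule Qop_cmult)
    then show ?case using subspD(1)[OF E(1)] by simp
  next
    case (insert i T)
    have s: "sqint M (\<lambda>x. \<Sum>i\<in>T. c i * of_real x ^ i)" by (intro sqint_sum sqint_cmult sm insert)
    have "Qop (\<lambda>x. c i * of_real x ^ i) \<in> ?E" unfolding Qop_cmult by (rule subspD(3)[OF E(1) mon])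
    from subspD(2)[OF E(1) this insert.IH]
    show ?case unfolding Qop_add[OF sqint_cmult[OF sm] s, symmetric] using insert by simp
  qed
  have pols: "Qop (pol p) \<in> ?E" for p
    using sums[of "{..degree p}" "coeff p"] by (simp add: pol_def[abs_def] poly_altdef)
  obtain C where C: "C > 0" "\<And>u. sqint M u \<Longrightarrow> n2 (Qop u) \<le> C * nrm M u" using Qop_bound by blast
  have "\<exists>\<phi>\<in>?E. n2 (\<lambda>Y. Qop u Y - \<phi> Y) < \<epsilon>" if e: "\<epsilon> > 0" for \<epsilon>
  proof -
    have "\<epsilon> / C > 0" using e C(1) by simp
    then obtain p where p: "nrm M (\<lambda>x. u x - pol p x) < \<epsilon> / C"
      using polynomials_dense[OF u] unfolding approx_def by blast
    have "Qop (\<lambda>x. u x - pol p x) = (\<lambda>Y. Qop u Y - Qop (pol p) Y)"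
      using Qop_add[OF u sqint_cmult[OF sqint_pol], of "-1" p] Qop_cmult[of "-1" "pol p"] by simp
    then have "n2 (\<lambda>Y. Qop u Y - Qop (pol p) Y) \<le> C * nrm M (\<lambda>x. u x - pol p x)"
      using C(2)[OF sqint_diff[OF u sqint_pol], of p] by simp
    also have "\<dots> < \<epsilon>" using p C(1) by (simp add: field_simps)
    finally show ?thesis using pols by blast
  qed
  then have "Qop u \<in> l2_closure ?E" unfolding l2_closure_iff[OF E(2)] using Qop_l2[OF u] by blast
  then show ?thesis using E(3) by simp
qed

text \<open>In child subtree i, \<open>Qop u\<close> has density \<open>sqrt (A i)\<close> kap_i u
  and \<open>Vop [] v\<close> has density \<open>sg i\<close> v. Matching f on subtree j and 0 on
  the other is a linear 2 by 2 system whose determinant is D / sqrt(A1 A2); D is at least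
  \<open>A I1 * k0\<close>, so u and v are square-integrable.\<close>

lemma children_split:
  assumes f: "sqint M f"
  obtains u v where "sqint M u" "sqint M v" "sh [j] (U j f) = (\<lambda>Y. Qop u Y + Vop [] v Y)"
proof -
  define D where "D x = A I1 * kap I1 x + A I2 * kap I2 x" for x
  have Dpos: "D x > 0" for x unfolding D_def using A_pos kap_pos by (intro add_pos_pos mult_pos_pos)
  have Dlow: "D x \<ge> A I1 * k0" for x
    unfolding D_def using A_pos[of I1] A_pos[of I2] kap_bounds(2)[of I1 x] kap_pos[of I2 x]
    by (intro order_trans[OF mult_left_mono[OF kap_bounds(2)[of I1 x]]]) auto
  have Dm [measurable]: "D \<in> borel_measurable borel" unfolding D_def[abs_def] by measurable
  define u where "u x = of_real (sqrt (A j) / D x) * f x" for x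
  have u: "sqint M u" unfolding u_def[abs_def]
  proof (rule sqint_bounded_mult[OF f])
    show "cmod (complex_of_real (sqrt (A j) / D x)) \<le> sqrt (A j) / (A I1 * k0)" for x
      using Dlow[of x] Dpos[of x] A_pos[of I1] A_pos[of j] kap_bounds(1) by (simp add: norm_divide frac_le)
  qed measurable
  \<comment> \<open>The equation with right side 0, in the subtree other than j, determines v from
    u.\<close>
  define v where "v = (if j = I1 then (\<lambda>x. of_real (- A I2) * (u x * ck I2 x)) else (\<lambda>x. of_real (A I1) * (u x * ck I1 x)))"
  have v: "sqint M v" unfolding v_def by (cases j) (simp_all only: if_True if_False idx.distinct simp_thms sqint_cmult sq_kap u)
  have comp: "of_real (sqrt (A i)) * U i (\<lambda>x. u x * ck i x) V + of_real (sg i) * U i v V = (if i = j then U i f V else 0)" for i V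
  proof -
    have "of_real (sqrt (A i)) * U i (\<lambda>x. u x * ck i x) V + of_real (sg i) * U i v V
       = U i (\<lambda>x. of_real (sqrt (A i)) * (u x * ck i x) + of_real (sg i) * v x) V"
      using U_add[OF sqint_cmult[OF sq_kap[OF u]] sqint_cmult[OF v], of i "of_real (sqrt (A i))" i "of_real (sg i)"]
      by (simp add: U_cmult)
    also have "(\<lambda>x. of_real (sqrt (A i)) * (u x * ck i x) + of_real (sg i) * v x) = (\<lambda>x. if i = j then f x else 0)"
    proof
      fix x
      have r: "sqrt (A i) * (sqrt (A j) / D x * kap i x) + sg i *
         (if j = I1 then - A I2 * (sqrt (A j) / D x * kap I2 x) else A I1 * (sqrt (A j) / D x * kap I1 x)) = (if i = j then 1 else 0)"
      proof -
        have *: "s * (s / d * p) - 1 / s * - (t * t * (s / d * q)) = 1" "t * (t / d * q) + 1 / t * (s * s * (t / d * p)) = 1"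
          "s * (t / d * p) - 1 / s * (s * s * (t / d * p)) = 0" "t * (s / d * q) + 1 / t * - (t * t * (s / d * q)) = 0"
          if "s > 0" "t > 0" "d > 0" "s * s * p + t * t * q = d" for s t p q d :: real
          using that by (simp_all add: field_simps)
        define s t where "s = sqrt (A I1)" and "t = sqrt (A I2)"
        have st: "s > 0" "t > 0" "A I1 = s * s" "A I2 = t * t" using A_pos[of I1] A_pos[of I2] by (auto simp: s_def t_def)
        have "s * s * kap I1 x + t * t * kap I2 x = D x" by (simp add: D_def st)
        note * = *[OF st(1,2) Dpos this]
        have sA: "sqrt (s * s) = s" "sqrt (t * t) = t" using st(1,2) by simp_all
        show ?thesis unfolding sg_def
          by (cases i; cases j) (simp_all only: sA st(3,4) if_True if_False idx.distinct simp_thms * mult_minus_left diff_conv_add_uminus[symmetric] uminus_add_conv_diff add_uminus_conv_diff)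
      qed
      have "of_real (sqrt (A i)) * (u x * ck i x) + of_real (sg i) * v x =
        of_real (sqrt (A i) * (sqrt (A j) / D x * kap i x) + sg i *
         (if j = I1 then - A I2 * (sqrt (A j) / D x * kap I2 x) else A I1 * (sqrt (A j) / D x * kap I1 x))) * f x"
        unfolding u_def v_def by (cases j) (simp_all add: algebra_simps)
      then show "of_real (sqrt (A i)) * (u x * ck i x) + of_real (sg i) * v x = (if i = j then f x else 0)"
        unfolding r by simp
    qed
    finally show ?thesis by (simp add: U_def)
  qed
  have "Qop u Y + Vop [] v Y = sh [I1] (\<lambda>V. if I1 = j then U I1 f V else 0) Y + sh [I2] (\<lambda>V. if I2 = j then U I2 f V else 0) Y" for Y
    unfolding comp[symmetric] sh_add by (simp add: Qop_def Vop_def pr_def)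
  also have "\<dots> Y = sh [j] (U j f) Y" for Y by (cases j) (simp_all add: sh_zero)
  finally have "sh [j] (U j f) = (\<lambda>Y. Qop u Y + Vop [] v Y)" by auto
  with u v show ?thesis by (rule that)
qed

text \<open>What remains is completeness: the orthogonal sum is closed, so it suffices that it
  contains every unit vector.\<close>

theorem tree_decomposition:
  fixes VR defines "VR \<equiv> \<lambda>Z. {Vop Z f |f. sqint M f}"
  shows "(\<forall>Z. is_cyclic_subspace (J l) (VR Z)) \<and>
         (\<exists>\<L>. hilbert_sum \<L> VR \<and> orthogonal_sum l2 (cyclic_subspace (J l) (delta [])) \<L>)"
proof (intro conjI allI exI)
  let ?L = "l2_closure (lin_span (\<Union>Z. VR Z))"
  have VRl2: "VR Z \<subseteq> l2" for Z unfolding VR_def using Vop_l2 by auto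
  then have UVl2: "(\<Union>Z. VR Z) \<subseteq> l2" by blast
  show "is_cyclic_subspace (J l) (VR Z)" for Z
    unfolding is_cyclic_subspace_def VR_def
    by (rule bexI[of _ "Vop Z (\<lambda>x. 1)"]) (use Vop_range(2) Vop_l2[OF sq_1] in auto)
  show "hilbert_sum ?L VR"
    unfolding hilbert_sum_def l2_orthogonal_def
  proof (intro conjI allI impI ballI refl)
    show "closed_subspace (VR Z)" for Z unfolding VR_def by (rule Vop_range)
    show "l2_inner \<phi> \<psi> = 0" if "Z \<noteq> Z'" "\<phi> \<in> VR Z" "\<psi> \<in> VR Z'" for Z Z' \<phi> \<psi>
      using that VRl2[of Z] VRl2[of Z'] Vop_orth by (subst l2_inner_ip) (auto simp: VR_def)
  qed
  let ?E = "cyclic_subspace (J l) (delta [])"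
  have Eeq: "?E = {U l f |f. sqint M f}" by (rule U_range)
  have Ecl: "closed_subspace ?E" unfolding Eeq by (rule U_range)
  have Lcl: "closed_subspace ?L" by (rule closed_subspace_closure[OF UVl2])
  have orth: "ip cnt \<phi> \<psi> = 0" if "\<phi> \<in> ?E" "\<psi> \<in> ?L" for \<phi> \<psi>
  proof -
    obtain g where g: "\<phi> = U l g" "sqint M g" using \<open>\<phi> \<in> ?E\<close> unfolding Eeq by blast
    have "ip cnt \<psi> \<phi> = 0"
    proof (rule orthogonal_closure[OF UVl2 _ _ \<open>\<psi> \<in> ?L\<close>])
      show "\<phi> \<in> l2" using g U_bounds(1) by simp
      show "ip cnt \<eta> \<phi> = 0" if *: "\<eta> \<in> (\<Union>Z. VR Z)" for \<eta>
      proof -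
        obtain Z f where "\<eta> = Vop Z f" "sqint M f" using * unfolding VR_def by blast
        then show ?thesis using Vop_orth_U[of f g l Z] g ip_cnj[of \<eta> \<phi>] by simp
      qed
    qed
    then show ?thesis using ip_cnj[of \<phi> \<psi>] by simp
  qed
  let ?S = "{\<lambda>Y. \<phi> Y + \<psi> Y |\<phi> \<psi>. \<phi> \<in> ?E \<and> \<psi> \<in> ?L}"
  have Scl: "closed_subspace ?S" by (rule closed_subspace_sum[OF Ecl Lcl orth])
  note S = closed_subspaceD[OF Scl]
  have ES: "\<phi> \<in> ?S" if "\<phi> \<in> ?E" for \<phi>
    by (intro CollectI exI[of _ \<phi>] exI[of _ "\<lambda>Y. 0"]) (use that subspD(1)[OF closed_subspaceD(1)[OF Lcl]] in auto)
  have LS: "\<psi> \<in> ?S" if "\<psi> \<in> ?L" for \<psi>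
    by (intro CollectI exI[of _ "\<lambda>Y. 0"] exI[of _ \<psi>]) (use that subspD(1)[OF closed_subspaceD(1)[OF Ecl]] in auto)
  have VL: "Vop Z f \<in> ?L" if "sqint M f" for Z f
  proof -
    have "Vop Z f \<in> (\<Union>Z. VR Z)" using that unfolding VR_def by blast
    then show ?thesis
      using lin_span_superset l2_closure_superset[OF lin_span_subset[OF subsp_l2 UVl2]] by blast
  qed
  \<comment> \<open>Induction from a vertex up to the root. \<open>children_split\<close>, moved to
    the subtree at the parent Z, writes a vector of the child's cyclic subspace as one from the
    parent's cyclic subspace plus an element of the space attached to the parent. The root type of
    the subtree operator is the type of its top, hence \<open>hd Z\<close>.\<close>
  have all: "sh Z (U (if Z = [] then l else hd Z) f) \<in> ?S" if "sqint M f" for Z f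
    using that
  proof (induction Z arbitrary: f)
    case Nil
    then have "U l f \<in> ?E" unfolding Eeq by blast
    from ES[OF this] show ?case by (simp add: sh_Nil)
  next
    case (Cons j Z)
    let ?k = "if Z = [] then l else hd Z"
    obtain u v where uv: "sqint M u" "sqint M v" "sh [j] (U j f) = (\<lambda>Y. Qop u Y + Vop [] v Y)"
      using children_split[OF Cons.prems] by metis
    obtain g where g: "Qop u = U ?k g" "sqint M g" using Qop_in_range[OF uv(1), of ?k] by blast
    have "sh (j # Z) (U j f) = sh Z (sh [j] (U j f))" by (simp add: sh_sh)
    also have "\<dots> = (\<lambda>Y. sh Z (U ?k g) Y + Vop Z v Y)"
      unfolding uv(3) g(1) sh_add using Vop_append[of "[]" Z v] by simp
    finally show ?case
      using subspD(2)[OF S(1) Cons.IH[OF g(2)] LS[OF VL[OF uv(2)]]] by simp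
  qed
  \<comment> \<open>Taking f = \<open>kap\<close> for the type of Z makes \<open>U\<close> the unit
    vector at the top of the subtree.\<close>
  have "delta Z \<in> ?S" for Z
    using all[OF sq_ck, of Z "if Z = [] then l else hd Z"] unfolding U_ck sh_delta .
  then have "?S = l2" by (rule closed_subspace_all[OF Scl])
  then show "orthogonal_sum l2 ?E ?L"
    unfolding orthogonal_sum_def l2_orthogonal_def
    using Ecl Lcl orth closed_subspaceD(2)[OF Ecl] closed_subspaceD(2)[OF Lcl]
    by (auto simp: l2_inner_ip subset_iff)
qed

end

section \<open>The Angelesco weights\<close>

context surface_map
begin

text \<open>Off the open cuts \<open>chi\<close> is real at x, so the denominator in
  \<open>Psi\<close> is 0 and division by zero returns 0. Knowing the values at every x makes the
  integrands visibly measurable.\<close>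

lemma Psi_outside:
  assumes "x \<notin> Ko" shows "Psi chi A B i V x = 0"
proof -
  have "Im (X S0 (of_real x)) = 0"
  proof (cases "x \<in> bp")
    case False
    have "\<not> (a j < x \<and> x < b j)" for j using assms by (auto simp: Ko_def)
    from this[of I1] this[of I2] False have "x < a I1 \<or> b I2 < x \<or> b I1 < x \<and> x < a I2"
      by (auto simp: bp_eq)
    then show ?thesis by (intro X_real_pos prd_pos)
  qed (rule X0_bp_real)
  then have "Im (M_fun chi B i (S0, Some (of_real x))) = 0"
    using chi_finite(1)[OF in_surface(2), of "of_real x"] by (simp add: M_fun_def Im_divide)
  then show ?thesis by (simp add: Psi_def)
qed

lemma tree_model_omega:
  "\<exists>R k0 k1. tree_model (omega_c a b) R A B kap psiW k0 k1"
proof -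
  obtain k0 k1 where k: "0 < k0" "\<And>j x. k0 \<le> kap j x \<and> kap j x \<le> k1" using kap_bounds by blast
  obtain R where R: "\<And>x. x \<in> K \<Longrightarrow> \<bar>x\<bar> \<le> R"
    using compact_imp_bounded[OF compact_K] by (auto simp: bounded_iff)
  have eigen: "jacobi_op A B i (\<lambda>V. of_real (psiW i V x)) V = of_real (x * psiW i V x)" if "x \<in> Ko" for x i V
  proof -
    have "jacobi_op A B i (\<lambda>V. of_real (psiW i V x)) V =
      of_real ((\<Sum>j\<in>{I1, I2}. sqrt (A j) * psiW i (j # V) x) + (if V = [] then 0 else sqrt (A (hd V)) * psiW i (tl V) x)
        + B (if V = [] then i else hd V) * psiW i V x)"
      by (simp add: jacobi_op_eq)
    then show ?thesis unfolding psiW_eigen[OF that] .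
  qed
  have "tree_model (omega_c a b) R A B kap psiW k0 k1"
    unfolding tree_model_def tree_model_axioms_def compact_measure_def compact_measure_axioms_def
  proof (intro conjI allI)
    show "finite_measure (omega_c a b)" by (rule omega_finite)
    show "AE x in omega_c a b. \<bar>x\<bar> \<le> R" using omega_AE by eventually_elim (use R Ko_K in auto)
    show "AE x in omega_c a b. \<forall>i V. jacobi_op A B i (\<lambda>V. of_real (psiW i V x)) V = of_real (x * psiW i V x)"
      using omega_AE by eventually_elim (use eigen in auto)
    show "(\<integral>x. psiW i V x * kap i x \<partial>(omega_c a b)) = (if V = [] then 1 else 0)" for i V
      by (rule psiW_moment)
  qed (use k A_pos kap_measurable psiW_measurable psiW_bounded psiW_root in auto)
  then show ?thesis by blast
qed

lemma decomposition:
  "(\<forall>Z. is_cyclic_subspace (jacobi_op A B l) (C_hat a b chi A B Z)) \<and>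
   (\<exists>\<L>. hilbert_sum \<L> (C_hat a b chi A B) \<and>
        orthogonal_sum l2 (cyclic_subspace (jacobi_op A B l) (delta [])) \<L>)"
proof -
  obtain R k0 k1 where "tree_model (omega_c a b) R A B kap psiW k0 k1" using tree_model_omega by blast
  then interpret T: tree_model "omega_c a b" R A B kap psiW k0 k1 .
  have L2: "L2_fun (omega_c a b) = {f. sqint (omega_c a b) f}" by (simp add: L2_fun_def sqint_def)
  have hat: "(\<integral>x. f x * of_real (Psi_hat chi A B Z Y x) \<partial>(omega_c a b)) = T.Vop Z f Y"
    if f: "sqint (omega_c a b) f" for f Z Y
  proof (cases "\<exists>j W. Y = W @ j # Z")
    case True
    then obtain j W where Y: "Y = W @ j # Z" by blast
    have the: "(THE V. W @ j # Z = V @ j # Z) = W" by (rule the_equality) auto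
    have only: "suffix (i # Z) Y \<longleftrightarrow> i = j" for i
      unfolding Y by (auto simp: suffix_def)
    note m = sqintD(1)[OF f, measurable] psiW_measurable[measurable]
    have Kom [measurable]: "Ko \<in> sets borel" by (auto simp: Ko_def intro!: borel_open)
    \<comment> \<open>\<open>Psi\<close> and \<open>psiW\<close> may differ off \<open>Ko\<close>.
      The exact formula serves measurability; the integral sees only the almost sure
      equality.\<close>
    have hat: "Psi_hat chi A B Z Y x = T.sg j * (if x \<in> Ko then psiW j W x else 0)" for x
      unfolding Psi_hat_def only unfolding Psi_sub_def Y
      using Psi_eq[of x] Psi_outside[of x] the by (cases j) (auto simp: T.sg_def)
    have "(\<integral>x. f x * of_real (Psi_hat chi A B Z Y x) \<partial>(omega_c a b)) =
      (\<integral>x. of_real (T.sg j) * (f x * of_real (psiW j W x)) \<partial>(omega_c a b))"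
    proof (rule integral_cong_AE)
      show "(\<lambda>x. f x * of_real (Psi_hat chi A B Z Y x)) \<in> borel_measurable (omega_c a b)"
        unfolding hat by measurable
      show "AE x in omega_c a b. f x * of_real (Psi_hat chi A B Z Y x) = of_real (T.sg j) * (f x * of_real (psiW j W x))"
        using omega_AE by eventually_elim (simp add: hat)
    qed measurable
    also have "\<dots> = of_real (T.sg j) * T.U j f W" by (simp add: T.U_def)
    also have "\<dots> = T.Vop Z f Y"
    proof -
      have "T.pr Z f i Y = (if i = j then of_real (T.sg j) * T.U j f W else 0)" for i
        using only[of i] unfolding T.pr_def by (auto simp: sh_outside Y)
      then show ?thesis by (cases j) (simp_all add: T.Vop_def)
    qed
    finally show ?thesis .
  next
    case False
    then have "\<not> suffix (j # Z) Y" for j by (auto simp: suffix_def)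
    then show ?thesis by (simp add: Psi_hat_def T.Vop_def T.pr_def sh_outside)
  qed
  have "C_hat a b chi A B = (\<lambda>Z. {T.Vop Z f |f. sqint (omega_c a b) f})"
  proof
    fix Z
    have e: "(\<lambda>Y. \<integral>x. f x * of_real (Psi_hat chi A B Z Y x) \<partial>(omega_c a b)) = T.Vop Z f"
      if "sqint (omega_c a b) f" for f
      using hat[OF that] by blast
    show "C_hat a b chi A B Z = {T.Vop Z f |f. sqint (omega_c a b) f}"
      unfolding C_hat_def L2 using e by (auto, metis+)
  qed
  then show ?thesis using T.tree_decomposition[of l] by simp
qed

end

lemma support_subset:
  assumes "closed F" "emeasure \<mu> (- F) = 0" shows "measure_support \<mu> \<subseteq> F"
  using assms by (force simp: measure_support_def)

theorem theorem4p2p3: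
  fixes \<alpha> \<beta> :: "idx \<Rightarrow> real" and c :: real and l :: idx
    and \<omega> :: "idx \<Rightarrow> real measure" and a b :: "idx \<Rightarrow> real"
    and chi :: "spoint \<Rightarrow> sphere" and A B :: "idx \<Rightarrow> real"
  assumes "\<alpha> I1 < \<beta> I1" and "\<beta> I1 < \<alpha> I2" and "\<alpha> I2 < \<beta> I2"
    and "0 < c" and "c < 1"
    and "angelesco_equilibrium \<alpha> \<beta> c \<omega>"
    and "\<And>i. a i < b i \<and> measure_support (\<omega> i) = {a i..b i}"
    and "normalized_conformal_map a b chi"
    and "expansion_constants chi A B"
  shows "(\<forall>Z. is_cyclic_subspace (jacobi_op A B l) (C_hat a b chi A B Z)) \<and>
         (\<exists>\<L>. hilbert_sum \<L> (C_hat a b chi A B) \<and>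
              orthogonal_sum l2 (cyclic_subspace (jacobi_op A B l) (delta [])) \<L>)"
proof -
  \<comment> \<open>The equilibrium measures vanish off the given closed intervals, so their
    supports lie inside and the cuts inherit the separation of these intervals.\<close>
  have "{a i..b i} \<subseteq> {\<alpha> i..\<beta> i}" for i
    using support_subset[of "{\<alpha> i..\<beta> i}" "\<omega> i"] assms(6,7)
    by (auto simp: angelesco_equilibrium_def angelesco_admissible_def)
  then have "a i \<in> {\<alpha> i..\<beta> i}" "b i \<in> {\<alpha> i..\<beta> i}" for i
    using assms(7)[of i] by (auto simp: subset_iff)
  from this(2)[of I1] this(1)[of I2] have "b I1 < a I2" using assms(2) by simp
  then interpret surface_map a b chi A B
    using assms(7-9) by unfold_locales auto
  show ?thesis by (rule decomposition)
qed

end
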